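(* The infinite word $\mathbf{p}\,\tau(\varphi(\mathbf{s}))$ is $5/4$-power-free, where $\mathbf{s}=\mathbf{z}\,\varphi(\mathbf{z})\,\varphi^2(\mathbf{z})\cdots$.
   Context: Let $\Sigma_8=\{n_j : n\in\mathbb{Z},\ 0\le j\le 7\}$ be the infinite alphabet of distinct formal symbols $n_j$. Let $\varphi$ be the $6$-uniform morphism on $\Sigma_8$ (extended to finite and infinite words by concatenation) defined for all $n\in\mathbb{Z}$ by $\varphi(n_0)=0_0 1_1 0_2 0_3 1_4 (n+3)_5$, $\varphi(n_1)=1_6 1_7 0_0 0_1 0_2 (n+2)_3$, $\varphi(n_2)=1_4 1_5 1_6 0_7 0_0 (n+3)_1$, $\varphi(n_3)=0_2 1_3 1_4 0_5 1_6 (n+2)_7$, $\varphi(n_4)=0_0 1_1 0_2 0_3 1_4 (n+1)_5$, $\varphi(n_5)=1_6 1_7 0_0 0_1 0_2 (n+2)_3$, $\varphi(n_6)=1_4 1_5 1_6 0_7 0_0 (n+1)_1$, $\varphi(n_7)=0_2 1_3 1_4 0_5 1_6 (n+2)_7$. Let $\tau$ be the coding $\tau(n_j)=n$, applied letterwise. A word over $\Sigma_8$ is subscript-increasing if the subscripts of consecutive letters increase by $1$ modulo $8$. A $5/4$-power is a word $xyx$ with $|x|\ge1$ and $|y|=3|x|$; a word is $5/4$-power-free if no factor is a $5/4$-power. Let $\mathbf{w}_{5/4}=w(0)w(1)\cdots$ be the lexicographically least infinite $5/4$-power-free word over $\mathbb{N}=\{0,1,2,\dots\}$. Let $\mathbf{p}$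 be the prefix of $\mathbf{w}_{5/4}$ of length $6764$. Let $\mathbf{z}$ be the length-$20226$ subscript-increasing word over $\Sigma_8$ starting with the letter $0_2$ and satisfying $\tau(\varphi(\mathbf{z}))=w(6764)w(6765)\cdots w(6764+6\cdot 20226-1)$ (it begins $0_2 0_3 3_4 0_5 1_6 1_7 (-1)_0 2_1\cdots$ and ends $\cdots 0_0 0_1 0_2 3_3$). *)

theory Defs
  imports Complex_Main "HOL-Library.Stream"
begin

text \<open>Finite words are lists and infinite words are streams.\<close>

definition is_five_fourths_power :: "'a list \<Rightarrow> bool" where
  "is_five_fourths_power u \<longleftrightarrow>
     (\<exists>x y. u = x @ y @ x \<and> length x \<ge> 1 \<and> length y = 3 * length x)"

definition is_factor :: "'a list \<Rightarrow> 'a stream \<Rightarrow> bool" where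
  "is_factor u w \<longleftrightarrow> (\<exists>a b. w = a @- u @- b)"

definition five_fourths_power_free :: "'a stream \<Rightarrow> bool" where
  "five_fourths_power_free w \<longleftrightarrow> \<not> (\<exists>u. is_factor u w \<and> is_five_fourths_power u)"

definition lex_less :: "nat stream \<Rightarrow> nat stream \<Rightarrow> bool" where
  "lex_less u v \<longleftrightarrow> (\<exists>i. (\<forall>k<i. u !! k = v !! k) \<and> u !! i < v !! i)"

definition is_lex_least_power_free :: "nat stream \<Rightarrow> bool" where
  "is_lex_least_power_free w \<longleftrightarrow>
     five_fourths_power_free w \<and>
     (\<forall>v. five_fourths_power_free v \<longrightarrow> v = w \<or> lex_less w v)"

definition w54 :: "nat stream" where
  "w54 = (THE w. is_lex_least_power_free w)"

text \<open>Such a word exists (choose greedily: a letter that has not been used yet never completes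
  a \<open>5/4\<close>-power) and is unique, so \<^const>\<open>w54\<close> is well defined.\<close>

definition power_free_list :: "'a list \<Rightarrow> bool" where
  "power_free_list l \<longleftrightarrow> \<not> (\<exists>a u b. l = a @ u @ b \<and> is_five_fourths_power u)"

lemma power_free_iff_prefixes:
  "five_fourths_power_free w \<longleftrightarrow> (\<forall>n. power_free_list (stake n w))"
proof
  assume f: "five_fourths_power_free w"
  show "\<forall>n. power_free_list (stake n w)"
  proof (rule allI, rule ccontr)
    fix n assume "\<not> power_free_list (stake n w)"
    then obtain a u b where e: "stake n w = a @ u @ b" and u: "is_five_fourths_power u"
      by (auto simp: power_free_list_def)
    have "w = (a @ u @ b) @- sdrop n w"
      using stake_sdrop[of n w] e by simp
    hence "w = a @- u @- (b @- sdrop n w)"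
      by simp
    with u f show False
      by (auto simp: five_fourths_power_free_def is_factor_def)
  qed
next
  assume f: "\<forall>n. power_free_list (stake n w)"
  show "five_fourths_power_free w"
    unfolding five_fourths_power_free_def
  proof
    assume "\<exists>u. is_factor u w \<and> is_five_fourths_power u"
    then obtain a u b where e: "w = a @- u @- b" and u: "is_five_fourths_power u"
      by (auto simp: is_factor_def)
    have "stake (length a + length u) w = a @ u @ []"
      by (simp add: e stake_shift)
    with f u show False
      unfolding power_free_list_def by blast
  qed
qed

lemma power_free_list_fresh:
  assumes "power_free_list l" "m \<notin> set l"
  shows "power_free_list (l @ [m])"
  unfolding power_free_list_def
proof
  assume "\<exists>a u b. l @ [m] = a @ u @ b \<and> is_five_fourths_power u"
  then obtain a u b where e: "l @ [m] = a @ u @ b" and u: "is_five_fourths_power u"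
    by blast
  show False
  proof (cases b rule: rev_cases)
    case (snoc b' c)
    hence "l = a @ u @ b'" using e by simp
    with assms(1) u show False by (auto simp: power_free_list_def)
  next
    case Nil
    from u obtain x y where xy: "u = x @ y @ x" "length x \<ge> 1"
      by (auto simp: is_five_fourths_power_def)
    then obtain x' c where x: "x = x' @ [c]"
      by (cases x rule: rev_cases) auto
    have "l @ [m] = (a @ x' @ [c] @ y @ x') @ [c]"
      using e Nil xy x by simp
    hence "l = a @ x' @ [c] @ y @ x'" "m = c"
      by (blast dest: append1_eq_conv[THEN iffD1])+
    with assms(2) show False by simp
  qed
qed

primrec greedy :: "nat \<Rightarrow> nat list" where
  "greedy 0 = []"
| "greedy (Suc n) = greedy n @ [LEAST m. power_free_list (greedy n @ [m])]"

lemma power_free_list_greedy: "power_free_list (greedy n)"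
proof (induction n)
  case 0
  show ?case by (auto simp: power_free_list_def is_five_fourths_power_def)
next
  case (Suc n)
  obtain m where "m \<notin> set (greedy n)"
    using ex_new_if_finite[OF infinite_UNIV_nat, of "set (greedy n)"] by auto
  hence "power_free_list (greedy n @ [m])"
    by (rule power_free_list_fresh[OF Suc])
  hence "power_free_list (greedy n @ [LEAST m. power_free_list (greedy n @ [m])])"
    by (rule LeastI)
  thus ?case by simp
qed

lemma is_lex_least_power_free_ex1: "\<exists>!w. is_lex_least_power_free w"
proof -
  define w where "w = smap (\<lambda>n. greedy (Suc n) ! n) nats"
  have len: "length (greedy n) = n" for n
    by (induction n) auto
  have nth: "w !! n = (LEAST m. power_free_list (greedy n @ [m]))" for n
    using len[of n] by (simp add: nth_append w_def)
  have pre: "stake n w = greedy n" for n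
  proof (induction n)
    case (Suc n)
    thus ?case unfolding stake_Suc nth by simp
  qed simp
  have w_free: "five_fourths_power_free w"
    unfolding power_free_iff_prefixes pre using power_free_list_greedy by blast
  have w_least: "v = w \<or> lex_less w v" if v: "five_fourths_power_free v" for v
  proof (rule disjCI)
    assume "\<not> lex_less w v"
    hence nl: "\<not> w !! i < v !! i" if "\<forall>k<i. w !! k = v !! k" for i
      using that unfolding lex_less_def by blast
    have eq: "v !! n = w !! n" for n
    proof (induction n rule: less_induct)
      case (less n)
      have "stake n v = greedy n"
        unfolding pre[symmetric] using less by (intro nth_equalityI) auto
      hence "power_free_list (greedy n @ [v !! n])"
        using v unfolding power_free_iff_prefixes by (metis stake_Suc)
      hence "w !! n \<le> v !! n"
        unfolding nth by (rule Least_le)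
      with nl[of n] less show ?case by force
    qed
    have "(!!) v = (!!) w"
      using eq by (rule ext)
    thus "v = w"
      by (metis stream_smap_nats)
  qed
  have asym: "\<not> lex_less u v" if "lex_less v u" for u v
  proof
    assume "lex_less u v"
    then obtain i where i: "\<forall>k<i. u !! k = v !! k" "u !! i < v !! i"
      unfolding lex_less_def by blast
    from that obtain j where j: "\<forall>k<j. v !! k = u !! k" "v !! j < u !! j"
      unfolding lex_less_def by blast
    from i j show False by (cases i j rule: linorder_cases) auto
  qed
  show ?thesis
  proof (rule ex1I[of _ w])
    show "is_lex_least_power_free w"
      unfolding is_lex_least_power_free_def using w_free w_least by blast
    show "v = w" if "is_lex_least_power_free v" for v
      using that w_free w_least[of v] asym[of w v]
      unfolding is_lex_least_power_free_def by blast
  qed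
qed

lemma is_lex_least_power_free_w54: "is_lex_least_power_free w54"
  unfolding w54_def by (rule theI'[OF is_lex_least_power_free_ex1])

text \<open>The letter \<open>n\<^sub>j\<close> is the pair \<open>(n, j)\<close>; it belongs to the alphabet iff \<open>j \<le> 7\<close>.\<close>

type_synonym letter = "int \<times> nat"

definition Sigma8 :: "letter set" where
  "Sigma8 = {(n, j). j \<le> 7}"

definition tau :: "letter \<Rightarrow> int" where
  "tau = fst"

text \<open>The value outside \<^const>\<open>Sigma8\<close> (\<open>j > 7\<close>, covered by the last branch) is irrelevant.\<close>

fun phi_letter :: "letter \<Rightarrow> letter list" where
  "phi_letter (n, j) =
    (if j = 0 then [(0,0), (1,1), (0,2), (0,3), (1,4), (n+3,5)]
     else if j = 1 then [(1,6), (1,7), (0,0), (0,1), (0,2), (n+2,3)]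
     else if j = 2 then [(1,4), (1,5), (1,6), (0,7), (0,0), (n+3,1)]
     else if j = 3 then [(0,2), (1,3), (1,4), (0,5), (1,6), (n+2,7)]
     else if j = 4 then [(0,0), (1,1), (0,2), (0,3), (1,4), (n+1,5)]
     else if j = 5 then [(1,6), (1,7), (0,0), (0,1), (0,2), (n+2,3)]
     else if j = 6 then [(1,4), (1,5), (1,6), (0,7), (0,0), (n+1,1)]
     else [(0,2), (1,3), (1,4), (0,5), (1,6), (n+2,7)])"

definition phi :: "letter list \<Rightarrow> letter list" where
  "phi u = concat (map phi_letter u)"

definition phi_inf :: "letter stream \<Rightarrow> letter stream" where
  "phi_inf s = flat (smap phi_letter s)"

definition subscript_increasing :: "letter list \<Rightarrow> bool" where
  "subscript_increasing u \<longleftrightarrow>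
     (\<forall>i. Suc i < length u \<longrightarrow> snd (u ! Suc i) = (snd (u ! i) + 1) mod 8)"

definition iterated_word :: "letter list \<Rightarrow> letter stream" where
  "iterated_word z = flat (siterate phi z)"  \<comment> \<open>\<open>z \<phi>(z) \<phi>\<^sup>2(z) \<dots>\<close>\<close>

end

theory Submission
  imports Defs
begin

text \<open>
  In \<open>\<phi>(n\<^sub>j)\<close> only the last letter depends on \<open>n\<close>; call its value \<open>n + d\<^sub>j\<close>. Outside of a prefix the
  word \<open>\<^bold>p \<tau>(\<phi>(\<^bold>s))\<close> therefore has period 24, except that every sixth letter is taken from the
  sequence \<open>\<sigma>\<close> of the numbers \<open>n + d\<^sub>j\<close> belonging to the letters \<open>n\<^sub>j\<close> of \<open>\<^bold>s\<close>, and these exceed all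
  the others. Hence a power \<open>xyx\<close> in the periodic part has \<open>6\<close> dividing \<open>|x|\<close> and comes from a power
  in \<open>\<sigma>\<close> that is six times shorter. As \<open>\<^bold>s = \<^bold>z \<phi>(\<^bold>s)\<close>, the sequence \<open>\<sigma>\<close> itself has the same shape,
  so it is free of powers by induction on \<open>|x|\<close>, once the powers beginning in the prefix are
  excluded. If \<open>x\<close> is long, it contains a letter of the prefix that deviates from the periodic
  pattern; this leaves finitely many powers, which are refuted by rewriting.

  The letters of the prefix are identified without knowing that \<open>\<^bold>w\<close> is the word constructed here:
  at the first difference of the two, the letter of \<open>\<^bold>w\<close> would be smaller by minimality, but every
  smaller letter completes a power.
\<close>

section \<open>Checking powers by rewriting\<close>

text \<open>The word \<open>z\<close> is given only through 6 * 20226 letters of \<open>w54\<close>,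
  so \<open>w54\<close> has to be identified up to position 6764 + 6 * 20226 = 128120, far beyond
  the stored letters. Minimality is therefore lifted along \<phi> as well: if a smaller letter would
  complete a power in \<sigma>, the same letter at the corresponding place of \<open>w54\<close>
  completes a power six times as long. The letters 0 and 1, which \<sigma> never contains, complete
  powers with |x| \<le> 2 wherever they are too small. The numbers n + d_j make both levels alike:
  they are what \<tau>(\<phi>(s)) displays, whereas n itself can be negative. The last letter of
  each block has an odd subscript, and d_j = 2 for odd j; so on the level of \<sigma> the copied
  entries grow by exactly 2. The other letters of \<phi>(n_j) agree for j and j + 4, whence period
  24 rather than 48. The stored lengths 8468 = 6764 + 24 * 71 and 25290 = 20226 + 24 * 211 consist
  of the prefix and whole periods; each power xyx whose second x begins in the prefix ends within
  them.\<close>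

datatype chunk = C
  (d0: nat) (d1: nat) (d2: nat) (d3: nat) (d4: nat) (d5: nat) (d6: nat) (d7: nat)
  (d8: nat) (d9: nat) (d10: nat) (d11: nat) (d12: nat) (d13: nat) (d14: nat) (d15: nat)

definition blank :: chunk where
  "blank = C 0 0 0 0 0 0 0 0 0 0 0 0 0 0 0 0"

text \<open>Words are stored in chunks of 16 letters and addressed by binary numerals, so that the
  simplifier finds a letter in a few rewrite steps. Letter \<open>i\<close> has address \<open>i + 4096\<close>: the offset
  keeps all subtractions of addresses below within the range where \<open>num_diff\<close> is correct. Values of
  \<open>chunk_at\<close> and \<open>letter_at\<close> outside of the stored range are junk.\<close>

definition chunk_at :: "chunk list \<Rightarrow> num \<Rightarrow> chunk" where
  "chunk_at A m = (if 256 \<le> nat_of_num m \<and> nat_of_num m - 256 < length A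
             then A ! (nat_of_num m - 256) else blank)"

fun letter_at :: "chunk list \<Rightarrow> num \<Rightarrow> nat" where
  "letter_at A (num.Bit0 (num.Bit0 (num.Bit0 (num.Bit0 m)))) = d0 (chunk_at A m)"
| "letter_at A (num.Bit1 (num.Bit0 (num.Bit0 (num.Bit0 m)))) = d1 (chunk_at A m)"
| "letter_at A (num.Bit0 (num.Bit1 (num.Bit0 (num.Bit0 m)))) = d2 (chunk_at A m)"
| "letter_at A (num.Bit1 (num.Bit1 (num.Bit0 (num.Bit0 m)))) = d3 (chunk_at A m)"
| "letter_at A (num.Bit0 (num.Bit0 (num.Bit1 (num.Bit0 m)))) = d4 (chunk_at A m)"
| "letter_at A (num.Bit1 (num.Bit0 (num.Bit1 (num.Bit0 m)))) = d5 (chunk_at A m)"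
| "letter_at A (num.Bit0 (num.Bit1 (num.Bit1 (num.Bit0 m)))) = d6 (chunk_at A m)"
| "letter_at A (num.Bit1 (num.Bit1 (num.Bit1 (num.Bit0 m)))) = d7 (chunk_at A m)"
| "letter_at A (num.Bit0 (num.Bit0 (num.Bit0 (num.Bit1 m)))) = d8 (chunk_at A m)"
| "letter_at A (num.Bit1 (num.Bit0 (num.Bit0 (num.Bit1 m)))) = d9 (chunk_at A m)"
| "letter_at A (num.Bit0 (num.Bit1 (num.Bit0 (num.Bit1 m)))) = d10 (chunk_at A m)"
| "letter_at A (num.Bit1 (num.Bit1 (num.Bit0 (num.Bit1 m)))) = d11 (chunk_at A m)"
| "letter_at A (num.Bit0 (num.Bit0 (num.Bit1 (num.Bit1 m)))) = d12 (chunk_at A m)"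
| "letter_at A (num.Bit1 (num.Bit0 (num.Bit1 (num.Bit1 m)))) = d13 (chunk_at A m)"
| "letter_at A (num.Bit0 (num.Bit1 (num.Bit1 (num.Bit1 m)))) = d14 (chunk_at A m)"
| "letter_at A (num.Bit1 (num.Bit1 (num.Bit1 (num.Bit1 m)))) = d15 (chunk_at A m)"
| "letter_at A _ = 0"

definition word :: "chunk list \<Rightarrow> nat \<Rightarrow> nat" where
  "word A i = letter_at A (num_of_nat (i + 4096))"

primrec tab :: "(num \<Rightarrow> chunk) \<Rightarrow> num \<Rightarrow> chunk list \<Rightarrow> bool" where
  "tab f m [] = True"
| "tab f m (c # cs) = (f m = c \<and> tab f (Num.inc m) cs)"

primrec adv :: "num \<Rightarrow> 'a list \<Rightarrow> num" where
  "adv m [] = m"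
| "adv m (c # cs) = adv (Num.inc m) cs"

lemma tab_append: "tab f m (cs @ ds) \<longleftrightarrow> tab f m cs \<and> tab f (adv m cs) ds"
  by (induction cs arbitrary: m) simp_all

lemma tab_concat: "tab f m (concat (cs # css)) \<longleftrightarrow> tab f m cs \<and> tab f (adv m cs) (concat css)"
  by (simp add: tab_append)

lemma tab_nth:
  assumes "\<And>i. i < length cs \<Longrightarrow> f (num_of_nat (nat_of_num m + i)) = cs ! i"
  shows "tab f m cs"
  using assms
proof (induction cs arbitrary: m)
  case (Cons c cs)
  have "f (num_of_nat (nat_of_num (Num.inc m) + i)) = cs ! i" if "i < length cs" for i
    using Cons.prems[of "Suc i"] that by (simp add: nat_of_num_inc)
  moreover have "f m = c"
    using Cons.prems[of 0] by (simp add: nat_of_num_inverse)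
  ultimately show ?case using Cons.IH by simp
qed simp

text \<open>The premise \<open>A = cs\<close> keeps the name of the data folded: applied to a data
  definition and unfolded, this is a conjunction of equations \<open>chunk_at A m = C ...\<close>
  that serves the simplifier as a lookup table. The first chunk has address 256 = 4096 / 16.\<close>

lemma tab_chunk_at:
  assumes "A = cs"
  shows "tab (chunk_at A) (num_of_nat 256) cs"
proof (rule tab_nth)
  fix i assume i: "i < length cs"
  have "nat_of_num (num_of_nat (nat_of_num (num_of_nat 256) + i)) = 256 + i"
    by (simp only: num_of_nat_inverse add_pos_nonneg zero_less_numeral zero_le)
  then show "chunk_at A (num_of_nat (nat_of_num (num_of_nat 256) + i)) = cs ! i"
    using i assms by (simp only: chunk_at_def) simp
qed

section \<open>Arithmetic of binary addresses\<close>

lemma nat_of_num_BitM: "nat_of_num (Num.BitM n) = 2 * nat_of_num n - 1"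
  by (metis BitM_plus_one add_diff_cancel_right' mult_2 nat_of_num.simps(1,2) nat_of_num_add One_nat_def)

fun dec :: "num \<Rightarrow> num" where
  "dec num.One = num.One"
| "dec (num.Bit0 m) = Num.BitM m"
| "dec (num.Bit1 m) = num.Bit0 m"

lemma nat_of_num_dec: "m \<noteq> num.One \<Longrightarrow> nat_of_num (dec m) = nat_of_num m - 1"
  by (cases m) (simp_all add: nat_of_num_BitM mult_2)

lemma nat_of_num_gt_1: "m \<noteq> num.One \<Longrightarrow> 1 < nat_of_num m"
proof (cases m)
  case (Bit0 n)
  then show ?thesis using nat_of_num_pos[of n] by simp
next
  case (Bit1 n)
  then show ?thesis using nat_of_num_pos[of n] by simp
qed simp

lemma dec_num_of_nat: "1 < n \<Longrightarrow> dec (num_of_nat n) = num_of_nat (n - 1)"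
  by (rule num_eq_iff[THEN iffD2], subst nat_of_num_dec) (auto simp: num_of_nat_inverse num_eq_iff)

text \<open>Subtraction, correct only for \<open>2 * b \<le> a\<close>: this condition is inherited by all recursive
  calls, which rules out a zero difference of the leading digits.\<close>

fun num_diff :: "num \<Rightarrow> num \<Rightarrow> num" where
  "num_diff a num.One = dec a"
| "num_diff (num.Bit0 a) (num.Bit0 b) = num.Bit0 (num_diff a b)"
| "num_diff (num.Bit1 a) (num.Bit0 b) = num.Bit1 (num_diff a b)"
| "num_diff (num.Bit1 a) (num.Bit1 b) = num.Bit0 (num_diff a b)"
| "num_diff (num.Bit0 a) (num.Bit1 b) = Num.BitM (num_diff a b)"
| "num_diff num.One _ = num.One"

lemma nat_of_num_diff:
  "2 * nat_of_num b \<le> nat_of_num a \<Longrightarrow> nat_of_num (num_diff a b) = nat_of_num a - nat_of_num b"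
proof (induction a b rule: num_diff.induct)
  case (1 a)
  then show ?case by (cases a) (simp_all add: nat_of_num_BitM mult_2)
next
  case (5 a b)
  have "nat_of_num (num_diff a b) = nat_of_num a - nat_of_num b" using 5 by simp
  then show ?case using 5 by (simp add: nat_of_num_BitM)
qed (simp_all add: nat_of_num_pos)

section \<open>Bounded quantifiers over addresses\<close>

definition all_num :: "(num \<Rightarrow> bool) \<Rightarrow> num \<Rightarrow> num \<Rightarrow> bool" where
  "all_num P a n \<longleftrightarrow> (\<forall>x. nat_of_num a \<le> nat_of_num x \<and> nat_of_num x < nat_of_num a + nat_of_num n \<longrightarrow> P x)"

text \<open>Halving the interval along the binary digits of its length needs only additions and
  nests logarithmically deep.\<close>

lemma all_num_simps:
  "all_num P a num.One = P a"
  "all_num P a (num.Bit0 n) = (all_num P a n \<and> all_num P (a + n) n)"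
  "all_num P a (num.Bit1 n) = (all_num P a n \<and> all_num P (a + n) n \<and> P (a + n + n))"
proof -
  define R where "R k l \<longleftrightarrow> (\<forall>x. k \<le> nat_of_num x \<and> nat_of_num x < l \<longrightarrow> P x)" for k l
  have R: "all_num P a n \<longleftrightarrow> R (nat_of_num a) (nat_of_num a + nat_of_num n)" for a n
    by (simp add: all_num_def R_def)
  have split: "R k n \<longleftrightarrow> R k m \<and> R m n" if "k \<le> m" "m \<le> n" for k m n
    using that unfolding R_def by (meson le_trans not_le order_less_le_trans)
  have one: "R (nat_of_num a) (nat_of_num a + 1) = P a" for a
    unfolding R_def by (metis num_eq_iff Suc_eq_plus1 less_Suc_eq linorder_not_less order_refl)
  show "all_num P a num.One = P a"
    using one[of a] by (simp add: R)
  show "all_num P a (num.Bit0 n) = (all_num P a n \<and> all_num P (a + n) n)"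
    using split[of "nat_of_num a" "nat_of_num a + nat_of_num n" "nat_of_num a + nat_of_num n + nat_of_num n"]
    by (simp add: R nat_of_num_add add.assoc)
  show "all_num P a (num.Bit1 n) = (all_num P a n \<and> all_num P (a + n) n \<and> P (a + n + n))"
    using one[of "a + n + n"]
      split[of "nat_of_num a" "nat_of_num a + nat_of_num n" "nat_of_num a + nat_of_num n + nat_of_num n + 1"]
      split[of "nat_of_num a + nat_of_num n" "nat_of_num a + nat_of_num n + nat_of_num n"
        "nat_of_num a + nat_of_num n + nat_of_num n + 1"]
    by (simp add: R nat_of_num_add add.assoc)
qed

definition all_from :: "(num \<Rightarrow> bool) \<Rightarrow> nat \<Rightarrow> nat \<Rightarrow> bool" where
  "all_from P a n \<longleftrightarrow> (\<forall>x. a \<le> x \<and> x < a + n \<longrightarrow> P (num_of_nat x))"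

lemma all_from_numeral: "all_from P (numeral a) (numeral n) = all_num P a n"
proof -
  have "(\<forall>x. k \<le> x \<and> x < l \<longrightarrow> P (num_of_nat x)) \<longleftrightarrow>
      (\<forall>x. k \<le> nat_of_num x \<and> nat_of_num x < l \<longrightarrow> P x)" if "0 < k" for k l
    using that by (metis nat_of_num_inverse num_of_nat_inverse order_less_le_trans)
  then show ?thesis
    by (simp add: all_from_def all_num_def nat_of_num_numeral)
qed

text \<open>Search for a position refuting every power \<open>xyx\<close> with \<open>|x| = h\<close>. The current window, of
  which \<open>t\<close> positions are left, is scanned downwards from its end \<open>c\<close>; a mismatch of \<open>c\<close> and
  \<open>d = c + 4 * h\<close> refutes all windows that contain \<open>c\<close>, so the next window begins at \<open>c + 1\<close>.\<close>

partial_function (option) refutes :: "chunk list \<Rightarrow> num \<Rightarrow> num \<Rightarrow> num \<Rightarrow> num \<Rightarrow> num \<Rightarrow> unit option" where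
  "refutes A L h t c d =
    (if letter_at A c = letter_at A d
     then if t = num.One then None else refutes A L h (dec t) (dec c) (dec d)
     else if L \<le> d + h then Some () else refutes A L h h (c + h) (d + h))"

lemma all_fromD: "all_from P a n \<Longrightarrow> a \<le> x \<Longrightarrow> x < a + n \<Longrightarrow> P (num_of_nat x)"
  by (simp add: all_from_def)

text \<open>Invariant: all starts before c + 1 - t are settled, so only starts i from there on are
  considered. If the letters at c and d differ, every start i \<le> c is refuted by c itself,
  because t \<le> h puts c into the window; the starts i > c are left to the next call. If the scan
  stops since L \<le> d + h = c + 5h, no start i > c satisfies i + 5h \<le> L. The induction is over
  the partial function, as only runs ending in \<open>Some ()\<close> carry information.\<close>

lemma refutes_sound:
  assumes "refutes A L h t c d = Some ()"
    and "nat_of_num d = nat_of_num c + 4 * nat_of_num h"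
    and "nat_of_num t \<le> nat_of_num h" "nat_of_num t \<le> nat_of_num c"
    and "4095 + nat_of_num t \<le> nat_of_num c"
    and "nat_of_num c + 1 - nat_of_num t \<le> i" "i + 5 * nat_of_num h \<le> nat_of_num L"
  shows "\<exists>a. i \<le> a \<and> a < i + nat_of_num h \<and>
    letter_at A (num_of_nat a) \<noteq> letter_at A (num_of_nat (a + 4 * nat_of_num h))"
proof -
  show ?thesis
    using assms
  proof (induction A L h t c d "()" arbitrary: i rule: refutes.raw_induct[rotated, consumes 1, case_names 1])
    case (1 refutes A L h t c d)
    let ?h = "nat_of_num h" and ?c = "nat_of_num c"
    have h: "1 \<le> ?h" using nat_of_num_pos[of h] by simp
    have t: "1 \<le> nat_of_num t" using nat_of_num_pos[of t] by simp
    have cd: "num_of_nat ?c = c" "num_of_nat (?c + 4 * ?h) = d"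
      by (simp_all add: 1(3)[symmetric] nat_of_num_inverse)
    show ?case
    proof (cases "letter_at A c = letter_at A d")
      case True
      then have t1: "t \<noteq> num.One" and r: "refutes A L h (dec t) (dec c) (dec d) = Some ()"
        using 1(2) by (auto split: if_splits)
      have "c \<noteq> num.One" "d \<noteq> num.One"
        using nat_of_num_gt_1[OF t1] 1(3,5) by auto
      then have "nat_of_num (dec c) = ?c - 1" "nat_of_num (dec d) = nat_of_num d - 1"
        "nat_of_num (dec t) = nat_of_num t - 1"
        by (simp_all add: nat_of_num_dec t1)
      then show ?thesis
        using 1(1)[OF r, of i] 1(3-) nat_of_num_gt_1[OF t1] by auto
    next
      case False
      show ?thesis
      proof (cases "i \<le> ?c")
        case True
        then show ?thesis using False cd 1(3-) t by (intro exI[of _ ?c]) auto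
      next
        case ci: False
        show ?thesis
        proof (cases "L \<le> d + h")
          case True
          then show ?thesis using ci 1(3,8) by (simp add: less_eq_num_def nat_of_num_add)
        next
          case nine: False
          have r: "refutes A L h h (c + h) (d + h) = Some ()"
            using 1(2) False nine by simp
          show ?thesis
            using 1(1)[OF r, of i] 1(3-) ci by (auto simp: nat_of_num_add)
        qed
      qed
    qed
  qed
qed

text \<open>Compares the t - 1 letters before a with those before b. The letter at a itself is left
  out, because a hypothetical letter stands there. Here and in \<open>covered\<close>, nested
  conditionals take the place of conjunctions: under \<open>if_weak_cong\<close> the simplifier
  evaluates only the branch taken.\<close>

function run :: "chunk list \<Rightarrow> num \<Rightarrow> num \<Rightarrow> num \<Rightarrow> bool" where
  "run A t a b =
    (if t = num.One then True
     else if letter_at A (dec a) = letter_at A (dec b) then run A (dec t) (dec a) (dec b) else False)"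
  by auto
termination
  by (relation "measure (\<lambda>(A, t, a, b). nat_of_num t)")
     (use nat_of_num_dec nat_of_num_gt_1 in fastforce)+

declare run.simps [simp del]

lemma run_sound:
  assumes "run A t (num_of_nat x) (num_of_nat y)" "nat_of_num t \<le> x" "nat_of_num t \<le> y"
    and "1 \<le> j" "j < nat_of_num t"
  shows "letter_at A (num_of_nat (x - j)) = letter_at A (num_of_nat (y - j))"
  using assms
proof (induction "nat_of_num t" arbitrary: t x y j rule: less_induct)
  case less
  have t: "t \<noteq> num.One" using less.prems by auto
  have dt: "nat_of_num (dec t) = nat_of_num t - 1" by (rule nat_of_num_dec[OF t])
  have xy: "1 < x" "1 < y" using nat_of_num_gt_1[OF t] less.prems by auto
  have eq: "letter_at A (num_of_nat (x - 1)) = letter_at A (num_of_nat (y - 1))"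
    and r: "run A (dec t) (num_of_nat (x - 1)) (num_of_nat (y - 1))"
    using less.prems(1) t xy by (simp_all add: run.simps[of A t] dec_num_of_nat split: if_splits)
  show ?case
  proof (cases "j = 1")
    case False
    have "letter_at A (num_of_nat (x - 1 - (j - 1))) = letter_at A (num_of_nat (y - 1 - (j - 1)))"
      using less.hyps[OF _ r, of "j - 1"] less.prems False nat_of_num_gt_1[OF t] by (simp add: dt)
    then show ?thesis using less.prems False by simp
  qed (use eq in simp)
qed

text \<open>The letter v, put at address a, would complete a power with |x| = k for some listed k.
  The first test says that this power fits: position 0 has address 4096, so 5k + 4095 \<le> a means
  5k \<le> i + 1.\<close>

fun covered :: "chunk list \<Rightarrow> num list \<Rightarrow> num \<Rightarrow> nat \<Rightarrow> bool" where
  "covered A [] a v = False"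
| "covered A (k # ks) a v =
    (if num.Bit0 (num.Bit0 k) + k + num_of_nat 4095 \<le> a
     then if letter_at A (num_diff a (num.Bit0 (num.Bit0 k))) = v
       then if run A k a (num_diff a (num.Bit0 (num.Bit0 k))) then True else covered A ks a v
       else covered A ks a v
     else covered A ks a v)"

text \<open>The bound 1365 comes from \<open>num_diff\<close>, which is correct for 8k \<le> i +
  4096. As 5k \<le> i + 1, the difference i + 4096 - 8k is at least 4095 - 3k, which is nonnegative
  up to k = 1365.\<close>

lemma covered_sound:
  assumes "covered A ks (num_of_nat (i + 4096)) v" "\<And>k. k \<in> set ks \<Longrightarrow> nat_of_num k \<le> 1365"
  shows "\<exists>k\<ge>1. 5 * k \<le> i + 1 \<and> word A (i - 4 * k) = v \<and>
    (\<forall>j. 1 \<le> j \<and> j < k \<longrightarrow> word A (i - j) = word A (i - 4 * k - j))"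
  using assms
proof (induction ks)
  case (Cons k ks)
  define K where "K = nat_of_num k"
  have K: "1 \<le> K" "K \<le> 1365"
    using Cons.prems(2)[of k] nat_of_num_pos[of k] by (auto simp: K_def)
  let ?a = "num_of_nat (i + 4096)" and ?b = "num_diff (num_of_nat (i + 4096)) (num.Bit0 (num.Bit0 k))"
  have a: "nat_of_num ?a = i + 4096" by (rule num_of_nat_inverse) simp
  show ?case
  proof (cases "covered A ks ?a v")
    case False
    have letter_at: "letter_at A ?b = v" and run: "run A k ?a ?b"
      and le: "num.Bit0 (num.Bit0 k) + k + num_of_nat 4095 \<le> ?a"
      using Cons.prems(1) False unfolding covered.simps by (auto split: if_splits simp del: num_of_nat.simps)
    have "5 * K + 4095 \<le> i + 4096"
      using le num_of_nat_inverse[of 4095] unfolding less_eq_num_def nat_of_num_add a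
      by (simp add: K_def del: num_of_nat_numeral_eq)
    then have le: "5 * K \<le> i + 1" by simp
    have "nat_of_num ?b = i + 4096 - 4 * K"
      using K le by (subst nat_of_num_diff) (simp_all add: a K_def del: num_of_nat.simps)
    then have b: "?b = num_of_nat (i + 4096 - 4 * K)"
      by (metis nat_of_num_inverse)
    show ?thesis
    proof (intro exI[of _ K] conjI allI impI)
      show "word A (i - 4 * K) = v" using letter_at le K unfolding b by (simp add: word_def)
      show "word A (i - j) = word A (i - 4 * K - j)" if "1 \<le> j \<and> j < K" for j
        using run_sound[OF run[unfolded b], of j] that le K by (simp add: word_def K_def[symmetric])
    qed (use K le in auto)
  qed (use Cons in auto)
qed simp

text \<open>The bound b is 0 for the prefix of \<open>w54\<close> and 2 for \<sigma>; in the tail of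
  \<open>w54\<close>, letters below 2 are excluded by \<open>wext_forbidden_lt_2\<close>
  instead.\<close>

definition low :: "chunk list \<Rightarrow> num list \<Rightarrow> nat \<Rightarrow> num \<Rightarrow> bool" where
  "low A ks b a = list_all (covered A ks a) [b..<letter_at A a]"

text \<open>The first window is [0, h), and its last position h - 1 has address h + 4095.\<close>

definition start :: "chunk list \<Rightarrow> nat \<Rightarrow> num \<Rightarrow> bool" where
  "start A L h \<longleftrightarrow> refutes A (num_of_nat (L + 4096)) h h (h + num_of_nat 4095)
     (h + num_of_nat 4095 + num.Bit0 (num.Bit0 h)) = Some ()"

lemma start_sound:
  assumes "all_from (start A L) m n" "m \<le> k" "k < m + n" "1 \<le> k" "i + 5 * k \<le> L"
  shows "\<exists>a. i \<le> a \<and> a < i + k \<and> word A a \<noteq> word A (a + 4 * k)"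
proof -
  define h where "h = num_of_nat k"
  have h: "nat_of_num h = k" using assms(4) by (simp add: h_def num_of_nat_inverse)
  have n: "nat_of_num (num_of_nat 4095) = 4095" "nat_of_num (num_of_nat (L + 4096)) = L + 4096"
    by (rule num_of_nat_inverse, simp)+
  have "start A L h" using all_fromD[OF assms(1-3)] by (simp add: h_def)
  then have "refutes A (num_of_nat (L + 4096)) h h (h + num_of_nat 4095)
      (h + num_of_nat 4095 + num.Bit0 (num.Bit0 h)) = Some ()"
    by (simp only: start_def)
  from refutes_sound[OF this, of "i + 4096"]
  have "\<exists>a. i + 4096 \<le> a \<and> a < i + 4096 + k \<and> letter_at A (num_of_nat a) \<noteq> letter_at A (num_of_nat (a + 4 * k))"
    using assms by (simp add: h n nat_of_num_add del: num_of_nat_numeral_eq num_of_nat.simps)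
  then obtain a where a: "i + 4096 \<le> a" "a < i + 4096 + k"
    "letter_at A (num_of_nat a) \<noteq> letter_at A (num_of_nat (a + 4 * k))" by blast
  define b where "b = a - 4096"
  have "a = b + 4096" using a(1) unfolding b_def by linarith
  then show ?thesis
    using a by (intro exI[of _ b]) (simp add: word_def ac_simps)
qed

primrec seq :: "chunk list \<Rightarrow> num \<Rightarrow> nat list \<Rightarrow> bool" where
  "seq A a [] = True"
| "seq A a (v # vs) = (letter_at A a = v \<and> seq A (Num.inc a) vs)"

lemma seq_sound:
  "seq A (num_of_nat n) vs \<Longrightarrow> j < length vs \<Longrightarrow> 0 < n \<Longrightarrow> letter_at A (num_of_nat (n + j)) = vs ! j"
proof (induction vs arbitrary: n j)
  case (Cons v vs)
  have "seq A (num_of_nat (Suc n)) vs" using Cons.prems by simp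
  from Cons.IH[OF this, of "j - 1"] show ?case
    using Cons.prems by (cases j) simp_all
qed simp

lemma all_from_one: "all_from P 1 (numeral n) = all_num P num.One n"
  using all_from_numeral[of P num.One n] by simp

lemma upt_lits:
  "[0..<0] = []" "[0..<1] = [0]" "[0..<2] = [0, 1]" "[0..<3] = [0, 1, 2]" "[0..<4] = [0, 1, 2, 3]"
  "[2..<2] = []" "[2..<3] = [2]" "[2..<4] = [2, 3]" "[2..<5] = [2, 3, 4]" "[2..<6] = [2, 3, 4, 5]"
  by (simp_all add: upt_rec)

lemmas calc = letter_at.simps(1-16) chunk.sel add_num_simps dec.simps BitM.simps num_diff.simps(1-5) run.simps
  refutes.simps covered.simps low_def list.pred_inject upt_lits start_def seq.simps inc.simps all_num_simps all_from_numeral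
  all_from_one if_True if_False rel_simps simp_thms num.distinct le_num_simps numeral_plus_numeral
  num_of_nat_One[OF order_refl] num_of_nat_numeral_eq

section \<open>Powers in words with a periodic part\<close>

text \<open>A word xyx with |x| = k and |y| = 3k has period 4k, so such a power begins at i exactly
  if the k letters from i on reappear 4k positions later. A conflict refutes this.\<close>

definition conflict :: "(nat \<Rightarrow> 'a) \<Rightarrow> nat \<Rightarrow> nat \<Rightarrow> bool" where
  "conflict f i k \<longleftrightarrow> (\<exists>a. i \<le> a \<and> a < i + k \<and> f a \<noteq> f (a + 4 * k))"

lemma conflictI: "i \<le> a \<Longrightarrow> a < i + k \<Longrightarrow> f a \<noteq> f (a + 4 * k) \<Longrightarrow> conflict f i k"
  unfolding conflict_def by blast

lemma power_free_if_conflict: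
  assumes "\<And>i k. 1 \<le> k \<Longrightarrow> conflict (\<lambda>n. w !! n) i k"
  shows "five_fourths_power_free w"
  unfolding five_fourths_power_free_def is_factor_def is_five_fourths_power_def
proof safe
  fix a b :: "'a list" and c x y
  assume w: "w = a @- (x @ y @ x) @- c" and x: "1 \<le> length x" and y: "length y = 3 * length x"
  obtain j where j: "length a \<le> j" "j < length a + length x" "w !! j \<noteq> w !! (j + 4 * length x)"
    using assms[OF x, of "length a"] by (auto simp: conflict_def)
  define l where "l = j - length a"
  have l: "j = length a + l" "l < length x" using j(1,2) by (auto simp: l_def)
  have "w !! j = x ! l"
    using l by (simp add: w)
  moreover have "j + 4 * length x = length a + (length x + (length y + l))"
    using l y by simp
  then have "w !! (j + 4 * length x) = x ! l"
    using l by (simp only: w shift_append) simp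
  ultimately show False using j(3) by simp
qed

lemma conflict_if_power_free:
  assumes "five_fourths_power_free w" "1 \<le> k"
  shows "conflict (\<lambda>n. w !! n) i k"
proof (rule ccontr)
  assume nc: "\<not> conflict (\<lambda>n. w !! n) i k"
  define x y where "x = stake k (sdrop i w)" and "y = stake (3 * k) (sdrop (i + k) w)"
  have x': "stake k (sdrop (i + 4 * k) w) = x"
  proof (rule nth_equalityI)
    fix j assume "j < length (stake k (sdrop (i + 4 * k) w))"
    then have j: "j < k" by simp
    have "w !! (i + j) = w !! (i + j + 4 * k)"
      using nc j by (auto simp: conflict_def)
    then show "stake k (sdrop (i + 4 * k) w) ! j = x ! j"
      using j by (simp add: x_def sdrop_snth ac_simps)
  qed (simp add: x_def)
  have "w = stake i w @- sdrop i w" by (rule stake_sdrop[symmetric])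
  also have "sdrop i w = x @- sdrop (i + k) w"
    unfolding x_def by (metis sdrop_add stake_sdrop)
  also have "sdrop (i + k) w = y @- sdrop (i + 4 * k) w"
    unfolding y_def using stake_sdrop[of "3 * k" "sdrop (i + k) w"] by (simp add: sdrop_add ac_simps)
  also have "sdrop (i + 4 * k) w = x @- sdrop (i + 5 * k) w"
    using stake_sdrop[of k "sdrop (i + 4 * k) w"] by (simp only: x' sdrop_add) (simp add: ac_simps)
  finally have "w = stake i w @- (x @ y @ x) @- sdrop (i + 5 * k) w" by simp
  then have "is_factor (x @ y @ x) w" unfolding is_factor_def by blast
  moreover have "is_five_fourths_power (x @ y @ x)"
    unfolding is_five_fourths_power_def using assms(2) by (intro exI[of _ x] exI[of _ y]) (simp add: x_def y_def)
  ultimately show False using assms(1) by (auto simp: five_fourths_power_free_def)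
qed

text \<open>Outside of its first \<open>N\<close> letters the word \<open>f\<close> has period 24, up to every sixth letter, where
  a shifted copy of \<open>g\<close> is interleaved. The letters of that copy are at least \<open>M\<close>, hence differ
  from all others; so powers whose period is not a multiple of 24 are impossible there, and the
  others come from powers in \<open>g\<close>.\<close>

lemma tail_conflict:
  fixes f g :: "nat \<Rightarrow> nat"
  assumes star: "\<And>i. f (N + 6 * i + 5) = g i + d"
    and cap: "\<And>n. N \<le> n \<Longrightarrow> min (f n) M = P ! ((n + e) mod 24)"
    and pat: "\<And>c r. 1 \<le> c \<Longrightarrow> c < 6 \<Longrightarrow> r < 24 \<Longrightarrow>
      \<exists>a<c. P ! ((r + a) mod 24) \<noteq> P ! ((r + a + 4 * c) mod 24)"
    and data: "\<And>i k. i < N \<Longrightarrow> 1 \<le> k \<Longrightarrow> i + 4 * k < N \<or> k < K \<Longrightarrow> conflict f i k"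
    and chain: "\<And>c i. c < 6 \<Longrightarrow> i < N \<Longrightarrow> \<exists>a. i \<le> a \<and> a < i + K \<and>
      (c = 0 \<and> a = N + 17 \<or> min (f a) M \<noteq> P ! ((a + e + 4 * c) mod 24))"
    and two: "\<And>j. K \<le> 6 * j \<Longrightarrow> g (2 + 4 * j) \<noteq> g 2"
    and desubst: "\<And>j i. k = 6 * j \<Longrightarrow> 1 \<le> j \<Longrightarrow> conflict g i j"
    and k: "1 \<le> k"
  shows "conflict f i k"
proof -
  define c q where "c = k mod 6" and "q = k div 6"
  have kqc: "k = 6 * q + c" and c: "c < 6" by (simp_all add: c_def q_def)
  \<comment> \<open>Since 4k = 24q + 4c, a move by 4k acts on the pattern as a move by 4c: only k
    mod 6 matters.\<close>
  have phase: "(a + 4 * k + e) mod 24 = (a + e + 4 * c) mod 24" for a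
  proof -
    have "a + 4 * k + e = a + e + 4 * c + 24 * q" by (simp add: kqc)
    then show ?thesis by (metis mod_mult_self2)
  qed
  have capped: "conflict f i k"
    if "i \<le> a" "a < i + k" "N \<le> a + 4 * k" "min (f a) M \<noteq> P ! ((a + e + 4 * c) mod 24)" for a
    using cap[OF that(3)] that phase[of a] by (intro conflictI[of i a]) auto
  show ?thesis
  proof (cases "i < N")
    case True
    show ?thesis
    proof (cases "i + 4 * k < N \<or> k < K")
      case False
      obtain a where a: "i \<le> a" "a < i + K"
        "c = 0 \<and> a = N + 17 \<or> min (f a) M \<noteq> P ! ((a + e + 4 * c) mod 24)"
        using chain[OF c True] by blast
      show ?thesis
      proof (cases "c = 0 \<and> a = N + 17")
        case c0: True
        \<comment> \<open>N + 17 = N + 6 * 2 + 5 is the interleaved place with index 2; as k = 6q,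
          the place 4k further on has index 2 + 4q.\<close>
        have "f a = g 2 + d" using star[of 2] c0 by (simp add: ac_simps)
        moreover have "a + 4 * k = N + 6 * (2 + 4 * q) + 5" using c0 kqc by simp
        then have "f (a + 4 * k) = g (2 + 4 * q) + d" using star[of "2 + 4 * q"] by simp
        moreover have "g (2 + 4 * q) \<noteq> g 2" using two[of q] False c0 kqc by simp
        ultimately show ?thesis using a False by (intro conflictI[of i a]) auto
      next
        case c1: False
        then show ?thesis using a False by (intro capped[of a]) auto
      qed
    qed (use data True k in blast)
  next
    case False
    show ?thesis
    proof (cases "c = 0")
      case True
      define i' r where "i' = (i - N) div 6" and "r = (i - N) mod 6"
      have i: "i = N + 6 * i' + r" "r < 6"
        using False by (simp_all add: i'_def r_def)
      \<comment> \<open>Every window of 6q letters contains exactly q interleaved places, and their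
        indices are consecutive from i' on, whatever the offset r.\<close>
      have "conflict g i' q" using desubst[of q i'] kqc True k by simp
      then obtain b where b: "i' \<le> b" "b < i' + q" "g b \<noteq> g (b + 4 * q)"
        by (auto simp: conflict_def)
      have "N + 6 * b + 5 + 4 * k = N + 6 * (b + 4 * q) + 5" using kqc True by simp
      then have "f (N + 6 * b + 5) \<noteq> f (N + 6 * b + 5 + 4 * k)"
        using b(3) by (simp only: star)
      then show ?thesis
        using b(1,2) i kqc True by (intro conflictI[of i "N + 6 * b + 5"]) auto
    next
      case c0: False
      \<comment> \<open>Already the first c \<le> k letters of the window betray that the pattern is
        not repeated after 4c.\<close>
      obtain a where a: "a < c"
        "P ! (((i + e) mod 24 + a) mod 24) \<noteq> P ! (((i + e) mod 24 + a + 4 * c) mod 24)"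
        using pat[of c "(i + e) mod 24"] c c0 by auto
      have "min (f (i + a)) M = P ! ((i + a + e) mod 24)"
        using cap[of "i + a"] False by simp
      moreover have "((i + e) mod 24 + a) mod 24 = (i + a + e) mod 24"
        using mod_add_left_eq[of "i + e" 24 a] by (simp only: ac_simps)
      moreover have "((i + e) mod 24 + a + 4 * c) mod 24 = (i + a + e + 4 * c) mod 24"
        using mod_add_left_eq[of "i + e" 24 "a + 4 * c"] by (simp only: ac_simps)
      ultimately show ?thesis
        using a False kqc by (intro capped[of "i + a"]) simp_all
    qed
  qed
qed

text \<open>The bound a < i + K puts a into every window of length K that begins in [i, a], so the
  first window still to be served begins at \<open>Suc a\<close>. About N / K positions thus serve
  all windows beginning before N.\<close>

fun covers :: "(nat \<Rightarrow> bool) \<Rightarrow> nat \<Rightarrow> nat \<Rightarrow> nat \<Rightarrow> nat list \<Rightarrow> bool" where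
  "covers Q N K i [] \<longleftrightarrow> N \<le> i"
| "covers Q N K i (a # as) \<longleftrightarrow> a < i + K \<and> Q a \<and> covers Q N K (Suc a) as"

lemma covers_sound:
  "covers Q N K i as \<Longrightarrow> i \<le> j \<Longrightarrow> j < N \<Longrightarrow> \<exists>a. j \<le> a \<and> a < j + K \<and> Q a"
proof (induction as arbitrary: i)
  case (Cons a as)
  show ?case
  proof (cases "j \<le> a")
    case True
    then show ?thesis using Cons.prems by (intro exI[of _ a]) auto
  next
    case False
    then show ?thesis using Cons.IH[of "Suc a"] Cons.prems by simp
  qed
qed simp

text \<open>For c = 0 no letter of the tail deviates, and a window that begins shortly before N may
  meet no deviation at all. The tail position N + 17 takes over: it carries entry 2 of \<sigma>, a 4
  that does not recur at the entries 2 + 4j for large j.\<close>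

definition deviates :: "chunk list \<Rightarrow> nat list \<Rightarrow> nat \<Rightarrow> nat \<Rightarrow> nat \<Rightarrow> nat \<Rightarrow> nat \<Rightarrow> bool" where
  "deviates A P N e M c a \<longleftrightarrow> c = 0 \<and> a = N + 17 \<or> min (word A a) M \<noteq> P ! ((a + e + 4 * c) mod 24)"

text \<open>The letter v, put after the first n letters of f, would be the last letter of a power
  with |x| = k. The two copies of x are compared backwards from their ends, where the second copy
  has v.\<close>

definition forbidden :: "(nat \<Rightarrow> nat) \<Rightarrow> nat \<Rightarrow> nat \<Rightarrow> bool" where
  "forbidden f n v \<longleftrightarrow> (\<exists>k\<ge>1. 5 * k \<le> n + 1 \<and> f (n - 4 * k) = v \<and>
    (\<forall>j. 1 \<le> j \<and> j < k \<longrightarrow> f (n - j) = f (n - 4 * k - j)))"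

lemma not_forbidden:
  assumes "five_fourths_power_free w" "\<forall>m<n. w !! m = f m"
  shows "\<not> forbidden f n (w !! n)"
proof
  assume "forbidden f n (w !! n)"
  then obtain k where k: "1 \<le> k" "5 * k \<le> n + 1" "f (n - 4 * k) = w !! n"
    "\<And>j. 1 \<le> j \<Longrightarrow> j < k \<Longrightarrow> f (n - j) = f (n - 4 * k - j)"
    unfolding forbidden_def by blast
  obtain a where a: "n + 1 - 5 * k \<le> a" "a < n + 1 - 5 * k + k" "w !! a \<noteq> w !! (a + 4 * k)"
    using conflict_if_power_free[OF assms(1) k(1), of "n + 1 - 5 * k"] by (auto simp: conflict_def)
  \<comment> \<open>The distance of a from the end of the first x; j = 0 is the pair whose second
    letter is the one at n.\<close>
  define j where "j = n - 4 * k - a"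
  have j: "a = n - 4 * k - j" "a + 4 * k = n - j" "j < k" "j \<le> n - 4 * k"
    using a(1,2) k(1,2) by (auto simp: j_def)
  show False
  proof (cases "j = 0")
    case True
    then show False using a(3) j k(1-3) assms(2) by simp
  next
    case False
    have "w !! a = f (n - 4 * k - j)" "w !! (a + 4 * k) = f (n - j)"
      using assms(2) j False k(1,2) by simp_all
    then show False using a(3) k(4)[of j] j(3) False by simp
  qed
qed

text \<open>Only because the whole infinite word f is power-free does it compete with w; this
  decides the direction of the first difference.\<close>

lemma least_eq_prefix:
  assumes w: "is_lex_least_power_free w"
    and f: "\<And>i k. 1 \<le> k \<Longrightarrow> conflict f i k"
    and forb: "\<And>n v. n < N \<Longrightarrow> v < f n \<Longrightarrow> forbidden f n v"
    and n: "n < N"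
  shows "w !! n = f n"
proof -
  have free: "five_fourths_power_free w" using w by (simp add: is_lex_least_power_free_def)
  have "five_fourths_power_free (smap f nats)"
    by (rule power_free_if_conflict) (simp add: f)
  then consider "smap f nats = w" | "lex_less w (smap f nats)"
    using w unfolding is_lex_least_power_free_def by blast
  then show ?thesis
  proof cases
    case 1
    have "smap f nats !! n = f n" by simp
    then show ?thesis by (simp only: 1)
  next
    case 2
    then obtain i where i: "\<forall>m<i. w !! m = f m" "w !! i < f i"
      by (auto simp: lex_less_def)
    then have "\<not> i < N" using not_forbidden[OF free i(1)] forb by blast
    then show ?thesis using i(1) n by simp
  qed
qed

section \<open>The initial segments\<close>

text \<open>\<open>w_data\<close> consists of the first 8468 letters of \<^const>\<open>w54\<close>. Writing \<open>d\<^sub>j\<close> for the number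
  that \<open>\<phi>\<close> adds to \<open>n\<close> in the last letter of \<open>\<phi>(n\<^sub>j)\<close>, \<open>sigma_data\<close> consists of the numbers \<open>n + d\<^sub>j\<close>
  for the first 25290 letters \<open>n\<^sub>j\<close> of \<open>\<^bold>s\<close>. Both were found by a greedy search; the excess over
  6764 and 20226 letters is needed for powers that end beyond the prefix. The last chunks are
  padded with zeros.\<close>

definition sigma_data :: "chunk list" where
  "sigma_data = concat [
  [C 3 2 4 2 2 3 2 4 3 4 3 2 4 2 2 3,
  C 2 3 3 4 3 2 4 2 4 3 2 3 3 4 3 2,
  C 2 2 2 4 3 3 3 3 2 4 2 2 3 2 3 4,
  C 2 3 2 3 3 4 4 2 2 2 2 4 4 3 3 2,
  C 3 2 4 3 2 3 2 2 4 2 3 3 3 3 4 2,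
  C 2 2 2 3 4 3 3 2 3 4 2 4 2 2 3 3,
  C 3 5 2 2 2 3 3 4 3 2 2 3 2 4 3 2,
  C 3 3 2 4 2 2 3 5 3 4 2 2 2 3 3 3,
  C 3 2 2 4 2 4 3 2 3 5 2 3 2 2 3 4,
  C 3 3 2 2 2 4 3 3 3 2 2 5 2 3 3 2,
  C 3 4 2 3 2 2 3 5 3 3 2 2 2 5 3 3,
  C 3 2 2 4 2 3 3 2 3 5 2 3 2 2 3 4,
  C 3 4 2 2 2 3 3 3 3 2 2 5 2 4 3 2,
  C 3 3 2 3 2 2 3 5 3 4 2 2 2 5 3 3,
  C 3 2 2 4 2 4 3 2 3 5 2 3 2 2 3 4,
  C 3 3 2 2 2 5 3 5 3 2 2 3 2 3 3 2,
  C 3 4 2 4 2 2 3 3 3 3 2 2 2 4 3 4,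
  C 3 2 2 3 2 5 3 2 3 3 2 4 2 2 3 5,
  C 3 4 2 2 2 3 3 3 3 2 2 4 2 4 3 2,
  C 3 3 2 3 2 2 3 4 3 4 2 2 2 5 3 3,
  C 3 2 2 5 2 3 3 2 3 4 2 3 2 2 3 5,
  C 3 3 2 2 2 4 3 3 3 2 2 4 2 3 3 2,
  C 3 5 2 3 2 2 3 4 3 3 2 2 2 5 3 3,
  C 3 2 2 5 2 4 3 2 3 3 2 3 2 2 3 5,
  C 3 4 2 2 2 3 3 3 3 2 2 4 2 4 3 2,
  C 3 5 2 3 2 2 3 4 3 4 2 2 2 5 3 3,
  C 3 2 2 5 2 3 3 2 3 5 2 4 2 2 3 3,
  C 3 3 2 2 2 4 3 4 3 2 2 3 2 3 3 2,
  C 3 4 2 4 2 2 3 5 3 3 2 2 2 5 3 3,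
  C 3 2 2 4 2 3 3 2 3 5 2 3 2 2 3 4,
  C 3 3 2 2 2 4 3 3 3 2 2 5 2 3 3 2,
  C 3 4 2 3 2 2 3 5 3 3 2 2 2 5 3 4],
  [C 3 2 2 3 2 3 3 2 3 5 2 4 2 2 3 3,
  C 3 3 2 2 2 4 3 4 3 2 2 5 2 3 3 2,
  C 3 4 2 4 2 2 3 5 3 3 2 2 2 5 3 3,
  C 3 2 2 5 2 4 3 2 3 3 2 3 2 2 3 4,
  C 3 4 2 2 2 3 3 3 3 2 2 4 2 4 3 2,
  C 3 5 2 3 2 2 3 5 3 3 2 2 2 4 3 3,
  C 3 2 2 5 2 3 3 2 3 4 2 3 2 2 3 4,
  C 3 3 2 2 2 5 3 3 3 2 2 4 2 3 3 2,
  C 3 5 2 3 2 2 3 5 3 4 2 2 2 3 3 3,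
  C 3 2 2 5 2 4 3 2 3 3 2 3 2 2 3 4,
  C 3 4 2 2 2 5 3 3 3 2 2 4 2 4 3 2,
  C 3 5 2 3 2 2 3 5 3 3 2 2 2 5 3 4,
  C 3 2 2 3 2 3 3 2 3 4 2 4 2 2 3 3,
  C 3 3 2 2 2 4 3 4 3 2 2 5 2 3 3 2,
  C 3 5 2 3 2 2 3 4 3 3 2 2 2 5 3 3,
  C 3 2 2 4 2 3 3 2 3 4 2 3 2 2 3 5,
  C 3 3 2 2 2 4 3 3 3 2 2 5 2 3 3 2,
  C 3 5 2 4 2 2 3 3 3 3 2 2 2 5 3 4,
  C 3 2 2 3 2 3 3 2 3 4 2 4 2 2 3 5,
  C 3 3 2 2 2 4 3 4 3 2 2 5 2 3 3 2,
  C 3 5 2 3 2 2 3 5 3 4 2 2 2 3 3 3,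
  C 3 2 2 4 2 4 3 2 3 3 2 3 2 2 3 4,
  C 3 4 2 2 2 5 3 3 3 2 2 5 2 3 3 2,
  C 3 4 2 3 2 2 3 5 3 3 2 2 2 4 3 3,
  C 3 2 2 4 2 3 3 2 3 5 2 3 2 2 3 4,
  C 3 3 2 2 2 5 3 3 3 2 2 5 2 4 3 2,
  C 3 3 2 3 2 2 3 5 3 4 2 2 2 3 3 3,
  C 3 2 2 4 2 4 3 2 3 5 2 3 2 2 3 4,
  C 3 4 2 2 2 5 3 3 3 2 2 5 2 6 3 2,
  C 3 3 2 3 2 2 3 5 3 5 2 2 2 3 3 3,
  C 3 2 2 4 2 5 3 2 3 3 2 5 2 2 3 3,
  C 3 4 2 2 2 3 3 4 3 2 2 3 2 4 3 2],
  [C 3 3 2 4 2 2 3 3 3 5 2 2 2 3 3 5,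
  C 3 2 2 3 2 5 3 2 3 3 2 5 2 2 3 4,
  C 3 4 2 2 2 3 3 3 3 2 2 4 2 4 3 2,
  C 3 3 2 3 2 2 3 4 3 5 2 2 2 3 3 5,
  C 3 2 2 4 2 5 3 2 3 3 2 5 2 2 3 3,
  C 3 4 2 2 2 3 3 6 3 2 2 3 2 4 3 2,
  C 3 3 2 4 2 2 3 3 3 5 2 2 2 3 3 4,
  C 3 2 2 3 2 5 3 2 3 3 2 5 2 2 3 4,
  C 3 4 2 2 2 3 3 5 3 2 2 3 2 4 3 2,
  C 3 3 2 6 2 2 3 3 3 4 2 2 2 5 3 4,
  C 3 2 2 3 2 3 3 2 3 4 2 4 2 2 3 3,
  C 3 3 2 2 2 4 3 4 3 2 2 5 2 3 3 2,
  C 3 5 2 3 2 2 3 4 3 3 2 2 2 5 3 3,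
  C 3 2 2 4 2 3 3 2 3 4 2 3 2 2 3 5,
  C 3 3 2 2 2 4 3 3 3 2 2 5 2 3 3 2,
  C 3 5 2 4 2 2 3 3 3 3 2 2 2 5 3 4,
  C 3 2 2 3 2 3 3 2 3 4 2 4 2 2 3 5,
  C 3 5 2 2 2 3 3 3 3 2 2 4 2 4 3 2,
  C 3 3 2 3 2 2 3 4 3 4 2 2 2 3 3 5,
  C 3 2 2 3 2 4 3 2 3 5 2 4 2 2 3 3,
  C 3 3 2 2 2 4 3 4 3 2 2 3 2 3 3 2,
  C 3 4 2 4 2 2 3 6 3 3 2 2 2 5 3 3,
  C 3 2 2 4 2 3 3 2 3 5 2 3 2 2 3 4,
  C 3 3 2 2 2 4 3 3 3 2 2 5 2 3 3 2,
  C 3 4 2 3 2 2 3 5 3 3 2 2 2 5 3 3,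
  C 3 2 2 6 2 3 3 2 3 5 2 3 2 2 3 6,
  C 3 3 2 2 2 4 3 3 3 2 2 4 2 3 3 2,
  C 3 4 2 3 2 2 3 4 3 3 2 2 2 5 3 3,
  C 3 2 2 5 2 3 3 2 3 5 2 3 2 2 3 5,
  C 3 3 2 2 2 4 3 3 3 2 2 6 2 3 3 2,
  C 3 4 2 3 2 2 3 6 3 3 2 2 2 5 3 3,
  C 3 2 2 4 2 3 3 2 3 5 2 3 2 2 3 4],
  [C 3 3 2 2 2 4 3 5 3 2 2 3 2 3 3 2,
  C 3 4 2 4 2 2 3 3 3 3 2 2 2 5 3 4,
  C 3 2 2 3 2 4 3 2 3 3 2 4 2 2 3 5,
  C 3 4 2 2 2 3 3 3 3 2 2 4 2 4 3 2,
  C 3 5 2 3 2 2 3 4 3 3 2 2 2 4 3 3,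
  C 3 2 2 5 2 3 3 2 3 4 2 3 2 2 3 5,
  C 3 3 2 2 2 5 3 3 3 2 2 4 2 3 3 2,
  C 3 5 2 3 2 2 3 4 3 4 2 2 2 3 3 3,
  C 3 2 2 5 2 4 3 2 3 3 2 3 2 2 3 5,
  C 3 4 2 2 2 5 3 3 3 2 2 4 2 4 3 2,
  C 3 5 2 3 2 2 3 4 3 3 2 2 2 5 3 5,
  C 3 2 2 3 2 3 3 2 3 4 2 4 2 2 3 3,
  C 3 3 2 2 2 4 3 4 3 2 2 3 2 5 3 2,
  C 3 3 2 4 2 2 3 5 3 4 2 2 2 3 3 3,
  C 3 2 2 4 2 4 3 2 3 3 2 3 2 2 3 4,
  C 3 4 2 2 2 5 3 3 3 2 2 5 2 3 3 2,
  C 3 4 2 3 2 2 3 5 3 3 2 2 2 4 3 3,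
  C 3 2 2 4 2 3 3 2 3 5 2 3 2 2 3 4,
  C 3 3 2 2 2 5 3 3 3 2 2 5 2 4 3 2,
  C 3 3 2 3 2 2 3 5 3 4 2 2 2 3 3 3,
  C 3 2 2 4 2 4 3 2 3 5 2 3 2 2 3 4,
  C 3 4 2 2 2 5 3 3 3 2 2 5 2 3 3 2,
  C 3 5 2 4 2 2 3 3 3 3 2 2 2 4 3 4,
  C 3 2 2 3 2 3 3 2 3 4 2 4 2 2 3 5,
  C 3 3 2 2 2 5 3 3 3 2 2 5 2 4 3 2,
  C 3 3 2 3 2 2 3 4 3 4 2 2 2 3 3 3,
  C 3 2 2 4 2 4 3 2 3 5 2 3 2 2 3 5,
  C 3 3 2 2 2 4 3 3 3 2 2 5 2 3 3 2,
  C 3 4 2 3 2 2 3 4 3 3 2 2 2 5 3 3,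
  C 3 2 2 4 2 3 3 2 3 5 2 3 2 2 3 5,
  C 3 4 2 2 2 3 3 3 3 2 2 5 2 4 3 2,
  C 3 3 2 3 2 2 3 4 3 4 2 2 2 5 3 3],
  [C 3 2 2 4 2 4 3 2 3 5 2 3 2 2 3 5,
  C 3 3 2 2 2 5 3 4 3 2 2 3 2 3 3 2,
  C 3 4 2 4 2 2 3 3 3 3 2 2 2 4 3 4,
  C 3 2 2 5 2 3 3 2 3 5 2 3 2 2 3 4,
  C 3 3 2 2 2 5 3 3 3 2 2 4 2 3 3 2,
  C 3 4 2 3 2 2 3 5 3 3 2 2 2 4 3 3,
  C 3 2 2 5 2 3 3 2 3 5 2 4 2 2 3 3,
  C 3 3 2 2 2 5 3 4 3 2 2 3 2 3 3 2,
  C 3 4 2 4 2 2 3 5 3 3 2 2 2 4 3 4,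
  C 3 2 2 5 2 3 3 2 3 5 2 3 2 2 3 5,
  C 3 4 2 2 2 3 3 3 3 2 2 4 2 4 3 2,
  C 3 3 2 3 2 2 3 4 3 4 2 2 2 5 3 3,
  C 3 2 2 5 2 3 3 2 3 5 2 4 2 2 3 3,
  C 3 3 2 2 2 4 3 4 3 2 2 3 2 3 3 2,
  C 3 4 2 4 2 2 3 5 3 3 2 2 2 5 3 3,
  C 3 2 2 4 2 3 3 2 3 5 2 3 2 2 3 4,
  C 3 3 2 2 2 4 3 3 3 2 2 5 2 3 3 2,
  C 3 4 2 3 2 2 3 5 3 3 2 2 2 5 3 4,
  C 3 2 2 3 2 3 3 2 3 5 2 4 2 2 3 3,
  C 3 3 2 2 2 4 3 4 3 2 2 5 2 3 3 2,
  C 3 4 2 4 2 2 3 5 3 3 2 2 2 5 3 3,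
  C 3 2 2 5 2 4 3 2 3 3 2 3 2 2 3 4,
  C 3 4 2 2 2 3 3 3 3 2 2 4 2 4 3 2,
  C 3 5 2 3 2 2 3 5 3 3 2 2 2 4 3 3,
  C 3 2 2 5 2 3 3 2 3 4 2 3 2 2 3 4,
  C 3 3 2 2 2 5 3 3 3 2 2 4 2 3 3 2,
  C 3 5 2 3 2 2 3 5 3 4 2 2 2 5 3 4,
  C 3 2 2 3 2 3 3 2 3 4 2 4 2 2 3 3,
  C 3 3 2 2 2 4 3 4 3 2 2 5 2 3 3 2,
  C 3 5 2 3 2 2 3 4 3 3 2 2 2 5 3 3,
  C 3 2 2 5 2 4 3 2 3 3 2 3 2 2 3 5,
  C 3 4 2 2 2 3 3 3 3 2 2 4 2 4 3 2],
  [C 3 5 2 3 2 2 3 4 3 4 2 2 2 5 3 3,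
  C 3 2 2 5 2 3 3 2 3 4 2 3 2 2 3 5,
  C 3 3 2 2 2 4 3 3 3 2 2 4 2 3 3 2,
  C 3 5 2 3 2 2 3 4 3 3 2 2 2 5 3 3,
  C 3 2 2 6 2 3 3 2 3 4 2 3 2 2 3 6,
  C 3 3 2 2 2 4 3 3 3 2 2 5 2 3 3 2,
  C 3 5 2 3 2 2 3 5 3 3 2 2 2 5 3 3,
  C 3 2 2 4 2 3 3 2 3 4 2 3 2 2 3 4,
  C 3 3 2 2 2 4 3 3 3 2 2 6 2 3 3 2,
  C 3 5 2 3 2 2 3 6 3 3 2 2 2 5 3 3,
  C 3 2 2 5 2 3 3 2 3 4 2 3 2 2 3 5,
  C 3 3 2 2 2 4 3 3 3 2 2 4 2 5 3 2,
  C 3 3 2 3 2 2 3 4 3 4 2 2 2 3 3 3,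
  C 3 2 2 5 2 4 3 2 3 3 2 4 2 2 3 3,
  C 3 4 2 2 2 5 3 4 3 2 2 3 2 3 3 2,
  C 3 4 2 4 2 2 3 5 3 3 2 2 2 4 3 3,
  C 3 2 2 4 2 3 3 2 3 5 2 3 2 2 3 4,
  C 3 3 2 2 2 5 3 3 3 2 2 5 2 3 3 2,
  C 3 4 2 3 2 2 3 5 3 3 2 2 2 6 3 3,
  C 3 2 2 4 2 3 3 2 3 6 2 3 2 2 3 4,
  C 3 3 2 2 2 4 3 3 3 2 2 5 2 3 3 2,
  C 3 5 2 3 2 2 3 5 3 3 2 2 2 5 3 3,
  C 3 2 2 4 2 3 3 2 3 4 2 3 2 2 3 4,
  C 3 3 2 2 2 6 3 3 3 2 2 5 2 3 3 2,
  C 3 6 2 3 2 2 3 5 3 3 2 2 2 4 3 3,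
  C 3 2 2 4 2 3 3 2 3 5 2 3 2 2 3 4,
  C 3 3 2 2 2 5 3 5 3 2 2 3 2 3 3 2,
  C 3 4 2 4 2 2 3 3 3 3 2 2 2 4 3 4,
  C 3 2 2 3 2 5 3 2 3 3 2 4 2 2 3 5,
  C 3 4 2 2 2 3 3 3 3 2 2 4 2 4 3 2,
  C 3 3 2 3 2 2 3 4 3 4 2 2 2 5 3 3,
  C 3 2 2 5 2 3 3 2 3 4 2 3 2 2 3 5],
  [C 3 3 2 2 2 4 3 3 3 2 2 4 2 3 3 2,
  C 3 5 2 3 2 2 3 6 3 3 2 2 2 5 3 3,
  C 3 2 2 5 2 4 3 2 3 3 2 3 2 2 3 4,
  C 3 4 2 2 2 3 3 3 3 2 2 4 2 4 3 2,
  C 3 5 2 3 2 2 3 5 3 3 2 2 2 4 3 3,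
  C 3 2 2 5 2 3 3 2 3 4 2 3 2 2 3 4,
  C 3 3 2 2 2 5 3 3 3 2 2 4 2 3 3 2,
  C 3 5 2 3 2 2 3 5 3 4 2 2 2 3 3 3,
  C 3 2 2 5 2 4 3 2 3 3 2 3 2 2 3 4,
  C 3 4 2 2 2 5 3 3 3 2 2 4 2 4 3 2,
  C 3 5 2 3 2 2 3 5 3 3 2 2 2 5 3 4,
  C 3 2 2 3 2 3 3 2 3 4 2 4 2 2 3 3,
  C 3 3 2 2 2 4 3 4 3 2 2 5 2 3 3 2,
  C 3 5 2 3 2 2 3 4 3 3 2 2 2 5 3 3,
  C 3 2 2 4 2 3 3 2 3 4 2 3 2 2 3 5,
  C 3 3 2 2 2 4 3 3 3 2 2 5 2 3 3 2,
  C 3 5 2 4 2 2 3 3 3 3 2 2 2 5 3 4,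
  C 3 2 2 3 2 3 3 2 3 4 2 4 2 2 3 5,
  C 3 3 2 2 2 4 3 4 3 2 2 5 2 3 3 2,
  C 3 5 2 3 2 2 3 5 3 4 2 2 2 5 3 3,
  C 3 2 2 4 2 3 3 2 3 4 2 3 2 2 3 4,
  C 3 3 2 2 2 4 3 3 3 2 2 5 2 3 3 2,
  C 3 5 2 4 2 2 3 5 3 3 2 2 2 5 3 3,
  C 3 2 2 4 2 4 3 2 3 3 2 3 2 2 3 4,
  C 3 4 2 2 2 3 3 3 3 2 2 5 2 4 3 2,
  C 3 5 2 3 2 2 3 5 3 3 2 2 2 4 3 3,
  C 3 2 2 4 2 3 3 2 3 4 2 3 2 2 3 4,
  C 3 3 2 2 2 5 3 3 3 2 2 5 2 3 3 2,
  C 3 5 2 3 2 2 3 5 3 4 2 2 2 3 3 3,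
  C 3 2 2 4 2 4 3 2 3 3 2 3 2 2 3 4,
  C 3 4 2 2 2 5 3 3 3 2 2 5 2 4 3 2,
  C 3 5 2 3 2 2 3 5 3 3 2 2 2 5 3 4],
  [C 3 2 2 3 2 3 3 2 3 4 2 4 2 2 3 3,
  C 3 3 2 2 2 4 3 4 3 2 2 5 2 3 3 2,
  C 3 5 2 3 2 2 3 4 3 3 2 2 2 5 3 3,
  C 3 2 2 4 2 3 3 2 3 4 2 3 2 2 3 6,
  C 3 3 2 2 2 4 3 3 3 2 2 5 2 3 3 2,
  C 3 5 2 4 2 2 3 3 3 3 2 2 2 5 3 4,
  C 3 2 2 3 2 3 3 2 3 4 2 4 2 2 3 5,
  C 3 3 2 2 2 4 3 3 3 2 2 4 2 3 3 2,
  C 3 5 2 3 2 2 3 4 3 3 2 2 2 5 3 3,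
  C 3 2 2 5 2 3 3 2 3 4 2 3 2 2 3 5,
  C 3 3 2 2 2 4 3 4 3 2 2 3 2 3 3 2,
  C 3 5 2 4 2 2 3 3 3 3 2 2 2 5 3 4,
  C 3 2 2 5 2 3 3 2 3 4 2 4 2 2 3 5,
  C 3 3 2 2 2 4 3 3 3 2 2 5 2 5 3 2,
  C 3 3 2 3 2 2 3 4 3 4 2 2 2 3 3 3,
  C 3 2 2 4 2 4 3 2 3 3 2 5 2 2 3 3,
  C 3 4 2 2 2 5 3 4 3 2 2 3 2 3 3 2,
  C 3 4 2 4 2 2 3 3 3 3 2 2 2 4 3 4,
  C 3 2 2 5 2 3 3 2 3 5 2 3 2 2 3 4,
  C 3 3 2 2 2 5 3 3 3 2 2 4 2 3 3 2,
  C 3 4 2 5 2 2 3 3 3 3 2 2 2 4 3 5,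
  C 3 2 2 3 2 3 3 2 3 5 2 4 2 2 3 3,
  C 3 4 2 2 2 3 3 4 3 2 2 3 2 4 3 2,
  C 3 3 2 4 2 2 3 5 3 4 2 2 2 5 3 3,
  C 3 2 2 4 2 3 3 2 3 4 2 3 2 2 3 4,
  C 3 3 2 2 2 4 3 3 3 2 2 5 2 3 3 2,
  C 3 5 2 3 2 2 3 5 3 3 2 2 2 5 3 3,
  C 3 2 2 4 2 4 3 2 3 3 2 3 2 2 3 4,
  C 3 4 2 2 2 3 3 3 3 2 2 5 2 4 3 2,
  C 3 5 2 3 2 2 3 5 3 4 2 2 2 5 3 3,
  C 3 2 2 4 2 3 3 2 3 4 2 5 2 2 3 3,
  C 3 3 2 2 2 4 3 4 3 2 2 3 2 3 3 2],
  [C 3 5 2 4 2 2 3 3 3 4 2 2 2 3 3 4,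
  C 3 2 2 5 2 4 3 2 3 3 2 3 2 2 3 4,
  C 3 4 2 2 2 5 3 3 3 2 2 4 2 3 3 2,
  C 3 5 2 3 2 2 3 5 3 3 2 2 2 4 3 3,
  C 3 2 2 5 2 3 3 2 3 4 2 3 2 2 3 4,
  C 3 3 2 2 2 5 3 3 3 2 2 4 2 4 3 2,
  C 3 3 2 3 2 2 3 5 3 4 2 2 2 3 3 3,
  C 3 2 2 5 2 4 3 2 3 5 2 3 2 2 3 4,
  C 3 3 2 2 2 4 3 3 3 2 2 4 2 3 3 2,
  C 3 4 2 3 2 2 3 5 3 3 2 2 2 5 3 3,
  C 3 2 2 5 2 3 3 2 3 5 2 3 2 2 3 4,
  C 3 4 2 2 2 3 3 3 3 2 2 4 2 4 3 2,
  C 3 3 2 3 2 2 3 5 3 4 2 2 2 5 3 3,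
  C 3 2 2 5 2 4 3 2 3 5 2 3 2 2 3 4,
  C 3 3 2 2 2 5 3 5 3 2 2 3 2 3 3 2,
  C 3 4 2 4 2 2 3 3 3 3 2 2 2 4 3 4,
  C 3 2 2 3 2 5 3 2 3 3 2 4 2 2 3 5,
  C 3 4 2 2 2 3 3 3 3 2 2 4 2 4 3 2,
  C 3 3 2 3 2 2 3 4 3 4 2 2 2 5 3 3,
  C 3 2 2 5 2 3 3 2 3 4 2 3 2 2 3 5,
  C 3 3 2 2 2 4 3 3 3 2 2 4 2 3 3 2,
  C 3 5 2 3 2 2 3 4 3 3 2 2 2 5 3 3,
  C 3 2 2 5 2 4 3 2 3 3 2 3 2 2 3 5,
  C 3 4 2 2 2 3 3 3 3 2 2 4 2 4 3 2,
  C 3 5 2 3 2 2 3 4 3 4 2 2 2 5 3 3,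
  C 3 2 2 5 2 3 3 2 3 5 2 4 2 2 3 3,
  C 3 3 2 2 2 4 3 4 3 2 2 3 2 3 3 2,
  C 3 4 2 4 2 2 3 5 3 3 2 2 2 5 3 3,
  C 3 2 2 4 2 3 3 2 3 5 2 3 2 2 3 4,
  C 3 3 2 2 2 4 3 3 3 2 2 5 2 3 3 2,
  C 3 4 2 3 2 2 3 5 3 3 2 2 2 5 3 4,
  C 3 2 2 3 2 3 3 2 3 5 2 4 2 2 3 3],
  [C 3 3 2 2 2 4 3 4 3 2 2 5 2 3 3 2,
  C 3 4 2 4 2 2 3 5 3 3 2 2 2 5 3 3,
  C 3 2 2 5 2 4 3 2 3 3 2 3 2 2 3 4,
  C 3 4 2 2 2 3 3 3 3 2 2 4 2 4 3 2,
  C 3 5 2 3 2 2 3 5 3 3 2 2 2 4 3 3,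
  C 3 2 2 5 2 3 3 2 3 4 2 3 2 2 3 4,
  C 3 3 2 2 2 5 3 3 3 2 2 4 2 3 3 2,
  C 3 5 2 3 2 2 3 5 3 4 2 2 2 3 3 3,
  C 3 2 2 5 2 4 3 2 3 3 2 3 2 2 3 4,
  C 3 4 2 2 2 5 3 3 3 2 2 4 2 4 3 2,
  C 3 5 2 3 2 2 3 5 3 3 2 2 2 5 3 4,
  C 3 2 2 3 2 3 3 2 3 4 2 4 2 2 3 3,
  C 3 3 2 2 2 4 3 4 3 2 2 5 2 3 3 2,
  C 3 5 2 3 2 2 3 4 3 3 2 2 2 5 3 3,
  C 3 2 2 4 2 3 3 2 3 4 2 3 2 2 3 5,
  C 3 3 2 2 2 4 3 3 3 2 2 5 2 3 3 2,
  C 3 5 2 4 2 2 3 3 3 3 2 2 2 5 3 4,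
  C 3 2 2 3 2 3 3 2 3 4 2 4 2 2 3 5,
  C 3 3 2 2 2 4 3 4 3 2 2 5 2 3 3 2,
  C 3 5 2 3 2 2 3 5 3 4 2 2 2 3 3 3,
  C 3 2 2 4 2 4 3 2 3 3 2 3 2 2 3 4,
  C 3 4 2 2 2 5 3 3 3 2 2 5 2 3 3 2,
  C 3 4 2 3 2 2 3 5 3 3 2 2 2 4 3 3,
  C 3 2 2 4 2 3 3 2 3 5 2 3 2 2 3 4,
  C 3 3 2 2 2 5 3 3 3 2 2 5 2 4 3 2,
  C 3 3 2 3 2 2 3 5 3 4 2 2 2 3 3 3,
  C 3 2 2 4 2 4 3 2 3 5 2 3 2 2 3 4,
  C 3 4 2 2 2 5 3 3 3 2 2 5 2 6 3 2,
  C 3 3 2 3 2 2 3 5 3 5 2 2 2 3 3 3,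
  C 3 2 2 4 2 5 3 2 3 3 2 5 2 2 3 3,
  C 3 4 2 2 2 3 3 4 3 2 2 3 2 4 3 2,
  C 3 3 2 4 2 2 3 3 3 5 2 2 2 3 3 5],
  [C 3 2 2 3 2 5 3 2 3 3 2 5 2 2 3 4,
  C 3 4 2 2 2 3 3 3 3 2 2 4 2 4 3 2,
  C 3 3 2 3 2 2 3 4 3 5 2 2 2 3 3 5,
  C 3 2 2 4 2 5 3 2 3 3 2 5 2 2 3 3,
  C 3 4 2 2 2 3 3 6 3 2 2 3 2 4 3 2,
  C 3 3 2 4 2 2 3 3 3 5 2 2 2 3 3 4,
  C 3 2 2 3 2 5 3 2 3 3 2 5 2 2 3 4,
  C 3 4 2 2 2 3 3 5 3 2 2 3 2 4 3 2,
  C 3 3 2 6 2 2 3 3 3 4 2 2 2 5 3 4,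
  C 3 2 2 3 2 3 3 2 3 4 2 4 2 2 3 3,
  C 3 3 2 2 2 4 3 4 3 2 2 5 2 3 3 2,
  C 3 5 2 3 2 2 3 4 3 3 2 2 2 5 3 3,
  C 3 2 2 4 2 3 3 2 3 4 2 3 2 2 3 6,
  C 3 3 2 2 2 4 3 3 3 2 2 5 2 3 3 2,
  C 3 5 2 4 2 2 3 3 3 3 2 2 2 5 3 4,
  C 3 2 2 3 2 3 3 2 3 4 2 4 2 2 3 5,
  C 3 3 2 2 2 4 3 3 3 2 2 4 2 3 3 2,
  C 3 5 2 3 2 2 3 4 3 3 2 2 2 5 3 3,
  C 3 2 2 5 2 3 3 2 3 4 2 3 2 2 3 5,
  C 3 3 2 2 2 4 3 4 3 2 2 3 2 3 3 2,
  C 3 5 2 4 2 2 3 3 3 3 2 2 2 5 3 4,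
  C 3 2 2 5 2 3 3 2 3 4 2 4 2 2 3 5,
  C 3 3 2 2 2 4 3 3 3 2 2 5 2 5 3 2,
  C 3 3 2 3 2 2 3 4 3 4 2 2 2 3 3 3,
  C 3 2 2 4 2 4 3 2 3 3 2 5 2 2 3 3,
  C 3 4 2 2 2 5 3 4 3 2 2 3 2 3 3 2,
  C 3 4 2 4 2 2 3 3 3 3 2 2 2 4 3 4,
  C 3 2 2 5 2 3 3 2 3 5 2 3 2 2 3 4,
  C 3 3 2 2 2 5 3 3 3 2 2 4 2 4 3 2,
  C 3 3 2 3 2 2 3 5 3 4 2 2 2 3 3 3,
  C 3 2 2 5 2 4 3 2 3 5 2 3 2 2 3 4,
  C 3 4 2 2 2 5 3 3 3 2 2 4 2 3 3 2],
  [C 3 4 2 3 2 2 3 5 3 3 2 2 2 4 3 3,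
  C 3 2 2 5 2 3 3 2 3 5 2 3 2 2 3 4,
  C 3 3 2 2 2 5 3 5 3 2 2 3 2 3 3 2,
  C 3 4 2 4 2 2 3 3 3 3 2 2 2 4 3 4,
  C 3 2 2 3 2 5 3 2 3 3 2 4 2 2 3 5,
  C 3 4 2 2 2 3 3 3 3 2 2 4 2 4 3 2,
  C 3 3 2 3 2 2 3 4 3 4 2 2 2 5 3 3,
  C 3 2 2 5 2 3 3 2 3 4 2 3 2 2 3 5,
  C 3 3 2 2 2 4 3 3 3 2 2 4 2 3 3 2,
  C 3 5 2 3 2 2 3 4 3 3 2 2 2 5 3 3,
  C 3 2 2 5 2 4 3 2 3 3 2 3 2 2 3 5,
  C 3 4 2 2 2 3 3 3 3 2 2 4 2 4 3 2,
  C 3 5 2 3 2 2 3 4 3 4 2 2 2 5 3 3,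
  C 3 2 2 5 2 3 3 2 3 5 2 4 2 2 3 3,
  C 3 3 2 2 2 4 3 4 3 2 2 3 2 3 3 2,
  C 3 4 2 4 2 2 3 5 3 3 2 2 2 5 3 3,
  C 3 2 2 4 2 3 3 2 3 5 2 3 2 2 3 4,
  C 3 3 2 2 2 4 3 3 3 2 2 5 2 3 3 2,
  C 3 4 2 3 2 2 3 5 3 3 2 2 2 5 3 4,
  C 3 2 2 3 2 3 3 2 3 5 2 4 2 2 3 3,
  C 3 3 2 2 2 4 3 4 3 2 2 5 2 3 3 2,
  C 3 4 2 4 2 2 3 5 3 3 2 2 2 5 3 3,
  C 3 2 2 5 2 6 3 2 3 3 2 3 2 2 3 4,
  C 3 4 2 2 2 3 3 3 3 2 2 4 2 4 3 2,
  C 3 3 2 5 2 2 3 3 3 4 2 2 2 5 3 4,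
  C 3 2 2 3 2 3 3 2 3 4 2 4 2 2 3 3,
  C 3 3 2 2 2 4 3 4 3 2 2 5 2 3 3 2,
  C 3 5 2 3 2 2 3 4 3 3 2 2 2 5 3 3,
  C 3 2 2 4 2 3 3 2 3 4 2 3 2 2 3 5,
  C 3 3 2 2 2 4 3 3 3 2 2 5 2 3 3 2,
  C 3 5 2 4 2 2 3 3 3 3 2 2 2 5 3 4,
  C 3 2 2 3 2 3 3 2 3 4 2 4 2 2 3 5],
  [C 3 3 2 2 2 4 3 4 3 2 2 5 2 3 3 2,
  C 3 5 2 3 2 2 3 5 3 4 2 2 2 3 3 3,
  C 3 2 2 4 2 4 3 2 3 3 2 3 2 2 3 4,
  C 3 4 2 2 2 5 3 3 3 2 2 5 2 3 3 2,
  C 3 4 2 3 2 2 3 5 3 3 2 2 2 4 3 3,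
  C 3 2 2 4 2 3 3 2 3 5 2 3 2 2 3 4,
  C 3 3 2 2 2 5 3 3 3 2 2 5 2 4 3 2,
  C 3 3 2 3 2 2 3 5 3 4 2 2 2 3 3 3,
  C 3 2 2 4 2 5 3 2 3 3 2 5 2 2 3 3,
  C 3 4 2 2 2 5 3 4 3 2 2 3 2 3 3 2,
  C 3 4 2 4 2 2 3 3 3 3 2 2 2 4 3 4,
  C 3 2 2 5 2 3 3 2 3 5 2 3 2 2 3 4,
  C 3 3 2 2 2 5 3 5 3 2 2 3 2 3 3 2,
  C 3 4 2 5 2 2 3 3 3 3 2 2 2 4 3 5,
  C 3 2 2 4 2 3 3 2 3 5 2 3 2 2 3 5,
  C 3 3 2 2 2 5 3 3 3 2 2 4 2 4 3 2,
  C 3 3 2 3 2 2 3 4 3 4 2 2 2 3 3 3,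
  C 3 2 2 5 2 4 3 2 3 5 2 3 2 2 3 5,
  C 3 4 2 2 2 5 3 3 3 2 2 4 2 3 3 2,
  C 3 4 2 3 2 2 3 4 3 3 2 2 2 4 3 3,
  C 3 2 2 5 2 3 3 2 3 5 2 3 2 2 3 5,
  C 3 3 2 2 2 5 3 3 3 2 2 6 2 3 3 2,
  C 3 4 2 3 2 2 3 6 3 3 2 2 2 4 3 3,
  C 3 2 2 4 2 3 3 2 3 5 2 3 2 2 3 4,
  C 3 3 2 2 2 5 3 3 3 2 2 5 2 3 3 2,
  C 3 4 2 3 2 2 3 5 3 3 2 2 2 4 3 3,
  C 3 2 2 6 2 3 3 2 3 5 2 3 2 2 3 6,
  C 3 3 2 2 2 5 3 3 3 2 2 4 2 3 3 2,
  C 3 4 2 3 2 2 3 4 3 3 2 2 2 4 3 3,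
  C 3 2 2 5 2 5 3 2 3 3 2 3 2 2 3 5,
  C 3 4 2 2 2 3 3 3 3 2 2 4 2 4 3 2,
  C 3 3 2 5 2 2 3 3 3 4 2 2 2 5 3 4],
  [C 3 2 2 3 2 3 3 2 3 4 2 4 2 2 3 3,
  C 3 3 2 2 2 4 3 4 3 2 2 5 2 3 3 2,
  C 3 5 2 3 2 2 3 4 3 3 2 2 2 5 3 3,
  C 3 2 2 4 2 3 3 2 3 4 2 3 2 2 3 5,
  C 3 3 2 2 2 4 3 3 3 2 2 5 2 3 3 2,
  C 3 5 2 4 2 2 3 3 3 3 2 2 2 5 3 4,
  C 3 2 2 3 2 3 3 2 3 4 2 4 2 2 3 5,
  C 3 3 2 2 2 4 3 4 3 2 2 6 2 3 3 2,
  C 3 5 2 3 2 2 3 4 3 3 2 2 2 5 3 3,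
  C 3 2 2 5 2 3 3 2 3 4 2 3 2 2 3 5,
  C 3 3 2 2 2 4 3 3 3 2 2 4 2 3 3 2,
  C 3 5 2 3 2 2 3 6 3 3 2 2 2 5 3 3,
  C 3 2 2 6 2 3 3 2 3 4 2 3 2 2 3 4,
  C 3 3 2 2 2 4 3 3 3 2 2 5 2 3 3 2,
  C 3 5 2 3 2 2 3 5 3 3 2 2 2 5 3 3,
  C 3 2 2 4 2 3 3 2 3 4 2 3 2 2 3 6,
  C 3 3 2 2 2 4 3 3 3 2 2 6 2 3 3 2,
  C 3 5 2 3 2 2 3 4 3 3 2 2 2 5 3 3,
  C 3 2 2 5 2 3 3 2 3 4 2 4 2 2 3 3,
  C 3 3 2 2 2 4 3 4 3 2 2 3 2 3 3 2,
  C 3 5 2 4 2 2 3 5 3 3 2 2 2 5 3 3,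
  C 3 2 2 4 2 3 3 2 3 4 2 5 2 2 3 3,
  C 3 3 2 2 2 4 3 5 3 2 2 3 2 3 3 2,
  C 3 5 2 5 2 2 3 4 3 3 2 2 2 5 3 3,
  C 3 2 2 5 2 3 3 2 3 4 2 3 2 2 3 4,
  C 3 5 2 2 2 3 3 3 3 2 2 4 2 4 3 2,
  C 3 3 2 3 2 2 3 5 3 4 2 2 2 3 3 4,
  C 3 2 2 3 2 4 3 2 3 5 2 4 2 2 3 3,
  C 3 3 2 2 2 4 3 4 3 2 2 5 2 3 3 2,
  C 3 4 2 3 2 2 3 4 3 3 2 2 2 5 3 3,
  C 3 2 2 4 2 3 3 2 3 5 2 3 2 2 3 5,
  C 3 3 2 2 2 4 3 3 3 2 2 5 2 3 3 2],
  [C 3 4 2 4 2 2 3 3 3 3 2 2 2 5 3 4,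
  C 3 2 2 3 2 3 3 2 3 5 2 4 2 2 3 5,
  C 3 3 2 2 2 4 3 4 3 2 2 5 2 3 3 2,
  C 3 4 2 3 2 2 3 5 3 5 2 2 2 3 3 3,
  C 3 2 2 4 2 4 3 2 3 3 2 3 2 2 3 4,
  C 3 4 2 2 2 3 3 5 3 2 2 3 2 4 3 2,
  C 3 5 2 4 2 2 3 3 3 3 2 2 2 4 3 4,
  C 3 2 2 3 2 3 3 2 3 4 2 4 2 2 3 5,
  C 3 3 2 2 2 5 3 3 3 2 2 4 2 3 3 2,
  C 3 5 2 3 2 2 3 4 3 3 2 2 2 4 3 3,
  C 3 2 2 5 2 3 3 2 3 4 2 3 2 2 3 5,
  C 3 3 2 2 2 5 3 4 3 2 2 3 2 3 3 2,
  C 3 5 2 4 2 2 3 3 3 3 2 2 2 4 3 4,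
  C 3 2 2 5 2 3 3 2 3 4 2 4 2 2 3 5,
  C 3 3 2 2 2 5 3 3 3 2 2 5 2 4 3 2,
  C 3 3 2 3 2 2 3 4 3 4 2 2 2 3 3 3,
  C 3 2 2 4 2 4 3 2 3 5 2 3 2 2 3 5,
  C 3 3 2 2 2 4 3 3 3 2 2 5 2 3 3 2,
  C 3 4 2 3 2 2 3 4 3 3 2 2 2 5 3 3,
  C 3 2 2 4 2 3 3 2 3 5 2 3 2 2 3 5,
  C 3 4 2 2 2 3 3 3 3 2 2 5 2 4 3 2,
  C 3 3 2 3 2 2 3 4 3 4 2 2 2 5 3 3,
  C 3 2 2 4 2 4 3 2 3 5 2 3 2 2 3 5,
  C 3 3 2 2 2 5 3 4 3 2 2 3 2 3 3 2,
  C 3 4 2 4 2 2 3 3 3 3 2 2 2 4 3 4,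
  C 3 2 2 5 2 3 3 2 3 5 2 3 2 2 3 4,
  C 3 3 2 2 2 5 3 3 3 2 2 4 2 3 3 2,
  C 3 4 2 3 2 2 3 5 3 3 2 2 2 4 3 3,
  C 3 2 2 5 2 3 3 2 3 5 2 4 2 2 3 3,
  C 3 3 2 2 2 5 3 4 3 2 2 3 2 3 3 2,
  C 3 4 2 4 2 2 3 5 3 3 2 2 2 4 3 4,
  C 3 2 2 5 2 3 3 2 3 5 2 3 2 2 3 5],
  [C 3 4 2 2 2 3 3 3 3 2 2 4 2 4 3 2,
  C 3 3 2 3 2 2 3 4 3 4 2 2 2 5 3 3,
  C 3 2 2 5 2 3 3 2 3 4 2 3 2 2 3 5,
  C 3 3 2 2 2 4 3 3 3 2 2 4 2 3 3 2,
  C 3 5 2 3 2 2 3 4 3 3 2 2 2 5 3 3,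
  C 3 2 2 5 2 4 3 2 3 3 2 3 2 2 3 5,
  C 3 4 2 2 2 3 3 3 3 2 2 4 2 4 3 2,
  C 3 5 2 3 2 2 3 4 3 4 2 2 2 5 3 3,
  C 3 2 2 5 2 3 3 2 3 5 2 4 2 2 3 3,
  C 3 3 2 2 2 4 3 4 3 2 2 3 2 3 3 2,
  C 3 4 2 4 2 2 3 5 3 3 2 2 2 5 3 3,
  C 3 2 2 4 2 3 3 2 3 5 2 3 2 2 3 4,
  C 3 3 2 2 2 4 3 3 3 2 2 5 2 3 3 2,
  C 3 4 2 3 2 2 3 5 3 3 2 2 2 5 3 4,
  C 3 2 2 3 2 3 3 2 3 5 2 4 2 2 3 3,
  C 3 3 2 2 2 4 3 4 3 2 2 5 2 3 3 2,
  C 3 4 2 4 2 2 3 5 3 3 2 2 2 5 3 6,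
  C 3 2 2 3 2 3 3 2 3 5 2 5 2 2 3 3,
  C 3 3 2 2 2 4 3 5 3 2 2 3 2 5 3 2,
  C 3 3 2 4 2 2 3 3 3 4 2 2 2 3 3 4,
  C 3 2 2 3 2 4 3 2 3 3 2 5 2 2 3 3,
  C 3 5 2 2 2 3 3 5 3 2 2 3 2 5 3 2,
  C 3 4 2 4 2 2 3 3 3 3 2 2 2 4 3 4,
  C 3 2 2 3 2 3 3 2 3 4 2 5 2 2 3 3,
  C 3 5 2 2 2 4 3 5 3 2 2 3 2 5 3 2,
  C 3 3 2 4 2 2 3 3 3 6 2 2 2 3 3 4,
  C 3 2 2 3 2 4 3 2 3 3 2 5 2 2 3 3,
  C 3 4 2 2 2 3 3 5 3 2 2 3 2 5 3 2,
  C 3 4 2 4 2 2 3 3 3 5 2 2 2 3 3 4,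
  C 3 2 2 3 2 6 3 2 3 3 2 4 2 2 3 5,
  C 3 4 2 2 2 3 3 3 3 2 2 4 2 4 3 2,
  C 3 3 2 3 2 2 3 4 3 4 2 2 2 5 3 3],
  [C 3 2 2 5 2 3 3 2 3 4 2 3 2 2 3 5,
  C 3 3 2 2 2 4 3 3 3 2 2 4 2 3 3 2,
  C 3 5 2 3 2 2 3 4 3 3 2 2 2 5 3 3,
  C 3 2 2 5 2 4 3 2 3 3 2 3 2 2 3 5,
  C 3 4 2 2 2 3 3 3 3 2 2 4 2 4 3 2,
  C 3 5 2 5 2 2 3 3 3 3 2 2 2 4 3 4,
  C 3 2 2 3 2 3 3 2 3 4 2 4 2 2 3 3,
  C 3 5 2 2 2 3 3 4 3 2 2 5 2 4 3 2,
  C 3 3 2 3 2 2 3 4 3 4 2 2 2 3 3 3,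
  C 3 2 2 4 2 4 3 2 3 6 2 3 2 2 3 5,
  C 3 3 2 2 2 4 3 3 3 2 2 5 2 3 3 2,
  C 3 4 2 3 2 2 3 4 3 3 2 2 2 5 3 3,
  C 3 2 2 4 2 3 3 2 3 5 2 3 2 2 3 5,
  C 3 3 2 2 2 6 3 3 3 2 2 5 2 3 3 2,
  C 3 6 2 3 2 2 3 4 3 3 2 2 2 4 3 3,
  C 3 2 2 4 2 3 3 2 3 4 2 3 2 2 3 5,
  C 3 3 2 2 2 5 3 3 3 2 2 5 2 3 3 2,
  C 3 5 2 3 2 2 3 4 3 3 2 2 2 6 3 3,
  C 3 2 2 4 2 3 3 2 3 6 2 3 2 2 3 5,
  C 3 3 2 2 2 4 3 3 3 2 2 5 2 3 3 2,
  C 3 4 2 3 2 2 3 4 3 5 2 2 2 3 3 3,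
  C 3 2 2 4 2 4 3 2 3 3 2 3 2 2 3 5,
  C 3 4 2 2 2 3 3 4 3 2 2 3 2 4 3 2,
  C 3 5 2 4 2 2 3 3 3 3 2 2 2 4 3 4,
  C 3 2 2 5 2 3 3 2 3 4 2 3 2 2 3 4,
  C 3 3 2 2 2 5 3 3 3 2 2 4 2 3 3 2,
  C 3 5 2 3 2 2 3 5 3 3 2 2 2 4 3 3,
  C 3 2 2 5 2 3 3 2 3 4 2 4 2 2 3 3,
  C 3 3 2 2 2 5 3 4 3 2 2 3 2 3 3 2,
  C 3 5 2 4 2 2 3 5 3 3 2 2 2 4 3 4,
  C 3 2 2 5 2 3 3 2 3 4 2 3 2 2 3 5,
  C 3 5 2 2 2 3 3 3 3 2 2 4 2 4 3 2],
  [C 3 3 2 3 2 2 3 4 3 4 2 2 2 3 3 5,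
  C 3 2 2 3 2 4 3 2 3 5 2 4 2 2 3 3,
  C 3 3 2 2 2 4 3 4 3 2 2 3 2 3 3 2,
  C 3 4 2 4 2 2 3 5 3 3 2 2 2 5 3 3,
  C 3 2 2 4 2 3 3 2 3 5 2 3 2 2 3 4,
  C 3 3 2 2 2 4 3 3 3 2 2 5 2 3 3 2,
  C 3 4 2 3 2 2 3 5 3 3 2 2 2 5 3 4,
  C 3 2 2 3 2 3 3 2 3 5 2 4 2 2 3 3,
  C 3 3 2 2 2 4 3 4 3 2 2 5 2 3 3 2,
  C 3 4 2 4 2 2 3 5 3 3 2 2 2 5 3 3,
  C 3 2 2 6 2 3 3 2 3 5 2 3 2 2 3 4,
  C 3 3 2 2 2 4 3 3 3 2 2 4 2 3 3 2,
  C 3 4 2 3 2 2 3 5 3 3 2 2 2 5 3 4,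
  C 3 2 2 5 2 3 3 2 3 5 2 3 2 2 3 6,
  C 3 3 2 2 2 4 3 3 3 2 2 5 2 5 3 2,
  C 3 3 2 3 2 2 3 4 3 4 2 2 2 3 3 3,
  C 3 2 2 4 2 4 3 2 3 3 2 5 2 2 3 3,
  C 3 4 2 2 2 5 3 4 3 2 2 3 2 3 3 2,
  C 3 4 2 4 2 2 3 3 3 3 2 2 2 4 3 4,
  C 3 2 2 5 2 3 3 2 3 5 2 3 2 2 3 4,
  C 3 3 2 2 2 5 3 3 3 2 2 4 2 3 3 2,
  C 3 4 2 3 2 2 3 5 3 3 2 2 2 4 3 3,
  C 3 2 2 5 2 3 3 2 3 5 2 4 2 2 3 3,
  C 3 3 2 2 2 5 3 4 3 2 2 3 2 3 3 2,
  C 3 4 2 4 2 2 3 5 3 3 2 2 2 4 3 4,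
  C 3 2 2 5 2 3 3 2 3 5 2 3 2 2 3 5,
  C 3 4 2 2 2 3 3 3 3 2 2 4 2 4 3 2,
  C 3 3 2 3 2 2 3 4 3 4 2 2 2 5 3 3,
  C 3 2 2 5 2 3 3 2 3 4 2 3 2 2 3 5,
  C 3 3 2 2 2 4 3 3 3 2 2 4 2 3 3 2,
  C 3 5 2 3 2 2 3 4 3 3 2 2 2 5 3 3,
  C 3 2 2 5 2 4 3 2 3 3 2 3 2 2 3 5],
  [C 3 4 2 2 2 3 3 3 3 2 2 4 2 4 3 2,
  C 3 5 2 3 2 2 3 4 3 4 2 2 2 5 3 3,
  C 3 2 2 5 2 3 3 2 3 5 2 4 2 2 3 3,
  C 3 3 2 2 2 4 3 4 3 2 2 3 2 3 3 2,
  C 3 4 2 4 2 2 3 5 3 3 2 2 2 5 3 3,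
  C 3 2 2 4 2 3 3 2 3 5 2 3 2 2 3 4,
  C 3 3 2 2 2 4 3 3 3 2 2 5 2 3 3 2,
  C 3 4 2 3 2 2 3 5 3 5 2 2 2 3 3 3,
  C 3 2 2 4 2 4 3 2 3 3 2 3 2 2 3 4,
  C 3 4 2 2 2 3 3 5 3 2 2 3 2 4 3 2,
  C 3 5 2 4 2 2 3 3 3 3 2 2 2 4 3 4,
  C 3 2 2 3 2 3 3 2 3 4 2 5 2 2 3 3,
  C 3 5 2 2 2 3 3 4 3 2 2 5 2 4 3 2,
  C 3 3 2 3 2 2 3 4 3 4 2 2 2 5 3 3,
  C 3 2 2 4 2 3 3 2 3 4 2 3 2 2 3 5,
  C 3 3 2 2 2 4 3 3 3 2 2 5 2 3 3 2,
  C 3 5 2 3 2 2 3 4 3 3 2 2 2 5 3 3,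
  C 3 2 2 4 2 4 3 2 3 3 2 3 2 2 3 5,
  C 3 4 2 2 2 3 3 3 3 2 2 5 2 4 3 2,
  C 3 5 2 3 2 2 3 4 3 4 2 2 2 5 3 3,
  C 3 2 2 4 2 3 3 2 3 5 2 5 2 2 3 3,
  C 3 3 2 2 2 4 3 4 3 2 2 3 2 3 3 2,
  C 3 4 2 4 2 2 3 3 3 5 2 2 2 3 3 4,
  C 3 2 2 5 2 4 3 2 3 3 2 3 2 2 3 4,
  C 3 4 2 2 2 3 3 3 3 2 2 4 2 4 3 2,
  C 3 5 2 3 2 2 3 5 3 3 2 2 2 4 3 3,
  C 3 2 2 5 2 3 3 2 3 4 2 3 2 2 3 4,
  C 3 3 2 2 2 5 3 3 3 2 2 4 2 3 3 2,
  C 3 5 2 3 2 2 3 5 3 4 2 2 2 3 3 3,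
  C 3 2 2 5 2 4 3 2 3 3 2 3 2 2 3 4,
  C 3 4 2 2 2 5 3 3 3 2 2 4 2 4 3 2,
  C 3 5 2 3 2 2 3 5 3 3 2 2 2 5 3 4],
  [C 3 2 2 3 2 3 3 2 3 4 2 4 2 2 3 3,
  C 3 3 2 2 2 4 3 4 3 2 2 5 2 3 3 2,
  C 3 5 2 3 2 2 3 4 3 3 2 2 2 5 3 3,
  C 3 2 2 4 2 3 3 2 3 4 2 3 2 2 3 5,
  C 3 3 2 2 2 4 3 3 3 2 2 5 2 3 3 2,
  C 3 5 2 4 2 2 3 3 3 3 2 2 2 5 3 4,
  C 3 2 2 3 2 3 3 2 3 4 2 4 2 2 3 5,
  C 3 3 2 2 2 4 3 4 3 2 2 5 2 3 3 2,
  C 3 5 2 3 2 2 3 5 3 4 2 2 2 3 3 3,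
  C 3 2 2 4 2 4 3 2 3 3 2 3 2 2 3 4,
  C 3 4 2 2 2 5 3 3 3 2 2 5 2 3 3 2,
  C 3 4 2 4 2 2 3 3 3 3 2 2 2 4 3 4,
  C 3 2 2 3 2 3 3 2 3 5 2 4 2 2 3 5,
  C 3 3 2 2 2 5 3 3 3 2 2 4 2 3 3 2,
  C 3 4 2 3 2 2 3 4 3 3 2 2 2 4 3 3,
  C 3 2 2 5 2 3 3 2 3 5 2 3 2 2 3 5,
  C 3 3 2 2 2 5 3 4 3 2 2 3 2 3 3 2,
  C 3 4 2 4 2 2 3 3 3 3 2 2 2 4 3 4,
  C 3 2 2 5 2 3 3 2 3 5 2 4 2 2 3 5,
  C 3 3 2 2 2 5 3 3 3 2 2 5 2 4 3 2,
  C 3 3 2 3 2 2 3 4 3 4 2 2 2 3 3 3,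
  C 3 2 2 4 2 4 3 2 3 5 2 3 2 2 3 5,
  C 3 3 2 2 2 4 3 3 3 2 2 5 2 3 3 2,
  C 3 4 2 3 2 2 3 4 3 3 2 2 2 5 3 3,
  C 3 2 2 4 2 3 3 2 3 5 2 3 2 2 3 5,
  C 3 4 2 2 2 3 3 3 3 2 2 5 2 4 3 2,
  C 3 3 2 3 2 2 3 4 3 5 2 2 2 3 3 5,
  C 3 2 2 3 2 4 3 2 3 5 2 4 2 2 3 3,
  C 3 3 2 2 2 4 3 4 3 2 2 3 2 3 3 2,
  C 3 4 2 4 2 2 3 5 3 3 2 2 2 5 3 3,
  C 3 2 2 4 2 3 3 2 3 5 2 3 2 2 3 4,
  C 3 3 2 2 2 4 3 3 3 2 2 5 2 3 3 2],
  [C 3 4 2 3 2 2 3 5 3 3 2 2 2 5 3 4,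
  C 3 2 2 3 2 3 3 2 3 5 2 4 2 2 3 3,
  C 3 3 2 2 2 4 3 4 3 2 2 5 2 3 3 2,
  C 3 4 2 4 2 2 3 5 3 3 2 2 2 5 3 3,
  C 3 2 2 5 2 4 3 2 3 3 2 3 2 2 3 4,
  C 3 4 2 2 2 3 3 3 3 2 2 4 2 4 3 2,
  C 3 5 2 3 2 2 3 5 3 3 2 2 2 4 3 3,
  C 3 2 2 6 2 3 3 2 3 4 2 3 2 2 3 4,
  C 3 3 2 2 2 5 3 3 3 2 2 4 2 3 3 2,
  C 3 5 2 3 2 2 3 5 3 4 2 2 2 3 3 3,
  C 3 2 2 5 2 4 3 2 3 3 2 3 2 2 3 4,
  C 3 4 2 2 2 5 3 3 3 2 2 4 2 4 3 2,
  C 3 5 2 3 2 2 3 5 3 3 2 2 2 5 3 4,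
  C 3 2 2 3 2 3 3 2 3 4 2 4 2 2 3 3,
  C 3 3 2 2 2 4 3 4 3 2 2 5 2 3 3 2,
  C 3 5 2 3 2 2 3 4 3 3 2 2 2 5 3 3,
  C 3 2 2 4 2 3 3 2 3 4 2 3 2 2 3 5,
  C 3 3 2 2 2 4 3 3 3 2 2 5 2 3 3 2,
  C 3 5 2 4 2 2 3 5 3 4 2 2 2 3 3 3,
  C 3 2 2 4 2 4 3 2 3 3 2 3 2 2 3 4,
  C 3 4 2 2 2 5 3 3 3 2 2 5 2 3 3 2,
  C 3 4 2 3 2 2 3 5 3 3 2 2 2 5 3 4,
  C 3 2 2 3 2 3 3 2 3 5 2 4 2 2 3 3,
  C 3 3 2 2 2 4 3 4 3 2 2 5 2 3 3 2,
  C 3 4 2 4 2 2 3 5 3 3 2 2 2 5 3 3,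
  C 3 2 2 4 2 3 3 2 3 5 2 3 2 2 3 4,
  C 3 3 2 2 2 4 3 3 3 2 2 5 2 3 3 2,
  C 3 4 2 3 2 2 3 5 3 3 2 2 2 6 3 3,
  C 3 2 2 4 2 3 3 2 3 6 2 3 2 2 3 4,
  C 3 3 2 2 2 5 3 3 3 2 2 5 2 3 3 2,
  C 3 5 2 3 2 2 3 5 3 3 2 2 2 4 3 3,
  C 3 2 2 4 2 3 3 2 3 4 2 3 2 2 3 4],
  [C 3 3 2 2 2 6 3 3 3 2 2 5 2 3 3 2,
  C 3 6 2 3 2 2 3 5 3 3 2 2 2 5 3 3,
  C 3 2 2 4 2 3 3 2 3 5 2 3 2 2 3 4,
  C 3 3 2 2 2 4 3 5 3 2 2 3 2 3 3 2,
  C 3 4 2 4 2 2 3 3 3 3 2 2 2 5 3 4,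
  C 3 2 2 3 2 4 3 2 3 3 2 4 2 2 3 5,
  C 3 4 2 2 2 3 3 3 3 2 2 4 2 4 3 2,
  C 3 5 2 3 2 2 3 4 3 3 2 2 2 4 3 3,
  C 3 2 2 5 2 3 3 2 3 4 2 3 2 2 3 5,
  C 3 3 2 2 2 5 3 3 3 2 2 4 2 3 3 2,
  C 3 5 2 3 2 2 3 6 3 3 2 2 2 4 3 3,
  C 3 2 2 6 2 3 3 2 3 4 2 3 2 2 3 4,
  C 3 3 2 2 2 5 3 3 3 2 2 5 2 3 3 2,
  C 3 5 2 3 2 2 3 5 3 3 2 2 2 4 3 3,
  C 3 2 2 4 2 3 3 2 3 4 2 3 2 2 3 6,
  C 3 3 2 2 2 5 3 3 3 2 2 6 2 3 3 2,
  C 3 5 2 3 2 2 3 4 3 3 2 2 2 4 3 3,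
  C 3 2 2 5 2 3 3 2 3 4 2 3 2 2 3 5,
  C 3 5 2 2 2 3 3 3 3 2 2 4 2 4 3 2,
  C 3 3 2 3 2 2 3 4 3 4 2 2 2 3 3 5,
  C 3 2 2 3 2 4 3 2 3 5 2 4 2 2 3 3,
  C 3 3 2 2 2 4 3 4 3 2 2 3 2 3 3 2,
  C 3 4 2 4 2 2 3 5 3 3 2 2 2 5 3 3,
  C 3 2 2 4 2 3 3 2 3 5 2 3 2 2 3 4,
  C 3 3 2 2 2 4 3 3 3 2 2 5 2 3 3 2,
  C 3 6 2 3 2 2 3 5 3 3 2 2 2 5 3 4,
  C 3 2 2 3 2 3 3 2 3 4 2 4 2 2 3 3,
  C 3 3 2 2 2 4 3 4 3 2 2 5 2 3 3 2,
  C 3 5 2 3 2 2 3 4 3 3 2 2 2 5 3 3,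
  C 3 2 2 4 2 3 3 2 3 4 2 3 2 2 3 5,
  C 3 3 2 2 2 4 3 3 3 2 2 5 2 3 3 2,
  C 3 5 2 4 2 2 3 3 3 3 2 2 2 5 3 4],
  [C 3 2 2 3 2 3 3 2 3 4 2 4 2 2 3 5,
  C 3 3 2 2 2 4 3 4 3 2 2 5 2 3 3 2,
  C 3 5 2 3 2 2 3 5 3 4 2 2 2 3 3 3,
  C 3 2 2 4 2 4 3 2 3 3 2 3 2 2 3 4,
  C 3 4 2 2 2 5 3 3 3 2 2 5 2 3 3 2,
  C 3 4 2 3 2 2 3 5 3 3 2 2 2 4 3 3,
  C 3 2 2 4 2 3 3 2 3 5 2 3 2 2 3 4,
  C 3 3 2 2 2 5 3 3 3 2 2 5 2 4 3 2,
  C 3 3 2 3 2 2 3 5 3 4 2 2 2 3 3 3,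
  C 3 2 2 4 2 4 3 2 3 5 2 3 2 2 3 4,
  C 3 4 2 2 2 5 3 3 3 2 2 5 2 3 3 2,
  C 3 5 2 4 2 2 3 3 3 3 2 2 2 4 3 4,
  C 3 2 2 3 2 3 3 2 3 4 2 4 2 2 3 5,
  C 3 3 2 2 2 5 3 3 3 2 2 4 2 3 3 2,
  C 3 5 2 3 2 2 3 4 3 3 2 2 2 4 3 3,
  C 3 2 2 5 2 3 3 2 3 4 2 3 2 2 3 5,
  C 3 3 2 2 2 5 3 4 3 2 2 3 2 3 3 2,
  C 3 5 2 4 2 2 3 3 3 3 2 2 2 4 3 4,
  C 3 2 2 5 2 3 3 2 3 4 2 4 2 2 3 5,
  C 3 3 2 2 2 5 3 3 3 2 2 5 2 4 3 2,
  C 3 3 2 3 2 2 3 4 3 4 2 2 2 3 3 3,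
  C 3 2 2 4 2 4 3 2 3 5 2 3 2 2 3 5,
  C 3 3 2 2 2 4 3 3 3 2 2 5 2 3 3 2,
  C 3 4 2 3 2 2 3 4 3 3 2 2 2 5 3 3,
  C 3 2 2 4 2 3 3 2 3 5 2 3 2 2 3 5,
  C 3 4 2 2 2 3 3 3 3 2 2 5 2 4 3 2,
  C 3 3 2 3 2 2 3 4 3 4 2 2 2 5 3 3,
  C 3 2 2 4 2 4 3 2 3 5 2 3 2 2 3 5,
  C 3 3 2 2 2 5 3 4 3 2 2 3 2 3 3 2,
  C 3 4 2 4 2 2 3 3 3 3 2 2 2 4 3 4,
  C 3 2 2 5 2 3 3 2 3 5 2 3 2 2 3 4,
  C 3 3 2 2 2 5 3 3 3 2 2 4 2 3 3 2],
  [C 3 4 2 3 2 2 3 5 3 3 2 2 2 4 3 3,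
  C 3 2 2 5 2 3 3 2 3 5 2 4 2 2 3 3,
  C 3 3 2 2 2 5 3 4 3 2 2 3 2 3 3 2,
  C 3 4 2 4 2 2 3 5 3 3 2 2 2 4 3 4,
  C 3 2 2 6 2 3 3 2 3 5 2 3 2 2 3 4,
  C 3 3 2 2 2 5 3 3 3 2 2 5 2 3 3 2,
  C 3 4 2 3 2 2 3 5 3 3 2 2 2 4 3 3,
  C 3 2 2 4 2 3 3 2 3 5 2 3 2 2 3 6,
  C 3 3 2 2 2 5 3 3 3 2 2 6 2 3 3 2,
  C 3 4 2 3 2 2 3 4 3 3 2 2 2 4 3 3,
  C 3 2 2 5 2 3 3 2 3 5 2 3 2 2 3 5,
  C 3 3 2 2 2 5 3 3 3 2 2 4 2 3 3 2,
  C 3 4 2 3 2 2 3 6 3 3 2 2 2 4 3 3,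
  C 3 2 2 6 2 3 3 2 3 5 2 3 2 2 3 4,
  C 3 3 2 2 2 5 3 3 3 2 2 5 2 3 3 2,
  C 3 4 2 4 2 2 3 3 3 3 2 2 2 4 3 4,
  C 3 2 2 3 2 3 3 2 3 5 2 4 2 2 3 5,
  C 3 3 2 2 2 5 3 3 3 2 2 4 2 3 3 2,
  C 3 4 2 5 2 2 3 3 3 3 2 2 2 4 3 5,
  C 3 2 2 3 2 3 3 2 3 5 2 5 2 2 3 4,
  C 3 3 2 2 2 5 3 3 3 2 2 5 2 3 3 2,
  C 3 4 2 3 2 2 3 4 3 5 2 2 2 3 3 3,
  C 3 2 2 4 2 4 3 2 3 3 2 3 2 2 3 5,
  C 3 4 2 2 2 3 3 4 3 2 2 3 2 4 3 2,
  C 3 5 2 4 2 2 3 3 3 3 2 2 2 4 3 4,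
  C 3 2 2 5 2 3 3 2 3 4 2 3 2 2 3 4,
  C 3 3 2 2 2 5 3 3 3 2 2 4 2 3 3 2,
  C 3 5 2 3 2 2 3 5 3 3 2 2 2 4 3 3,
  C 3 2 2 5 2 3 3 2 3 4 2 4 2 2 3 3,
  C 3 3 2 2 2 5 3 4 3 2 2 3 2 3 3 2,
  C 3 5 2 4 2 2 3 5 3 3 2 2 2 4 3 4,
  C 3 2 2 5 2 3 3 2 3 4 2 3 2 2 3 5],
  [C 3 5 2 2 2 3 3 3 3 2 2 4 2 4 3 2,
  C 3 3 2 3 2 2 3 4 3 4 2 2 2 3 3 5,
  C 3 2 2 3 2 4 3 2 3 5 2 4 2 2 3 3,
  C 3 3 2 2 2 4 3 4 3 2 2 3 2 3 3 2,
  C 3 4 2 4 2 2 3 5 3 3 2 2 2 5 3 3,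
  C 3 2 2 4 2 3 3 2 3 5 2 3 2 2 3 4,
  C 3 3 2 2 2 4 3 3 3 2 2 5 2 3 3 2,
  C 3 4 2 3 2 2 3 5 3 3 2 2 2 5 3 4,
  C 3 2 2 3 2 3 3 2 3 5 2 4 2 2 3 3,
  C 3 3 2 2 2 4 3 4 3 2 2 5 2 3 3 2,
  C 3 4 2 4 2 2 3 5 3 3 2 2 2 5 3 3,
  C 3 2 2 5 2 4 3 2 3 3 2 3 2 2 3 4,
  C 3 4 2 2 2 3 3 3 3 2 2 4 2 4 3 2,
  C 3 5 2 3 2 2 3 5 3 3 2 2 2 4 3 3,
  C 3 2 2 5 2 3 3 2 3 4 2 3 2 2 3 4,
  C 3 3 2 2 2 5 3 3 3 2 2 4 2 3 3 2,
  C 3 5 2 5 2 2 3 3 3 3 2 2 2 4 3 4,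
  C 3 2 2 3 2 3 3 2 3 4 2 4 2 2 3 3,
  C 3 5 2 2 2 3 3 4 3 2 2 5 2 4 3 2,
  C 3 3 2 3 2 2 3 4 3 4 2 2 2 3 3 3,
  C 3 2 2 4 2 5 3 2 3 3 2 5 2 2 3 3,
  C 3 4 2 2 2 5 3 4 3 2 2 3 2 3 3 2,
  C 3 4 2 4 2 2 3 5 3 3 2 2 2 4 3 3,
  C 3 2 2 4 2 3 3 2 3 5 2 3 2 2 3 4,
  C 3 3 2 2 2 5 3 3 3 2 2 5 2 3 3 2,
  C 3 4 2 3 2 2 3 5 3 3 2 2 2 4 3 4,
  C 3 2 2 3 2 3 3 2 3 5 2 4 2 2 3 3,
  C 3 3 2 2 2 5 3 4 3 2 2 5 2 3 3 2,
  C 3 4 2 4 2 2 3 5 3 3 2 2 2 4 3 3,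
  C 3 2 2 5 2 5 3 2 3 3 2 3 2 2 3 4,
  C 3 4 2 2 2 3 3 3 3 2 2 4 2 4 3 2,
  C 3 3 2 5 2 2 3 3 3 4 2 2 2 5 3 4],
  [C 3 2 2 3 2 3 3 2 3 4 2 4 2 2 3 3,
  C 3 3 2 2 2 4 3 4 3 2 2 5 2 3 3 2,
  C 3 5 2 3 2 2 3 4 3 3 2 2 2 5 3 3,
  C 3 2 2 4 2 3 3 2 3 4 2 3 2 2 3 5,
  C 3 3 2 2 2 4 3 3 3 2 2 5 2 3 3 2,
  C 3 5 2 4 2 2 3 3 3 3 2 2 2 5 3 4,
  C 3 2 2 3 2 3 3 2 3 4 2 4 2 2 3 5,
  C 3 3 2 2 2 4 3 4 3 2 2 5 2 3 3 2,
  C 3 5 2 3 2 2 3 5 3 4 2 2 2 3 3 3,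
  C 3 2 2 4 2 4 3 2 3 3 2 3 2 2 3 4,
  C 3 4 2 2 2 5 3 3 3 2 2 5 2 3 3 2,
  C 3 4 2 3 2 2 3 5 3 3 2 2 2 4 3 3,
  C 3 2 2 4 2 3 3 2 3 5 2 3 2 2 3 4,
  C 3 3 2 2 2 5 3 3 3 2 2 5 2 4 3 2,
  C 3 3 2 3 2 2 3 5 3 4 2 2 2 3 3 3,
  C 3 2 2 4 2 4 3 2 3 5 2 3 2 2 3 4,
  C 3 4 2 2 2 5 3 3 3 2 2 5 2 3 3 2,
  C 3 5 2 4 2 2 3 3 3 3 2 2 2 4 3 4,
  C 3 2 2 3 2 3 3 2 3 4 2 4 2 2 3 5,
  C 3 3 2 2 2 5 3 3 3 2 2 4 2 3 3 2,
  C 3 5 2 3 2 2 3 4 3 3 2 2 2 4 3 3,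
  C 3 2 2 5 2 3 3 2 3 4 2 3 2 2 3 5,
  C 3 3 2 2 2 5 3 4 3 2 2 3 2 3 3 2,
  C 3 5 2 4 2 2 3 3 3 3 2 2 2 4 3 4,
  C 3 2 2 5 2 3 3 2 3 4 2 4 2 2 3 5,
  C 3 5 2 2 2 3 3 3 3 2 2 4 2 4 3 2,
  C 3 3 2 3 2 2 3 4 3 4 2 2 2 3 3 5,
  C 3 2 2 3 2 4 3 2 3 5 2 4 2 2 3 3,
  C 3 3 2 2 2 4 3 5 3 2 2 4 2 3 3 2,
  C 3 4 2 3 2 2 3 4 3 3 2 2 2 5 3 3,
  C 3 2 2 4 2 4 3 2 3 3 2 3 2 2 3 5,
  C 3 4 2 2 2 3 3 3 3 2 2 5 2 4 3 2],
  [C 3 5 2 3 2 2 3 4 3 3 2 2 2 4 3 3,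
  C 3 2 2 4 2 3 3 2 3 4 2 3 2 2 3 5,
  C 3 3 2 2 2 5 3 3 3 2 2 5 2 3 3 2,
  C 3 5 2 3 2 2 3 4 3 4 2 2 2 3 3 3,
  C 3 2 2 4 2 4 3 2 3 3 2 3 2 2 3 5,
  C 3 4 2 2 2 5 3 3 3 2 2 5 2 4 3 2,
  C 3 5 2 3 2 2 3 4 3 3 2 2 2 5 3 5,
  C 3 2 2 3 2 3 3 2 3 4 2 4 2 2 3 3,
  C 3 3 2 2 2 4 3 4 3 2 2 3 2 5 3 2,
  C 3 3 2 4 2 2 3 5 3 4 2 2 2 3 3 3,
  C 3 2 2 4 2 4 3 2 3 3 2 3 2 2 3 4,
  C 3 4 2 2 2 5 3 3 3 2 2 5 2 3 3 2,
  C 3 4 2 3 2 2 3 5 3 3 2 2 2 4 3 3,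
  C 3 2 2 4 2 3 3 2 3 5 2 3 2 2 3 4,
  C 3 3 2 2 2 5 3 3 3 2 2 5 2 4 3 2,
  C 3 3 2 3 2 2 3 5 3 4 2 2 2 3 3 3,
  C 3 2 2 4 2 4 3 2 3 5 2 3 2 2 3 4,
  C 3 4 2 2 2 5 3 5 3 2 2 3 2 3 3 2,
  C 3 4 2 4 2 2 3 3 3 3 2 2 2 4 3 4,
  C 3 2 2 3 2 5 3 2 3 3 2 5 2 2 3 3,
  C 3 4 2 2 2 3 3 4 3 2 2 5 2 4 3 2,
  C 3 3 2 3 2 2 3 4 3 4 2 2 2 5 3 3,
  C 3 2 2 4 2 3 3 2 3 4 2 3 2 2 3 5,
  C 3 3 2 2 2 4 3 3 3 2 2 5 2 3 3 2,
  C 3 5 2 3 2 2 3 4 3 3 2 2 2 5 3 3,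
  C 3 2 2 4 2 4 3 2 3 3 2 3 2 2 3 5,
  C 3 4 2 2 2 3 3 3 3 2 2 5 2 4 3 2,
  C 3 5 2 3 2 2 3 4 3 4 2 2 2 5 3 3,
  C 3 2 2 4 2 3 3 2 3 5 2 5 2 2 3 3,
  C 3 3 2 2 2 4 3 4 3 2 2 3 2 3 3 2,
  C 3 4 2 4 2 2 3 3 3 5 2 2 2 3 3 4,
  C 3 2 2 5 2 4 3 2 3 3 2 3 2 2 3 4],
  [C 3 4 2 2 2 3 3 3 3 2 2 4 2 4 3 2,
  C 3 5 2 3 2 2 3 5 3 3 2 2 2 4 3 3,
  C 3 2 2 5 2 3 3 2 3 4 2 3 2 2 3 4,
  C 3 3 2 2 2 5 3 3 3 2 2 4 2 3 3 2,
  C 3 5 2 3 2 2 3 5 3 4 2 2 2 3 3 3,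
  C 3 2 2 5 2 4 3 2 3 3 2 3 2 2 3 4,
  C 3 4 2 2 2 5 3 3 3 2 2 4 2 4 3 2,
  C 3 5 2 3 2 2 3 5 3 3 2 2 2 5 3 4,
  C 3 2 2 3 2 3 3 2 3 4 2 4 2 2 3 3,
  C 3 3 2 2 2 4 3 4 3 2 2 5 2 3 3 2,
  C 3 5 2 3 2 2 3 4 3 3 2 2 2 5 3 3,
  C 3 2 2 4 2 3 3 2 3 4 2 3 2 2 3 5,
  C 3 3 2 2 2 4 3 3 3 2 2 5 2 3 3 2,
  C 3 5 2 4 2 2 3 3 3 3 2 2 2 5 3 4,
  C 3 2 2 3 2 3 3 2 3 4 2 4 2 2 3 5,
  C 3 3 2 2 2 4 3 4 3 2 2 5 2 3 3 2,
  C 3 5 2 3 2 2 3 5 3 4 2 2 2 3 3 3,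
  C 3 2 2 4 2 4 3 2 3 3 2 3 2 2 3 4,
  C 3 4 2 2 2 5 3 3 3 2 2 5 2 3 3 2,
  C 3 4 2 3 2 2 3 5 3 3 2 2 2 4 3 3,
  C 3 2 2 4 2 3 3 2 3 5 2 3 2 2 3 4,
  C 3 3 2 2 2 5 3 3 3 2 2 5 2 4 3 2,
  C 3 3 2 3 2 2 3 5 3 4 2 2 2 3 3 3,
  C 3 2 2 4 2 4 3 2 3 5 2 3 2 2 3 4,
  C 3 4 2 2 2 5 3 3 3 2 2 5 2 3 3 2,
  C 3 5 2 4 2 2 3 3 3 4 2 2 2 3 3 4,
  C 3 2 2 3 2 4 3 2 3 3 2 4 2 2 3 5,
  C 3 4 2 2 2 5 3 3 3 2 2 4 2 3 3 2,
  C 3 4 2 3 2 2 3 4 3 3 2 2 2 4 3 3,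
  C 3 2 2 5 2 3 3 2 3 5 2 3 2 2 3 5,
  C 3 3 2 2 2 5 3 3 3 2 2 4 2 4 3 2,
  C 3 3 2 3 2 2 3 4 3 4 2 2 2 3 3 3],
  [C 3 2 2 5 2 4 3 2 3 5 2 3 2 2 3 5,
  C 3 4 2 2 2 5 3 3 3 2 2 4 2 3 3 2,
  C 3 4 2 5 2 2 3 3 3 3 2 2 2 4 3 4,
  C 3 2 2 3 2 3 3 2 3 5 2 4 2 2 3 3,
  C 3 4 2 2 2 3 3 4 3 2 2 5 2 4 3 2,
  C 3 3 2 3 2 2 3 4 3 4 2 2 2 5 3 3,
  C 3 2 2 4 2 3 3 2 3 5 2 3 2 2 3 5,
  C 3 3 2 2 2 4 3 3 3 2 2 5 2 3 3 2,
  C 3 4 2 3 2 2 3 4 3 3 2 2 2 5 3 3,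
  C 3 2 2 4 2 4 3 2 3 3 2 3 2 2 3 5,
  C 3 4 2 2 2 3 3 3 3 2 2 5 2 4 3 2,
  C 3 5 2 3 2 2 3 4 3 3 2 2 2 4 3 3,
  C 3 2 2 4 2 3 3 2 3 4 2 3 2 2 3 5,
  C 3 3 2 2 2 5 3 3 3 2 2 5 2 3 3 2,
  C 3 5 2 3 2 2 3 4 3 4 2 2 2 3 3 3,
  C 3 2 2 4 2 4 3 2 3 3 2 3 2 2 3 5,
  C 3 4 2 2 2 5 3 3 3 2 2 5 2 4 3 2,
  C 3 5 2 3 2 2 3 4 3 3 2 2 2 5 3 5,
  C 3 2 2 3 2 3 3 2 3 4 2 4 2 2 3 3,
  C 3 3 2 2 2 4 3 4 3 2 2 3 2 5 3 2,
  C 3 3 2 4 2 2 3 5 3 4 2 2 2 3 3 3,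
  C 3 2 2 4 2 4 3 2 3 3 2 3 2 2 3 4,
  C 3 4 2 2 2 5 3 3 3 2 2 5 2 3 3 2,
  C 3 4 2 3 2 2 3 5 3 3 2 2 2 4 3 3,
  C 3 2 2 4 2 3 3 2 3 5 2 3 2 2 3 4,
  C 3 3 2 2 2 5 3 3 3 2 2 5 2 4 3 2,
  C 3 3 2 3 2 2 3 6 3 4 2 2 2 3 3 3,
  C 3 2 2 4 2 4 3 2 3 5 2 3 2 2 3 4,
  C 3 4 2 2 2 5 3 3 3 2 2 5 2 3 3 2,
  C 3 5 2 4 2 2 3 3 3 3 2 2 2 4 3 4,
  C 3 2 2 3 2 3 3 2 3 4 2 4 2 2 3 5,
  C 3 3 2 2 2 5 3 3 3 2 2 4 2 3 3 2],
  [C 3 5 2 3 2 2 3 4 3 3 2 2 2 4 3 3,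
  C 3 2 2 5 2 3 3 2 3 4 2 3 2 2 3 5,
  C 3 3 2 2 2 5 3 4 3 2 2 3 2 3 3 2,
  C 3 5 2 4 2 2 3 3 3 3 2 2 2 4 3 4,
  C 3 2 2 5 2 3 3 2 3 4 2 4 2 2 3 5,
  C 3 3 2 2 2 5 3 3 3 2 2 5 2 4 3 2,
  C 3 3 2 3 2 2 3 4 3 4 2 2 2 3 3 3,
  C 3 2 2 4 2 4 3 2 3 5 2 3 2 2 3 5,
  C 3 3 2 2 2 4 3 3 3 2 2 5 2 3 3 2,
  C 3 4 2 3 2 2 3 4 3 3 2 2 2 5 3 3,
  C 3 2 2 4 2 3 3 2 3 5 2 3 2 2 3 5,
  C 3 4 2 2 2 3 3 3 3 2 2 5 2 4 3 2,
  C 3 3 2 3 2 2 3 4 3 4 2 2 2 5 3 3,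
  C 3 2 2 4 2 4 3 2 3 5 2 3 2 2 3 5,
  C 3 3 2 2 2 5 3 4 3 2 2 3 2 3 3 2,
  C 3 4 2 4 2 2 3 3 3 3 2 2 2 4 3 4,
  C 3 2 2 5 2 3 3 2 3 5 2 3 2 2 3 4,
  C 3 3 2 2 2 5 3 3 3 2 2 4 2 3 3 2,
  C 3 4 2 3 2 2 3 5 3 3 2 2 2 4 3 3,
  C 3 2 2 5 2 3 3 2 3 5 2 4 2 2 3 3,
  C 3 3 2 2 2 5 3 4 3 2 2 3 2 3 3 2,
  C 3 4 2 4 2 2 3 5 3 3 2 2 2 4 3 4,
  C 3 2 2 5 2 3 3 2 3 5 2 3 2 2 3 5,
  C 3 6 2 2 2 3 3 3 3 2 2 4 2 4 3 2,
  C 3 3 2 3 2 2 3 4 3 4 2 2 2 3 3 5,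
  C 3 2 2 3 2 4 3 2 3 5 2 4 2 2 3 3,
  C 3 3 2 2 2 4 3 4 3 2 2 3 2 3 3 2,
  C 3 4 2 4 2 2 3 5 3 3 2 2 2 5 3 3,
  C 3 2 2 4 2 3 3 2 3 5 2 3 2 2 3 4,
  C 3 3 2 2 2 4 3 3 3 2 2 5 2 3 3 2,
  C 3 4 2 3 2 2 3 5 3 3 2 2 2 5 3 4,
  C 3 2 2 3 2 3 3 2 3 5 2 4 2 2 3 3],
  [C 3 3 2 2 2 4 3 5 3 2 2 3 2 5 3 2,
  C 3 3 2 4 2 2 3 5 3 4 2 2 2 3 3 3,
  C 3 2 2 4 2 4 3 2 3 3 2 3 2 2 3 4,
  C 3 4 2 2 2 5 3 3 3 2 2 5 2 3 3 2,
  C 3 4 2 3 2 2 3 5 3 3 2 2 2 4 3 3,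
  C 3 2 2 4 2 3 3 2 3 5 2 3 2 2 3 4,
  C 3 3 2 2 2 5 3 3 3 2 2 5 2 4 3 2,
  C 3 3 2 3 2 2 3 5 3 4 2 2 2 3 3 3,
  C 3 2 2 4 2 4 3 2 3 5 2 3 2 2 3 4,
  C 3 4 2 2 2 5 3 3 3 2 2 5 2 3 3 2,
  C 3 5 2 4 2 2 3 3 3 3 2 2 2 4 3 4,
  C 3 2 2 3 2 3 3 2 3 4 2 4 2 2 3 5,
  C 3 3 2 2 2 5 3 3 3 2 2 4 2 3 3 2,
  C 3 5 2 3 2 2 3 4 3 3 2 2 2 4 3 5,
  C 3 2 2 3 2 3 3 2 3 4 2 5 2 2 3 3,
  C 3 3 2 2 2 5 3 4 3 2 2 3 2 4 3 2,
  C 3 3 2 4 2 2 3 3 3 4 2 2 2 3 3 4,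
  C 3 2 2 5 2 4 3 2 3 5 2 3 2 2 3 4,
  C 3 3 2 2 2 4 3 3 3 2 2 4 2 3 3 2,
  C 3 4 2 3 2 2 3 5 3 3 2 2 2 5 3 3,
  C 3 2 2 5 2 3 3 2 3 5 2 3 2 2 3 4,
  C 3 4 2 2 2 3 3 3 3 2 2 4 2 4 3 2,
  C 3 3 2 3 2 2 3 5 3 4 2 2 2 5 3 3,
  C 3 2 2 5 2 4 3 2 3 5 2 3 2 2 3 4,
  C 3 3 2 2 2 4 3 5 3 2 2 3 2 3 3 2,
  C 3 4 2 4 2 2 3 3 3 3 2 2 2 5 3 4,
  C 3 2 2 3 2 4 3 2 3 3 2 4 2 2 3 5,
  C 3 4 2 2 2 3 3 3 3 2 2 4 2 4 3 2,
  C 3 5 2 3 2 2 3 4 3 3 2 2 2 5 3 3,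
  C 3 2 2 5 2 3 3 2 3 4 2 3 2 2 3 5,
  C 3 3 2 2 2 4 3 3 3 2 2 4 2 3 3 2,
  C 3 5 2 3 2 2 3 4 3 4 2 2 2 3 3 3],
  [C 3 2 2 5 2 4 3 2 3 3 2 3 2 2 3 5,
  C 3 4 2 2 2 5 3 3 3 2 2 4 2 3 3 2,
  C 3 4 2 3 2 2 3 4 3 3 2 2 2 4 3 3,
  C 3 2 2 5 2 3 3 2 3 5 2 3 2 2 3 5,
  C 3 3 2 2 2 5 3 3 3 2 2 4 2 4 3 2,
  C 3 3 2 3 2 2 3 4 3 4 2 2 2 3 3 3,
  C 3 2 2 5 2 4 3 2 3 5 2 3 2 2 3 5,
  C 3 4 2 2 2 5 3 3 3 2 2 4 2 3 3 2,
  C 3 5 2 5 2 2 3 3 3 3 2 2 2 4 3 4,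
  C 3 2 2 3 2 3 3 2 3 4 2 4 2 2 3 3,
  C 3 5 2 2 2 3 3 4 3 2 2 5 2 4 3 2,
  C 3 3 2 3 2 2 3 4 3 4 2 2 2 3 3 3,
  C 3 2 2 4 2 4 3 2 3 5 2 3 2 2 3 5,
  C 3 3 2 2 2 4 3 3 3 2 2 5 2 3 3 2,
  C 3 4 2 3 2 2 3 4 3 3 2 2 2 5 3 3,
  C 3 2 2 4 2 3 3 2 3 5 2 3 2 2 3 5,
  C 3 4 2 2 2 3 3 3 3 2 2 5 2 4 3 2,
  C 3 3 2 3 2 2 3 4 3 4 2 2 2 5 3 3,
  C 3 2 2 4 2 4 3 2 3 5 2 3 2 2 3 5,
  C 3 3 2 2 2 5 3 4 3 2 2 3 2 3 3 2,
  C 3 4 2 4 2 2 3 3 3 3 2 2 2 4 3 4,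
  C 3 2 2 5 2 3 3 2 3 5 2 3 2 2 3 4,
  C 3 3 2 2 2 5 3 3 3 2 2 4 2 3 3 2,
  C 3 4 2 3 2 2 3 5 3 3 2 2 2 4 3 3,
  C 3 2 2 5 2 3 3 2 3 5 2 4 2 2 3 3,
  C 3 3 2 2 2 5 3 4 3 2 2 3 2 3 3 2,
  C 3 4 2 4 2 2 3 5 3 3 2 2 2 4 3 4,
  C 3 2 2 5 2 3 3 2 3 5 2 6 2 2 3 3,
  C 3 3 2 2 2 5 3 5 3 2 2 3 2 3 3 2,
  C 3 4 2 5 2 2 3 3 3 5 2 2 2 3 3 4,
  C 3 2 2 3 2 4 3 2 3 3 2 4 2 2 3 3,
  C 3 4 2 2 2 3 3 5 3 2 2 3 2 5 3 2],
  [C 3 3 2 5 2 2 3 3 3 5 2 2 2 4 3 4,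
  C 3 2 2 3 2 3 3 2 3 4 2 4 2 2 3 3,
  C 3 3 2 2 2 4 3 5 3 2 2 3 2 5 3 2,
  C 3 4 2 5 2 2 3 3 3 5 2 2 2 3 3 4,
  C 3 2 2 3 2 6 3 2 3 3 2 4 2 2 3 3,
  C 3 4 2 2 2 3 3 5 3 2 2 3 2 4 3 2,
  C 3 3 2 5 2 2 3 3 3 5 2 2 2 4 3 4,
  C 3 2 2 3 2 5 3 2 3 3 2 4 2 2 3 3,
  C 3 6 2 2 2 3 3 4 3 2 2 5 2 4 3 2,
  C 3 3 2 3 2 2 3 4 3 4 2 2 2 3 3 3,
  C 3 2 2 4 2 4 3 2 3 5 2 3 2 2 3 5,
  C 3 3 2 2 2 4 3 3 3 2 2 5 2 3 3 2,
  C 3 4 2 3 2 2 3 4 3 3 2 2 2 5 3 3,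
  C 3 2 2 4 2 3 3 2 3 5 2 3 2 2 3 5,
  C 3 4 2 2 2 3 3 3 3 2 2 5 2 4 3 2,
  C 3 3 2 3 2 2 3 4 3 5 2 2 2 3 3 5,
  C 3 2 2 3 2 4 3 2 3 5 2 4 2 2 3 3,
  C 3 3 2 2 2 4 3 4 3 2 2 3 2 3 3 2,
  C 3 4 2 4 2 2 3 5 3 3 2 2 2 5 3 3,
  C 3 2 2 4 2 3 3 2 3 5 2 3 2 2 3 4,
  C 3 3 2 2 2 4 3 3 3 2 2 5 2 3 3 2,
  C 3 4 2 3 2 2 3 5 3 3 2 2 2 5 3 4,
  C 3 2 2 3 2 3 3 2 3 5 2 4 2 2 3 3,
  C 3 3 2 2 2 4 3 4 3 2 2 5 2 3 3 2,
  C 3 4 2 4 2 2 3 5 3 3 2 2 2 5 3 3,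
  C 3 2 2 5 2 4 3 2 3 3 2 3 2 2 3 4,
  C 3 4 2 2 2 3 3 3 3 2 2 4 2 4 3 2,
  C 3 5 2 3 2 2 3 5 3 3 2 2 2 4 3 3,
  C 3 2 2 5 2 3 3 2 3 4 2 3 2 2 3 4,
  C 3 5 2 2 2 3 3 3 3 2 2 4 2 5 3 2,
  C 3 3 2 3 2 2 3 5 3 4 2 2 2 3 3 4,
  C 3 2 2 3 2 4 3 2 3 3 2 4 2 2 3 3],
  [C 3 4 2 2 2 5 3 4 3 2 2 5 2 3 3 2,
  C 3 4 2 3 2 2 3 4 3 3 2 2 2 4 3 3,
  C 3 2 2 4 2 3 3 2 3 5 2 3 2 2 3 5,
  C 3 3 2 2 2 5 3 3 3 2 2 5 2 3 3 2,
  C 3 4 2 4 2 2 3 3 3 3 2 2 2 4 3 4,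
  C 3 2 2 3 2 3 3 2 3 5 2 4 2 2 3 5,
  C 3 3 2 2 2 5 3 4 3 2 2 5 2 3 3 2,
  C 3 4 2 3 2 2 3 4 3 5 2 2 2 3 3 3,
  C 3 2 2 4 2 4 3 2 3 3 2 3 2 2 3 5,
  C 3 4 2 2 2 3 3 4 3 2 2 3 2 4 3 2,
  C 3 5 2 4 2 2 3 3 3 3 2 2 2 4 3 4,
  C 3 2 2 5 2 3 3 2 3 4 2 3 2 2 3 5,
  C 3 3 2 2 2 5 3 3 3 2 2 4 2 3 3 2,
  C 3 5 2 3 2 2 3 4 3 3 2 2 2 4 3 3,
  C 3 2 2 5 2 3 3 2 3 4 2 4 2 2 3 3,
  C 3 3 2 2 2 5 3 4 3 2 2 3 2 3 3 2,
  C 3 5 2 4 2 2 3 5 3 3 2 2 2 4 3 3,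
  C 3 2 2 4 2 3 3 2 3 4 2 3 2 2 3 4,
  C 3 3 2 2 2 5 3 3 3 2 2 5 2 3 3 2,
  C 3 5 2 3 2 2 3 5 3 3 2 2 2 4 3 4,
  C 3 2 2 3 2 3 3 2 3 4 2 4 2 2 3 3,
  C 3 3 2 2 2 5 3 4 3 2 2 5 2 3 3 2,
  C 3 5 2 4 2 2 3 5 3 3 2 2 2 4 3 3,
  C 3 2 2 5 2 5 3 2 3 3 2 3 2 2 3 4,
  C 3 4 2 2 2 3 3 3 3 2 2 4 2 4 3 2,
  C 3 3 2 5 2 2 3 3 3 4 2 2 2 5 3 4,
  C 3 2 2 3 2 3 3 2 3 4 2 4 2 2 3 3,
  C 3 3 2 2 2 4 3 4 3 2 2 5 2 3 3 2,
  C 3 5 2 3 2 2 3 4 3 3 2 2 2 5 3 3,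
  C 3 2 2 4 2 3 3 2 3 4 2 3 2 2 3 5,
  C 3 3 2 2 2 4 3 3 3 2 2 5 2 3 3 2,
  C 3 5 2 4 2 2 3 3 3 3 2 2 2 5 3 4],
  [C 3 2 2 3 2 3 3 2 3 4 2 4 2 2 3 5,
  C 3 3 2 2 2 4 3 4 3 2 2 5 2 3 3 2,
  C 3 5 2 3 2 2 3 5 3 4 2 2 2 3 3 3,
  C 3 2 2 4 2 4 3 2 3 3 2 3 2 2 3 4,
  C 3 4 2 2 2 5 3 3 3 2 2 5 2 3 3 2,
  C 3 4 2 3 2 2 3 5 3 3 2 2 2 4 3 3,
  C 3 2 2 4 2 3 3 2 3 5 2 3 2 2 3 4,
  C 3 3 2 2 2 5 3 3 3 2 2 5 2 4 3 2,
  C 3 3 2 3 2 2 3 5 3 4 2 2 2 3 3 3,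
  C 3 2 2 4 2 4 3 2 3 5 2 3 2 2 3 4,
  C 3 4 2 2 2 5 3 3 3 2 2 5 2 3 3 2,
  C 3 5 2 4 2 2 3 3 3 3 2 2 2 4 3 4,
  C 3 2 2 3 2 3 3 2 3 4 2 4 2 2 3 5,
  C 3 3 2 2 2 5 3 3 3 2 2 4 2 3 3 2,
  C 3 5 2 3 2 2 3 4 3 3 2 2 2 4 3 3,
  C 3 2 2 5 2 3 3 2 3 4 2 3 2 2 3 5,
  C 3 3 2 2 2 5 3 4 3 2 2 3 2 3 3 2,
  C 3 5 2 4 2 2 3 3 3 3 2 2 2 4 3 4,
  C 3 2 2 5 2 3 3 2 3 4 2 4 2 2 3 5,
  C 3 3 2 2 2 5 3 3 3 2 2 5 2 4 3 2,
  C 3 3 2 3 2 2 3 4 3 4 2 2 2 3 3 3,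
  C 3 2 2 4 2 4 3 2 3 5 2 3 2 2 3 5,
  C 3 3 2 2 2 4 3 3 3 2 2 5 2 3 3 2,
  C 3 4 2 3 2 2 3 4 3 3 2 2 2 5 3 3,
  C 3 2 2 4 2 3 3 2 3 5 2 3 2 2 3 5,
  C 3 4 2 2 2 3 3 3 3 2 2 5 2 4 3 2,
  C 3 3 2 3 2 2 3 4 3 4 2 2 2 5 3 3,
  C 3 2 2 4 2 4 3 2 3 5 2 3 2 2 3 5,
  C 3 3 2 2 2 5 3 4 3 2 2 3 2 3 3 2,
  C 3 4 2 4 2 2 3 3 3 3 2 2 2 4 3 4,
  C 3 2 2 5 2 3 3 2 3 5 2 3 2 2 3 4,
  C 3 3 2 2 2 5 3 3 3 2 2 4 2 3 3 2],
  [C 3 4 2 3 2 2 3 5 3 3 2 2 2 4 3 3,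
  C 3 2 2 5 2 3 3 2 3 5 2 4 2 2 3 3,
  C 3 3 2 2 2 5 3 4 3 2 2 3 2 3 3 2,
  C 3 4 2 4 2 2 3 5 3 3 2 2 2 4 3 4,
  C 3 2 2 5 2 3 3 2 3 5 2 6 2 2 3 3,
  C 3 3 2 2 2 5 3 5 3 2 2 3 2 3 3 2,
  C 3 4 2 5 2 2 3 3 3 5 2 2 2 3 3 4,
  C 3 2 2 3 2 4 3 2 3 3 2 4 2 2 3 3,
  C 3 4 2 2 2 3 3 5 3 2 2 3 2 5 3 2,
  C 3 3 2 5 2 2 3 3 3 5 2 2 2 4 3 4,
  C 3 2 2 3 2 3 3 2 3 4 2 4 2 2 3 3,
  C 3 3 2 2 2 4 3 5 3 2 2 3 2 5 3 2,
  C 3 4 2 5 2 2 3 3 3 5 2 2 2 3 3 4,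
  C 3 2 2 3 2 6 3 2 3 3 2 5 2 2 3 4,
  C 3 4 2 2 2 3 3 3 3 2 2 4 2 4 3 2,
  C 3 3 2 3 2 2 3 4 3 5 2 2 2 3 3 5,
  C 3 2 2 3 2 4 3 2 3 5 2 4 2 2 3 3,
  C 3 3 2 2 2 4 3 4 3 2 2 3 2 3 3 2,
  C 3 4 2 4 2 2 3 5 3 3 2 2 2 5 3 3,
  C 3 2 2 4 2 3 3 2 3 5 2 3 2 2 3 4,
  C 3 3 2 2 2 4 3 3 3 2 2 5 2 3 3 2,
  C 3 4 2 3 2 2 3 5 3 3 2 2 2 5 3 4,
  C 3 2 2 3 2 3 3 2 3 5 2 4 2 2 3 3,
  C 3 3 2 2 2 4 3 4 3 2 2 5 2 3 3 2,
  C 3 4 2 4 2 2 3 5 3 3 2 2 2 5 3 3,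
  C 3 2 2 5 2 4 3 2 3 3 2 4 2 2 3 3,
  C 3 4 2 2 2 3 3 4 3 2 2 3 2 4 3 2,
  C 3 5 2 4 2 2 3 5 3 3 2 2 2 4 3 3,
  C 3 2 2 4 2 3 3 2 3 4 2 3 2 2 3 4,
  C 3 3 2 2 2 5 3 3 3 2 2 5 2 3 3 2,
  C 3 5 2 3 2 2 3 5 3 3 2 2 2 4 3 4,
  C 3 2 2 3 2 3 3 2 3 4 2 4 2 2 3 3],
  [C 3 3 2 2 2 5 3 4 3 2 2 5 2 3 3 2,
  C 3 5 2 4 2 2 3 5 3 3 2 2 2 4 3 3,
  C 3 2 2 4 2 5 3 2 3 3 2 3 2 2 3 4,
  C 3 4 2 2 2 3 3 3 3 2 2 5 2 4 3 2,
  C 3 3 2 4 2 2 3 3 3 4 2 2 2 5 3 4,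
  C 3 2 2 3 2 3 3 2 3 4 2 4 2 2 3 5,
  C 3 3 2 2 2 4 3 3 3 2 2 5 2 3 3 2,
  C 3 5 2 3 2 2 3 4 3 3 2 2 2 5 3 3,
  C 3 2 2 4 2 3 3 2 3 4 2 3 2 2 3 5,
  C 3 3 2 2 2 4 3 4 3 2 2 3 2 3 3 2,
  C 3 5 2 4 2 2 3 3 3 3 2 2 2 5 3 4,
  C 3 2 2 5 2 3 3 2 3 4 2 3 2 2 3 4,
  C 3 3 2 2 2 4 3 3 3 2 2 4 2 3 3 2,
  C 3 5 2 3 2 2 3 5 3 3 2 2 2 5 3 3,
  C 3 2 2 5 2 3 3 2 3 4 2 4 2 2 3 3,
  C 3 3 2 2 2 4 3 4 3 2 2 3 2 3 3 2,
  C 3 5 2 4 2 2 3 5 3 3 2 2 2 5 3 4,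
  C 3 2 2 5 2 3 3 2 3 4 2 3 2 2 3 5,
  C 3 5 2 2 2 3 3 3 3 2 2 4 2 4 3 2,
  C 3 3 2 3 2 2 3 4 3 4 2 2 2 3 3 5,
  C 3 2 2 3 2 4 3 2 3 5 2 4 2 2 3 3,
  C 3 3 2 2 2 4 3 4 3 2 2 3 2 3 3 2,
  C 3 4 2 4 2 2 3 5 3 3 2 2 2 5 3 3,
  C 3 2 2 4 2 3 3 2 3 5 2 3 2 2 3 4,
  C 3 3 2 2 2 4 3 3 3 2 2 5 2 3 3 2,
  C 3 4 2 3 2 2 3 5 3 3 2 2 2 5 3 4,
  C 3 2 2 3 2 3 3 2 3 5 2 4 2 2 3 3,
  C 3 3 2 2 2 4 3 4 3 2 2 5 2 3 3 2,
  C 3 4 2 4 2 2 3 5 3 5 2 2 2 3 3 3,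
  C 3 2 2 4 2 4 3 2 3 3 2 3 2 2 3 4,
  C 3 4 2 2 2 3 3 5 3 2 2 3 2 5 3 2,
  C 3 3 2 4 2 2 3 3 3 4 2 2 2 5 3 4],
  [C 3 2 2 3 2 3 3 2 3 4 2 4 2 2 3 5,
  C 3 3 2 2 2 4 3 3 3 2 2 4 2 3 3 2,
  C 3 5 2 3 2 2 3 4 3 3 2 2 2 5 3 3,
  C 3 2 2 5 2 3 3 2 3 4 2 3 2 2 3 5,
  C 3 3 2 2 2 4 3 4 3 2 2 3 2 3 3 2,
  C 3 5 2 4 2 2 3 3 3 3 2 2 2 5 3 4,
  C 3 2 2 5 2 3 3 2 3 4 2 4 2 2 3 5,
  C 3 3 2 2 2 4 3 3 3 2 2 5 2 5 3 2,
  C 3 3 2 3 2 2 3 4 3 4 2 2 2 3 3 3,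
  C 3 2 2 4 2 4 3 2 3 3 2 5 2 2 3 3,
  C 3 4 2 2 2 5 3 4 3 2 2 3 2 3 3 2,
  C 3 4 2 4 2 2 3 3 3 3 2 2 2 4 3 4,
  C 3 2 2 5 2 3 3 2 3 5 2 3 2 2 3 4,
  C 3 3 2 2 2 5 3 3 3 2 2 4 2 3 3 2,
  C 3 4 2 3 2 2 3 5 3 3 2 2 2 4 3 3,
  C 3 2 2 5 2 3 3 2 3 5 2 4 2 2 3 3,
  C 3 3 2 2 2 5 3 4 3 2 2 3 2 3 3 2,
  C 3 4 2 4 2 2 3 5 3 3 2 2 2 4 3 4,
  C 3 2 2 5 2 3 3 2 3 5 2 3 2 2 3 5,
  C 3 4 2 2 2 3 3 3 3 2 2 4 2 4 3 2,
  C 3 3 2 3 2 2 3 4 3 4 2 2 2 5 3 3,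
  C 3 2 2 5 2 3 3 2 3 4 2 3 2 2 3 5,
  C 3 3 2 2 2 4 3 3 3 2 2 4 2 3 3 2,
  C 3 5 2 3 2 2 3 4 3 3 2 2 2 5 3 3,
  C 3 2 2 5 2 4 3 2 3 3 2 3 2 2 3 5,
  C 3 4 2 2 2 3 3 3 3 2 2 4 2 4 3 2,
  C 3 5 2 3 2 2 3 4 3 4 2 2 2 5 3 3,
  C 3 2 2 5 2 3 3 2 3 5 2 4 2 2 3 3,
  C 3 3 2 2 2 4 3 4 3 2 2 3 2 3 3 2,
  C 3 4 2 4 2 2 3 5 3 3 2 2 2 5 3 3,
  C 3 2 2 4 2 3 3 2 3 5 2 3 2 2 3 4,
  C 3 3 2 2 2 4 3 3 3 2 2 5 2 3 3 2],
  [C 3 4 2 3 2 2 3 5 3 3 2 2 2 5 3 4,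
  C 3 2 2 3 2 3 3 2 3 5 2 4 2 2 3 3,
  C 3 3 2 2 2 4 3 4 3 2 2 6 2 3 3 2,
  C 3 4 2 3 2 2 3 4 3 3 2 2 2 5 3 3,
  C 3 2 2 4 2 3 3 2 3 5 2 3 2 2 3 5,
  C 3 3 2 2 2 4 3 3 3 2 2 5 2 3 3 2,
  C 3 4 2 3 2 2 3 6 3 3 2 2 2 5 3 3,
  C 3 2 2 6 2 3 3 2 3 5 2 3 2 2 3 4,
  C 3 3 2 2 2 4 3 3 3 2 2 4 2 3 3 2,
  C 3 4 2 3 2 2 3 5 3 3 2 2 2 5 3 3,
  C 3 2 2 5 2 3 3 2 3 5 2 3 2 2 3 6,
  C 3 3 2 2 2 4 3 3 3 2 2 6 2 3 3 2,
  C 3 4 2 3 2 2 3 4 3 3 2 2 2 5 3 3,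
  C 3 2 2 4 2 3 3 2 3 5 2 5 2 2 3 3,
  C 3 3 2 2 2 4 3 4 3 2 2 3 2 3 3 2,
  C 3 4 2 4 2 2 3 3 3 5 2 2 2 3 3 4,
  C 3 2 2 5 2 4 3 2 3 3 2 3 2 2 3 4,
  C 3 4 2 2 2 3 3 3 3 2 2 4 2 4 3 2,
  C 3 5 2 3 2 2 3 5 3 3 2 2 2 4 3 3,
  C 3 2 2 5 2 3 3 2 3 4 2 3 2 2 3 4,
  C 3 3 2 2 2 5 3 3 3 2 2 4 2 3 3 2,
  C 3 6 2 3 2 2 3 5 3 3 2 2 2 6 3 3,
  C 3 2 2 5 2 3 3 2 3 5 2 3 2 2 3 4,
  C 3 3 2 2 2 4 3 3 3 2 2 4 2 3 3 2,
  C 3 4 2 3 2 2 3 5 3 3 2 2 2 5 3 3,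
  C 3 2 2 5 2 3 3 2 3 6 2 3 2 2 3 4,
  C 3 3 2 2 2 6 3 3 3 2 2 4 2 3 3 2,
  C 3 5 2 3 2 2 3 5 3 3 2 2 2 4 3 3,
  C 3 2 2 5 2 3 3 2 3 4 2 3 2 2 3 4,
  C 3 5 2 2 2 3 3 3 3 2 2 4 2 4 3 2,
  C 3 3 2 3 2 2 3 5 3 4 2 2 2 3 3 4,
  C 3 2 2 3 2 4 3 2 3 5 2 4 2 2 3 3],
  [C 3 3 2 2 2 4 3 4 3 2 2 5 2 3 3 2,
  C 3 4 2 3 2 2 3 4 3 3 2 2 2 5 3 3,
  C 3 2 2 4 2 3 3 2 3 5 2 3 2 2 3 5,
  C 3 3 2 2 2 4 3 3 3 2 2 6 2 3 3 2,
  C 3 4 2 3 2 2 3 6 3 3 2 2 2 5 3 3,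
  C 3 2 2 5 2 3 3 2 3 5 2 3 2 2 3 4,
  C 3 3 2 2 2 4 3 3 3 2 2 4 2 3 3 2,
  C 3 4 2 3 2 2 3 5 3 3 2 2 2 5 3 3,
  C 3 2 2 6 2 3 3 2 3 5 2 3 2 2 3 6,
  C 3 3 2 2 2 4 3 3 3 2 2 5 2 3 3 2,
  C 3 4 2 3 2 2 3 4 3 3 2 2 2 5 3 3,
  C 3 2 2 4 2 3 3 2 3 5 2 5 2 2 3 3,
  C 3 3 2 2 2 4 3 4 3 2 2 3 2 3 3 2,
  C 3 4 2 4 2 2 3 3 3 5 2 2 2 3 3 4,
  C 3 2 2 5 2 4 3 2 3 3 2 3 2 2 3 4,
  C 3 4 2 2 2 3 3 3 3 2 2 4 2 4 3 2,
  C 3 5 2 3 2 2 3 5 3 3 2 2 2 4 3 3,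
  C 3 2 2 6 2 3 3 2 3 4 2 3 2 2 3 4,
  C 3 3 2 2 2 5 3 3 3 2 2 4 2 3 3 2,
  C 3 6 2 3 2 2 3 5 3 3 2 2 2 6 3 3,
  C 3 2 2 5 2 3 3 2 3 4 2 3 2 2 3 6,
  C 3 3 2 2 2 4 3 3 3 2 2 4 2 3 3 2,
  C 3 5 2 3 2 2 3 4 3 3 2 2 2 5 3 3,
  C 3 2 2 5 2 3 3 2 3 6 2 3 2 2 3 5,
  C 3 3 2 2 2 4 3 3 3 2 2 6 2 3 3 2,
  C 3 4 2 3 2 2 3 6 3 3 2 2 2 5 3 3,
  C 3 2 2 4 2 3 3 2 3 5 2 3 2 2 3 5,
  C 3 3 2 2 2 6 3 3 3 2 2 5 2 3 3 2,
  C 3 4 2 3 2 2 3 4 3 3 2 2 2 4 3 3,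
  C 3 2 2 4 2 3 3 2 3 6 2 3 2 2 3 5,
  C 3 3 2 2 2 5 3 3 3 2 2 5 2 3 3 2,
  C 3 5 2 3 2 2 3 4 3 3 2 2 2 6 3 3],
  [C 3 2 2 4 2 3 3 2 3 4 2 3 2 2 3 5,
  C 3 3 2 2 2 4 3 3 3 2 2 5 2 3 3 2,
  C 3 6 2 3 2 2 3 4 3 3 2 2 2 5 3 3,
  C 3 2 2 4 2 3 3 2 3 5 2 3 2 2 3 5,
  C 3 3 2 2 2 6 3 3 3 2 2 6 2 3 3 2,
  C 3 4 2 3 2 2 3 4 3 3 2 2 2 4 3 3,
  C 3 2 2 4 2 3 3 2 3 6 2 3 2 2 3 6,
  C 3 3 2 2 2 5 3 3 3 2 2 5 2 3 3 2,
  C 3 4 2 3 2 2 3 5 3 3 2 2 2 4 3 3,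
  C 3 2 2 6 2 3 3 2 3 5 2 3 2 2 3 4,
  C 3 3 2 2 2 5 3 3 3 2 2 4 2 3 3 2,
  C 3 4 2 3 2 2 3 6 3 3 2 2 2 4 3 3,
  C 3 2 2 5 2 3 3 2 3 5 2 3 2 2 3 5,
  C 3 3 2 2 2 5 3 3 3 2 2 6 2 3 3 2,
  C 3 4 2 3 2 2 3 4 3 3 2 2 2 4 3 3,
  C 3 2 2 4 2 3 3 2 3 5 2 3 2 2 3 6,
  C 3 3 2 2 2 5 3 3 3 2 2 5 2 3 3 2,
  C 3 4 2 3 2 2 3 5 3 3 2 2 2 6 3 3,
  C 3 2 2 4 2 3 3 2 3 6 2 3 2 2 3 4,
  C 3 3 2 2 2 4 3 3 3 2 2 5 2 3 3 2,
  C 3 5 2 3 2 2 3 5 3 3 2 2 2 7 3 3,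
  C 3 2 2 4 2 3 3 2 3 4 2 3 2 2 3 4,
  C 3 3 2 2 2 5 3 3 3 2 2 5 2 3 3 2,
  C 3 6 2 3 2 2 3 5 3 3 2 2 2 4 3 3,
  C 3 2 2 4 2 3 3 2 3 5 2 3 2 2 3 4,
  C 3 3 2 2 2 6 3 3 3 2 2 5 2 3 3 2,
  C 3 4 2 3 2 2 3 5 3 3 2 2 2 5 3 3,
  C 3 2 2 4 2 3 3 2 3 6 2 3 2 2 3 4,
  C 3 3 2 2 2 4 3 3 3 2 2 5 2 3 3 2,
  C 3 7 2 3 2 2 3 5 3 3 2 2 2 6 3 3,
  C 3 2 2 4 2 3 3 2 3 4 2 3 2 2 3 4,
  C 3 3 2 2 2 5 3 3 3 2 2 5 2 3 3 2],
  [C 3 5 2 3 2 2 3 5 3 3 2 2 2 4 3 3,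
  C 3 2 2 4 2 3 3 2 3 6 2 3 2 2 3 4,
  C 3 3 2 2 2 6 3 3 3 2 2 5 2 3 3 2,
  C 3 4 2 3 2 2 3 5 3 3 2 2 2 7 3 3,
  C 3 2 2 4 2 3 3 2 3 5 2 3 2 2 3 4,
  C 3 3 2 2 2 4 3 3 3 2 2 5 2 3 3 2,
  C 3 6 2 3 2 2 3 5 3 3 2 2 2 5 3 3,
  C 3 2 2 4 2 3 3 2 3 4 2 3 2 2 3 4,
  C 3 3 2 2 2 6 3 3 3 2 2 5 2 3 3 2,
  C 3 5 2 3 2 2 3 5 3 3 2 2 2 4 3 3,
  C 3 2 2 4 2 3 3 2 3 7 2 3 2 2 3 4,
  C 3 3 2 2 2 5 3 3 3 2 2 5 2 3 3 2,
  C 3 4 2 3 2 2 3 5 3 3 2 2 2 6 3 3,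
  C 3 2 2 4 2 3 3 2 3 5 2 3 2 2 3 4,
  C 3 3 2 2 2 4 3 3 3 2 2 5 2 3 3 2,
  C 3 7 2 3 2 2 3 5 3 3 2 2 2 5 3 3,
  C 3 2 2 4 2 3 3 2 3 4 2 3 2 2 3 4,
  C 3 3 2 2 2 7 3 3 3 2 2 5 2 3 3 2,
  C 3 5 2 3 2 2 3 5 3 3 2 2 2 4 3 3,
  C 3 2 2 4 2 3 3 2 3 6 2 3 2 2 3 4,
  C 3 3 2 2 2 5 3 3 3 2 2 5 2 3 3 2,
  C 3 4 2 3 2 2 3 5 3 3 2 2 2 7 3 3,
  C 3 2 2 4 2 3 3 2 3 5 2 3 2 2 3 4,
  C 3 3 2 2 2 4 3 3 3 2 2 5 2 3 3 2,
  C 3 6 2 3 2 2 3 5 3 3 2 2 2 6 3 3,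
  C 3 2 2 4 2 3 3 2 3 4 2 3 2 2 3 4,
  C 3 3 2 2 2 5 3 3 3 2 2 5 2 3 3 2,
  C 3 5 2 3 2 2 3 5 3 3 2 2 2 4 3 3,
  C 3 2 2 4 2 3 3 2 3 7 2 3 2 2 3 4,
  C 3 3 2 2 2 6 3 3 3 2 2 5 2 3 3 2,
  C 3 4 2 3 2 2 3 5 3 3 2 2 2 5 3 3,
  C 3 2 2 4 2 3 3 2 3 5 2 3 2 2 3 4],
  [C 3 3 2 2 2 4 3 3 3 2 2 5 2 3 3 2,
  C 3 7 2 3 2 2 3 5 3 3 2 2 2 6 3 3,
  C 3 2 2 4 2 3 3 2 3 4 2 3 2 2 3 4,
  C 3 3 2 2 2 7 3 3 3 2 2 5 2 3 3 2,
  C 3 5 2 3 2 2 3 5 3 3 2 2 2 4 3 3,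
  C 3 2 2 4 2 3 3 2 3 6 2 3 2 2 3 4,
  C 3 3 2 2 2 6 3 3 3 2 2 5 2 3 3 2,
  C 3 4 2 3 2 2 3 5 3 3 2 2 2 7 3 3,
  C 3 2 2 4 2 3 3 2 3 5 2 3 2 2 3 4,
  C 3 3 2 2 2 4 3 3 3 2 2 5 2 3 3 2,
  C 3 6 2 3 2 2 3 5 3 3 2 2 2 5 3 3,
  C 3 2 2 4 2 3 3 2 3 4 2 3 2 2 3 4,
  C 3 3 2 2 2 7 3 3 3 2 2 5 2 3 3 2,
  C 3 7 2 3 2 2 3 5 3 3 2 2 2 4 3 3,
  C 3 2 2 4 2 3 3 2 3 5 2 3 2 2 3 4,
  C 3 3 2 2 2 5 3 3 3 2 2 5 2 3 3 2,
  C 3 4 2 3 2 2 3 5 3 3 2 2 2 6 3 3,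
  C 3 2 2 4 2 3 3 2 3 6 2 3 2 2 3 4,
  C 3 3 2 2 2 4 3 3 3 2 2 5 2 3 3 2,
  C 3 5 2 3 2 2 3 5 3 3 2 2 2 5 3 3,
  C 3 2 2 4 2 3 3 2 3 4 2 3 2 2 3 4,
  C 3 3 2 2 2 6 3 3 3 2 2 5 2 3 3 2,
  C 3 6 2 3 2 2 3 5 3 3 2 2 2 4 3 3,
  C 3 2 2 4 2 3 3 2 3 5 2 3 2 2 3 4,
  C 3 3 2 2 2 7 3 3 3 2 2 5 2 3 3 2,
  C 3 4 2 3 2 2 3 5 3 3 2 2 2 5 3 3,
  C 3 2 2 4 2 3 3 2 3 6 2 3 2 2 3 4,
  C 3 3 2 2 2 4 3 3 3 2 2 5 2 3 3 2,
  C 3 7 2 3 2 2 3 5 3 3 2 2 2 6 3 3,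
  C 3 2 2 4 2 3 3 2 3 4 2 3 2 2 3 4,
  C 3 3 2 2 2 5 3 3 3 2 2 5 2 3 3 2,
  C 3 5 2 3 2 2 3 5 3 3 2 2 2 4 3 3],
  [C 3 2 2 4 2 3 3 2 3 6 2 3 2 2 3 4,
  C 3 3 2 2 2 6 3 3 3 2 2 5 2 3 3 2,
  C 3 4 2 3 2 2 3 5 3 3 2 2 2 5 3 3,
  C 3 2 2 4 2 3 3 2 3 5 2 3 2 2 3 4,
  C 3 3 2 2 2 4 3 3 3 2 2 5 2 3 3 2,
  C 3 6 2 3 2 2 3 5 3 3 2 2 2 6 3 3,
  C 3 2 2 4 2 3 3 2 3 4 2 3 2 2 3 4,
  C 3 3 2 2 2 7 3 3 3 2 2 5 2 3 3 2,
  C 3 5 2 3 2 2 3 5 3 3 2 2 2 4 3 3,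
  C 3 2 2 4 2 3 3 2 3 7 2 3 2 2 3 4,
  C 3 3 2 2 2 5 3 3 3 2 2 5 2 3 3 2,
  C 3 4 2 3 2 2 3 5 3 3 2 2 2 6 3 3,
  C 3 2 2 4 2 3 3 2 3 5 2 3 2 2 3 4,
  C 3 3 2 2 2 4 3 3 3 2 2 5 2 3 3 2,
  C 3 7 2 3 2 2 3 5 3 3 2 2 2 5 3 3,
  C 3 2 2 4 2 3 3 2 3 4 2 3 2 2 3 4,
  C 3 3 2 2 2 6 3 3 3 2 2 5 2 3 3 2,
  C 3 5 2 3 2 2 3 5 3 3 2 2 2 4 3 3,
  C 3 2 2 4 2 3 3 2 3 6 2 3 2 2 3 4,
  C 3 3 2 2 2 5 3 3 3 2 2 5 2 3 3 2,
  C 3 4 2 3 2 2 3 5 3 3 2 2 2 7 3 3,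
  C 3 2 2 4 2 3 3 2 3 5 2 3 2 2 3 4,
  C 3 3 2 2 2 4 3 3 3 2 2 5 2 3 3 2,
  C 3 6 2 3 2 2 3 5 3 3 2 2 2 5 3 3,
  C 3 2 2 4 2 3 3 2 3 4 2 3 2 2 3 4,
  C 3 3 2 2 2 7 3 3 3 2 2 5 2 3 3 2,
  C 3 5 2 3 2 2 3 5 3 3 2 2 2 4 3 3,
  C 3 2 2 4 2 3 3 2 3 7 2 3 2 2 3 4,
  C 3 3 2 2 2 6 3 3 3 2 2 5 2 3 3 2,
  C 3 4 2 3 2 2 3 5 3 3 2 2 2 5 3 3,
  C 3 2 2 4 2 3 3 2 3 5 2 3 2 2 3 4,
  C 3 3 2 2 2 4 3 3 3 2 2 5 2 3 3 2],
  [C 3 7 2 3 2 2 3 5 3 3 2 2 2 6 3 3,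
  C 3 2 2 4 2 3 3 2 3 4 2 3 2 2 3 4,
  C 3 3 2 2 2 5 3 3 3 2 2 5 2 3 3 2,
  C 3 5 2 3 2 2 3 5 3 3 2 2 2 4 3 3,
  C 3 2 2 4 2 3 3 2 3 6 2 3 2 2 3 4,
  C 3 3 2 2 2 6 3 3 3 2 2 5 2 3 3 2,
  C 3 4 2 3 2 2 3 5 3 3 2 2 2 7 3 3,
  C 3 2 2 4 2 3 3 2 3 5 2 3 2 2 3 4,
  C 3 3 2 2 2 4 3 3 3 2 2 5 2 3 3 2,
  C 3 6 2 3 2 2 3 5 3 3 2 2 2 6 3 3,
  C 3 2 2 4 2 3 3 2 3 4 2 3 2 2 3 4,
  C 3 3 2 2 2 7 3 3 3 2 2 5 2 3 3 2,
  C 3 5 2 3 2 2 3 5 3 3 2 2 2 4 3 3,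
  C 3 2 2 4 2 3 3 2 3 7 2 3 2 2 3 4,
  C 3 3 2 2 2 5 3 3 3 2 2 5 2 3 3 2,
  C 3 4 2 3 2 2 3 5 3 3 2 2 2 7 3 3,
  C 3 2 2 4 2 3 3 2 3 6 2 3 2 2 3 4,
  C 3 3 2 2 2 4 3 3 3 2 2 5 2 3 3 2,
  C 3 5 2 3 2 2 3 5 3 3 2 2 2 5 3 3,
  C 3 2 2 4 2 3 3 2 3 4 2 3 2 2 3 4,
  C 3 3 2 2 2 6 3 3 3 2 2 5 2 3 3 2,
  C 3 6 2 3 2 2 3 5 3 3 2 2 2 4 3 3,
  C 3 2 2 4 2 3 3 2 3 5 2 3 2 2 3 4,
  C 3 3 2 2 2 5 3 3 3 2 2 5 2 3 3 2,
  C 3 4 2 3 2 2 3 5 3 3 2 2 2 6 3 3,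
  C 3 2 2 4 2 3 3 2 3 6 2 3 2 2 3 4,
  C 3 3 2 2 2 4 3 3 3 2 2 5 2 3 3 2,
  C 3 7 2 3 2 2 3 5 3 3 2 2 2 5 3 3,
  C 3 2 2 4 2 3 3 2 3 4 2 3 2 2 3 4,
  C 3 3 2 2 2 7 3 3 3 2 2 5 2 3 3 2,
  C 3 5 2 3 2 2 3 5 3 3 2 2 2 4 3 3,
  C 3 2 2 4 2 3 3 2 3 6 2 3 2 2 3 4],
  [C 3 3 2 2 2 5 3 3 3 2 2 5 2 3 3 2,
  C 3 4 2 3 2 2 3 5 3 3 2 2 2 7 3 3,
  C 3 2 2 4 2 3 3 2 3 5 2 3 2 2 3 4,
  C 3 3 2 2 2 4 3 3 3 2 2 5 2 3 3 2,
  C 3 6 2 3 2 2 3 5 3 3 2 2 2 5 3 3,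
  C 3 2 2 4 2 3 3 2 3 4 2 3 2 2 3 4,
  C 3 3 2 2 2 6 3 3 3 2 2 5 2 3 3 2,
  C 3 5 2 3 2 2 3 5 3 3 2 2 2 4 3 3,
  C 3 2 2 4 2 3 3 2 3 7 2 3 2 2 3 4,
  C 3 3 2 2 2 5 3 3 3 2 2 5 2 3 3 2,
  C 3 4 2 3 2 2 3 5 3 3 2 2 2 6 3 3,
  C 3 2 2 4 2 3 3 2 3 5 2 3 2 2 3 4,
  C 3 3 2 2 2 4 3 3 3 2 2 5 2 3 3 2,
  C 3 7 2 3 2 2 3 5 3 3 2 2 2 5 3 3,
  C 3 2 2 4 2 3 3 2 3 4 2 3 2 2 3 4,
  C 3 3 2 2 2 7 3 3 3 2 2 5 2 3 3 2,
  C 3 6 2 3 2 2 3 5 3 3 2 2 2 4 3 3,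
  C 3 2 2 4 2 3 3 2 3 5 2 3 2 2 3 4,
  C 3 3 2 2 2 5 3 3 3 2 2 5 2 3 3 2,
  C 3 4 2 3 2 2 3 5 3 3 2 2 2 7 3 3,
  C 3 2 2 4 2 3 3 2 3 6 2 3 2 2 3 4,
  C 3 3 2 2 2 4 3 3 3 2 2 5 2 3 3 2,
  C 3 5 2 3 2 2 3 5 3 3 2 2 2 5 3 3,
  C 3 2 2 4 2 3 3 2 3 4 2 3 2 2 3 4,
  C 3 3 2 2 2 6 3 3 3 2 2 5 2 3 3 2,
  C 3 6 2 3 2 2 3 5 3 3 2 2 2 4 3 3,
  C 3 2 2 4 2 3 3 2 3 7 2 3 2 2 3 4,
  C 3 3 2 2 2 5 3 3 3 2 2 5 2 3 3 2,
  C 3 4 2 3 2 2 3 5 3 3 2 2 2 6 3 3,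
  C 3 2 2 4 2 3 3 2 3 6 2 3 2 2 3 4,
  C 3 3 2 2 2 4 3 3 3 2 2 5 2 3 3 2,
  C 3 7 2 3 2 2 3 5 3 3 2 2 2 5 3 3],
  [C 3 2 2 4 2 3 3 2 3 4 2 3 2 2 3 4,
  C 3 3 2 2 2 7 3 3 3 2 2 5 2 3 3 2,
  C 3 5 2 3 2 2 3 5 3 3 2 2 2 4 3 3,
  C 3 2 2 4 2 3 3 2 3 7 2 3 2 2 3 4,
  C 3 3 2 2 2 6 3 3 3 2 2 5 2 3 3 2,
  C 3 4 2 3 2 2 3 5 3 3 2 2 2 5 3 3,
  C 3 2 2 4 2 3 3 2 3 5 2 3 2 2 3 4,
  C 3 3 2 2 2 4 3 3 3 2 2 5 2 3 3 2,
  C 3 6 2 3 2 2 3 5 3 3 2 2 2 6 3 3,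
  C 3 2 2 4 2 3 3 2 3 4 2 3 2 2 3 4,
  C 3 3 2 2 2 5 3 3 3 2 2 5 2 3 3 2,
  C 3 5 2 3 2 2 3 5 3 3 2 2 2 4 3 3,
  C 3 2 2 4 2 3 3 2 3 6 2 3 2 2 3 4,
  C 3 3 2 2 2 6 3 3 3 2 2 5 2 3 3 2,
  C 3 4 2 3 2 2 3 5 3 3 2 2 2 7 3 3,
  C 3 2 2 4 2 3 3 2 3 5 2 3 2 2 3 4,
  C 3 3 2 2 2 4 3 3 3 2 2 5 2 3 3 2,
  C 3 7 2 3 2 2 3 5 3 3 2 2 2 5 3 3,
  C 3 2 2 4 2 3 3 2 3 4 2 3 2 2 3 4,
  C 3 3 2 2 2 6 3 3 3 2 2 5 2 3 3 2,
  C 3 5 2 3 2 2 3 5 3 3 2 2 2 4 3 3,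
  C 3 2 2 4 2 3 3 2 3 7 2 3 2 2 3 4,
  C 3 3 2 2 2 5 3 3 3 2 2 5 2 3 3 2,
  C 3 4 2 3 2 2 3 5 3 3 2 2 2 6 3 3,
  C 3 2 2 4 2 3 3 2 3 5 2 3 2 2 3 4,
  C 3 3 2 2 2 4 3 3 3 2 2 5 2 3 3 2,
  C 3 6 2 3 2 2 3 5 3 3 2 2 2 5 3 3,
  C 3 2 2 4 2 3 3 2 3 4 2 3 2 2 3 4,
  C 3 3 2 2 2 7 3 3 3 2 2 5 2 3 3 2,
  C 3 5 2 3 2 2 3 5 3 3 2 2 2 4 3 3,
  C 3 2 2 4 2 3 3 2 3 6 2 3 2 2 3 4,
  C 3 3 2 2 2 5 3 3 3 2 2 5 2 3 3 2],
  [C 3 4 2 3 2 2 3 5 3 3 2 2 2 7 3 3,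
  C 3 2 2 4 2 3 3 2 3 5 2 3 2 2 3 4,
  C 3 3 2 2 2 4 3 3 3 2 2 5 2 3 3 2,
  C 3 7 2 3 2 2 3 5 3 3 2 2 2 6 3 3,
  C 3 2 2 4 2 3 3 2 3 4 2 3 2 2 3 4,
  C 3 3 2 2 2 5 3 3 3 2 2 5 2 3 3 2,
  C 3 5 2 3 2 2 3 5 3 3 2 2 2 4 3 3,
  C 3 2 2 4 2 3 3 2 3 7 2 3 2 2 3 4,
  C 3 3 2 2 2 6 3 3 3 2 2 5 2 3 3 2,
  C 3 4 2 3 2 2 3 5 3 3 2 2 2 5 3 3,
  C 3 2 2 4 2 3 3 2 3 5 2 3 2 2 3 4,
  C 3 3 2 2 2 4 3 3 3 2 2 5 2 3 3 2,
  C 3 6 2 3 2 2 3 5 3 3 2 2 2 6 3 3,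
  C 3 2 2 4 2 3 3 2 3 4 2 3 2 2 3 4,
  C 3 3 2 2 2 7 3 3 3 2 2 5 2 3 3 2,
  C 3 5 2 3 2 2 3 5 3 3 2 2 2 4 3 3,
  C 3 2 2 4 2 3 3 2 3 6 2 3 2 2 3 4,
  C 3 3 2 2 2 6 3 3 3 2 2 5 2 3 3 2,
  C 3 4 2 3 2 2 3 5 3 3 2 2 2 7 3 3,
  C 3 2 2 4 2 3 3 2 3 5 2 3 2 2 3 4,
  C 3 3 2 2 2 4 3 3 3 2 2 5 2 3 3 2,
  C 3 7 2 3 2 2 3 5 3 3 2 2 2 5 3 3,
  C 3 2 2 4 2 3 3 2 3 4 2 3 2 2 3 4,
  C 3 3 2 2 2 7 3 3 3 2 2 5 2 3 3 2,
  C 3 6 2 3 2 2 3 5 3 3 2 2 2 4 3 3,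
  C 3 2 2 4 2 3 3 2 3 5 2 3 2 2 3 4,
  C 3 3 2 2 2 5 3 3 3 2 2 5 2 3 3 2,
  C 3 4 2 3 2 2 3 5 3 3 2 2 2 6 3 3,
  C 3 2 2 4 2 3 3 2 3 6 2 3 2 2 3 4,
  C 3 3 2 2 2 4 3 3 3 2 2 5 2 3 3 2,
  C 3 5 2 3 2 2 3 5 3 3 2 2 2 5 3 3,
  C 3 2 2 4 2 3 3 2 3 4 2 3 2 2 3 4],
  [C 3 3 2 2 2 6 3 3 3 2 2 5 2 3 3 2,
  C 3 6 2 3 2 2 3 5 3 3 2 2 2 4 3 3,
  C 3 2 2 4 2 3 3 2 3 7 2 3 2 2 3 4,
  C 3 3 2 2 2 5 3 3 3 2 2 5 2 3 3 2,
  C 3 4 2 3 2 2 3 5 3 3 2 2 2 7 3 3,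
  C 3 2 2 4 2 3 3 2 3 5 2 3 2 2 3 4,
  C 3 3 2 2 2 4 3 3 3 2 2 5 2 3 3 2,
  C 3 6 2 3 2 2 3 5 3 3 2 2 2 5 3 3,
  C 3 2 2 4 2 3 3 2 3 4 2 3 2 2 3 4,
  C 3 3 2 2 2 7 3 3 3 2 2 5 2 3 3 2,
  C 3 5 2 3 2 2 3 5 3 3 2 2 2 4 3 3,
  C 3 2 2 4 2 3 3 2 3 6 2 3 2 2 3 4,
  C 3 3 2 2 2 5 3 3 3 2 2 5 2 3 3 2,
  C 3 4 2 3 2 2 3 5 3 3 2 2 2 6 3 3,
  C 3 2 2 4 2 3 3 2 3 5 2 3 2 2 3 4,
  C 3 3 2 2 2 4 3 3 3 2 2 5 2 3 3 2,
  C 3 7 2 3 2 2 3 5 3 3 2 2 2 5 3 3,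
  C 3 2 2 4 2 3 3 2 3 4 2 3 2 2 3 4,
  C 3 3 2 2 2 6 3 3 3 2 2 5 2 3 3 2,
  C 3 5 2 3 2 2 3 5 3 3 2 2 2 4 3 3,
  C 3 2 2 4 2 3 3 2 3 7 2 3 2 2 3 4,
  C 3 3 2 2 2 5 3 3 3 2 2 5 2 3 3 2,
  C 3 4 2 3 2 2 3 5 3 3 2 2 2 7 3 3,
  C 3 2 2 4 2 3 3 2 3 6 2 3 2 2 3 4,
  C 3 3 2 2 2 4 3 3 3 2 2 5 2 3 3 2,
  C 3 5 2 3 2 2 3 5 3 3 2 2 2 5 3 3,
  C 3 2 2 4 2 3 3 2 3 4 2 3 2 2 3 4,
  C 3 3 2 2 2 7 3 3 3 2 2 5 2 3 3 2,
  C 3 6 2 3 2 2 3 5 3 3 2 2 2 4 3 3,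
  C 3 2 2 4 2 3 3 2 3 5 2 3 2 2 3 4,
  C 3 3 2 2 2 5 3 3 3 2 2 5 2 3 3 2,
  C 3 4 2 3 2 2 3 5 3 3 2 2 2 6 3 3],
  [C 3 2 2 4 2 3 3 2 3 6 2 3 2 2 3 4,
  C 3 3 2 2 2 4 3 3 3 2 2 5 2 3 3 2,
  C 3 7 2 3 2 2 3 5 3 3 2 2 2 5 3 3,
  C 3 2 2 4 2 3 3 2 3 4 2 3 2 2 3 4,
  C 3 3 2 2 2 6 3 3 3 2 2 5 2 3 3 2,
  C 3 6 2 3 2 2 3 5 3 3 2 2 2 4 3 3,
  C 3 2 2 4 2 3 3 2 3 7 2 3 2 2 3 4,
  C 3 3 2 2 2 5 3 3 3 2 2 5 2 3 3 2,
  C 3 4 2 3 2 2 3 5 3 3 2 2 2 7 3 3,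
  C 3 2 2 4 2 3 3 2 3 5 2 3 2 2 3 4,
  C 3 3 2 2 2 4 3 3 3 2 2 5 2 3 3 2,
  C 3 7 2 3 2 2 3 5 3 3 2 2 2 6 3 3,
  C 3 2 2 4 2 3 3 2 3 4 0 0 0 0 0 0]]"

lemmas sigma_data_chunks =
  tab_chunk_at[OF sigma_data_def, unfolded num_of_nat_numeral_eq tab_concat tab.simps adv.simps inc.simps concat.simps(1) simp_thms]

definition w_data :: "chunk list" where
  "w_data = concat [
  [C 0 0 0 0 1 1 1 1 0 2 0 2 1 0 1 0,
  C 0 1 0 1 1 2 1 2 0 0 0 0 1 3 1 1,
  C 0 1 0 2 1 0 1 3 0 2 0 0 1 1 1 1,
  C 0 0 0 2 1 2 1 0 0 1 0 1 1 0 1 2,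
  C 0 2 0 0 1 3 1 1 0 0 0 3 1 1 1 0,
  C 0 2 0 1 1 0 1 3 0 1 0 0 1 2 1 1,
  C 0 0 0 2 1 1 1 0 0 3 0 1 1 0 1 2,
  C 0 1 0 0 1 3 1 1 0 0 0 3 1 2 1 0,
  C 0 1 0 1 1 0 1 3 0 2 0 0 1 1 1 1,
  C 0 0 0 2 1 2 1 0 0 3 0 1 1 0 1 2,
  C 0 2 0 0 1 3 1 1 0 0 0 3 1 1 1 0,
  C 0 3 0 2 1 0 1 1 0 1 0 0 1 2 1 2,
  C 0 0 0 1 1 1 1 0 0 2 0 2 1 0 1 3,
  C 0 1 0 0 1 3 1 1 0 0 0 2 1 1 1 0,
  C 0 3 0 1 1 0 1 2 0 1 0 0 1 2 1 1,
  C 0 0 0 3 1 1 1 0 0 2 0 1 1 0 1 3,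
  C 0 1 0 0 1 3 1 2 0 0 0 1 1 1 1 0,
  C 0 3 0 2 1 0 1 1 0 1 0 0 1 2 1 2,
  C 0 0 0 3 1 1 1 0 0 2 0 2 1 0 1 3,
  C 0 1 0 0 1 3 1 1 0 0 0 3 1 2 1 0,
  C 0 1 0 1 1 0 1 2 0 2 0 0 1 1 1 1,
  C 0 0 0 2 1 2 1 0 0 3 0 1 1 0 1 3,
  C 0 1 0 0 1 2 1 1 0 0 0 3 1 1 1 0,
  C 0 2 0 1 1 0 1 2 0 1 0 0 1 3 1 1,
  C 0 0 0 2 1 1 1 0 0 3 0 1 1 0 1 3,
  C 0 2 0 0 1 1 1 1 0 0 0 3 1 2 1 0,
  C 0 1 0 1 1 0 1 2 0 2 0 0 1 3 1 1,
  C 0 0 0 2 1 2 1 0 0 3 0 1 1 0 1 3,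
  C 0 1 0 0 1 3 1 2 0 0 0 1 1 1 1 0,
  C 0 2 0 2 1 0 1 1 0 1 0 0 1 2 1 2,
  C 0 0 0 3 1 1 1 0 0 3 0 1 1 0 1 2,
  C 0 1 0 0 1 3 1 1 0 0 0 2 1 1 1 0],
  [C 0 2 0 1 1 0 1 3 0 1 0 0 1 2 1 1,
  C 0 0 0 3 1 1 1 0 0 3 0 2 1 0 1 1,
  C 0 1 0 0 1 3 1 2 0 0 0 1 1 1 1 0,
  C 0 2 0 2 1 0 1 3 0 1 0 0 1 2 1 2,
  C 0 0 0 3 1 1 1 0 0 3 0 1 1 0 1 3,
  C 0 2 0 0 1 1 1 1 0 0 0 2 1 2 1 0,
  C 0 1 0 1 1 0 1 2 0 2 0 0 1 3 1 1,
  C 0 0 0 3 1 1 1 0 0 2 0 1 1 0 1 3,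
  C 0 1 0 0 1 2 1 1 0 0 0 2 1 1 1 0,
  C 0 3 0 1 1 0 1 2 0 1 0 0 1 3 1 1,
  C 0 0 0 3 1 2 1 0 0 1 0 1 1 0 1 3,
  C 0 2 0 0 1 1 1 1 0 0 0 2 1 2 1 0,
  C 0 3 0 1 1 0 1 2 0 2 0 0 1 3 1 1,
  C 0 0 0 3 1 4 1 0 0 1 0 1 1 0 1 3,
  C 0 3 0 0 1 1 1 1 0 0 0 2 1 3 1 0,
  C 0 1 0 3 1 0 1 1 0 2 0 0 1 1 1 2,
  C 0 0 0 1 1 2 1 0 0 1 0 2 1 0 1 1,
  C 0 3 0 0 1 1 1 3 0 0 0 1 1 3 1 0,
  C 0 1 0 3 1 0 1 2 0 2 0 0 1 1 1 1,
  C 0 0 0 2 1 2 1 0 0 1 0 1 1 0 1 2,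
  C 0 3 0 0 1 1 1 3 0 0 0 2 1 3 1 0,
  C 0 1 0 3 1 0 1 1 0 2 0 0 1 1 1 4,
  C 0 0 0 1 1 2 1 0 0 1 0 2 1 0 1 1,
  C 0 3 0 0 1 1 1 2 0 0 0 1 1 3 1 0,
  C 0 1 0 3 1 0 1 2 0 2 0 0 1 1 1 3,
  C 0 0 0 1 1 2 1 0 0 1 0 4 1 0 1 1,
  C 0 2 0 0 1 3 1 2 0 0 0 1 1 1 1 0,
  C 0 2 0 2 1 0 1 1 0 1 0 0 1 2 1 2,
  C 0 0 0 3 1 1 1 0 0 3 0 1 1 0 1 2,
  C 0 1 0 0 1 3 1 1 0 0 0 2 1 1 1 0,
  C 0 2 0 1 1 0 1 3 0 1 0 0 1 2 1 1,
  C 0 0 0 3 1 1 1 0 0 3 0 2 1 0 1 1],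
  [C 0 1 0 0 1 3 1 2 0 0 0 1 1 1 1 0,
  C 0 2 0 2 1 0 1 3 0 3 0 0 1 1 1 1,
  C 0 0 0 2 1 2 1 0 0 1 0 1 1 0 1 2,
  C 0 2 0 0 1 1 1 3 0 0 0 1 1 2 1 0,
  C 0 3 0 2 1 0 1 1 0 1 0 0 1 2 1 2,
  C 0 0 0 1 1 1 1 0 0 2 0 2 1 0 1 4,
  C 0 1 0 0 1 3 1 1 0 0 0 2 1 1 1 0,
  C 0 3 0 1 1 0 1 2 0 1 0 0 1 2 1 1,
  C 0 0 0 3 1 1 1 0 0 2 0 1 1 0 1 3,
  C 0 1 0 0 1 3 1 1 0 0 0 4 1 1 1 0,
  C 0 3 0 1 1 0 1 4 0 1 0 0 1 2 1 1,
  C 0 0 0 2 1 1 1 0 0 2 0 1 1 0 1 2,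
  C 0 1 0 0 1 3 1 1 0 0 0 3 1 1 1 0,
  C 0 3 0 1 1 0 1 3 0 1 0 0 1 2 1 1,
  C 0 0 0 4 1 1 1 0 0 2 0 1 1 0 1 4,
  C 0 1 0 0 1 3 1 1 0 0 0 2 1 1 1 0,
  C 0 3 0 1 1 0 1 2 0 1 0 0 1 2 1 3,
  C 0 0 0 1 1 1 1 0 0 2 0 2 1 0 1 1,
  C 0 1 0 0 1 3 1 2 0 0 0 1 1 2 1 0,
  C 0 1 0 2 1 0 1 3 0 2 0 0 1 1 1 1,
  C 0 0 0 2 1 2 1 0 0 3 0 1 1 0 1 2,
  C 0 1 0 0 1 2 1 1 0 0 0 3 1 1 1 0,
  C 0 2 0 1 1 0 1 3 0 1 0 0 1 3 1 1,
  C 0 0 0 2 1 1 1 0 0 3 0 1 1 0 1 2,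
  C 0 2 0 0 1 1 1 1 0 0 0 3 1 2 1 0,
  C 0 1 0 1 1 0 1 3 0 2 0 0 1 3 1 1,
  C 0 0 0 2 1 2 1 0 0 3 0 1 1 0 1 2,
  C 0 1 0 0 1 3 1 3 0 0 0 1 1 1 1 0,
  C 0 2 0 2 1 0 1 1 0 1 0 0 1 2 1 2,
  C 0 0 0 1 1 3 1 0 0 1 0 2 1 0 1 3,
  C 0 2 0 0 1 1 1 1 0 0 0 2 1 2 1 0,
  C 0 1 0 1 1 0 1 2 0 2 0 0 1 3 1 1],
  [C 0 0 0 3 1 1 1 0 0 2 0 1 1 0 1 3,
  C 0 1 0 0 1 2 1 1 0 0 0 2 1 1 1 0,
  C 0 3 0 1 1 0 1 2 0 1 0 0 1 3 1 1,
  C 0 0 0 3 1 2 1 0 0 1 0 1 1 0 1 3,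
  C 0 2 0 0 1 1 1 1 0 0 0 2 1 2 1 0,
  C 0 3 0 1 1 0 1 2 0 2 0 0 1 3 1 1,
  C 0 0 0 3 1 1 1 0 0 3 0 2 1 0 1 1,
  C 0 1 0 0 1 2 1 2 0 0 0 1 1 1 1 0,
  C 0 2 0 2 1 0 1 3 0 1 0 0 1 3 1 1,
  C 0 0 0 2 1 1 1 0 0 3 0 1 1 0 1 2,
  C 0 1 0 0 1 2 1 1 0 0 0 3 1 1 1 0,
  C 0 2 0 1 1 0 1 3 0 1 0 0 1 3 1 2,
  C 0 0 0 1 1 1 1 0 0 3 0 2 1 0 1 1,
  C 0 1 0 0 1 2 1 2 0 0 0 3 1 1 1 0,
  C 0 2 0 2 1 0 1 3 0 1 0 0 1 3 1 1,
  C 0 0 0 3 1 2 1 0 0 1 0 1 1 0 1 2,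
  C 0 2 0 0 1 1 1 1 0 0 0 2 1 2 1 0,
  C 0 3 0 1 1 0 1 3 0 1 0 0 1 2 1 1,
  C 0 0 0 3 1 1 1 0 0 2 0 1 1 0 1 2,
  C 0 1 0 0 1 3 1 1 0 0 0 2 1 1 1 0,
  C 0 3 0 1 1 2 1 2 0 0 0 0 1 1 1 1,
  C 0 2 0 2 1 0 1 0 0 1 0 1 1 2 1 3,
  C 0 0 0 0 1 3 1 1 0 1 0 2 1 0 1 3,
  C 0 2 0 0 1 1 1 1 0 0 0 2 1 2 1 0,
  C 0 1 0 1 1 0 1 2 0 2 0 0 1 3 1 1,
  C 0 0 0 3 1 1 1 0 0 2 0 1 1 0 1 3,
  C 0 1 0 0 1 2 1 1 0 0 0 2 1 1 1 0,
  C 0 3 0 1 1 0 1 2 0 1 0 0 1 3 1 1,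
  C 0 0 0 3 1 2 1 0 0 1 0 2 1 0 1 1,
  C 0 2 0 0 1 1 1 2 0 0 0 1 1 2 1 0,
  C 0 3 0 2 1 0 1 3 0 1 0 0 1 2 1 1,
  C 0 0 0 2 1 3 1 0 0 1 0 1 1 0 1 2],
  [C 0 2 0 0 1 1 1 1 0 0 0 3 1 2 1 0,
  C 0 1 0 2 1 0 1 3 0 2 0 0 1 3 1 1,
  C 0 0 0 2 1 1 1 0 0 2 0 1 1 0 1 2,
  C 0 1 0 0 1 2 1 1 0 0 0 3 1 1 1 0,
  C 0 3 0 1 1 0 1 3 0 1 0 0 1 3 1 1,
  C 0 0 0 2 1 2 1 0 0 1 0 1 1 0 1 2,
  C 0 2 0 0 1 1 1 1 0 0 0 3 1 3 1 0,
  C 0 1 0 2 1 0 1 1 0 2 0 0 1 3 1 2,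
  C 0 0 0 1 1 1 1 0 0 2 0 2 1 0 1 3,
  C 0 1 0 0 1 2 1 1 0 0 0 2 1 1 1 0,
  C 0 3 0 1 1 0 1 2 0 1 0 0 1 3 1 1,
  C 0 0 0 3 1 1 1 0 0 2 0 1 1 0 1 3,
  C 0 1 0 0 1 2 1 2 0 0 0 1 1 1 1 0,
  C 0 3 0 2 1 0 1 1 0 1 0 0 1 3 1 2,
  C 0 0 0 3 1 1 1 0 0 2 0 2 1 0 1 3,
  C 0 1 0 0 1 2 1 1 0 0 0 3 1 3 1 0,
  C 0 1 0 1 1 0 1 2 0 2 0 0 1 1 1 1,
  C 0 0 0 2 1 2 1 0 0 1 0 3 1 0 1 1,
  C 0 2 0 0 1 3 1 2 0 0 0 1 1 1 1 0,
  C 0 2 0 2 1 0 1 1 0 1 0 0 1 2 1 2,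
  C 0 0 0 3 1 1 1 0 0 3 0 1 1 0 1 2,
  C 0 1 0 0 1 3 1 1 0 0 0 2 1 1 1 0,
  C 0 2 0 1 1 0 1 3 0 1 0 0 1 2 1 1,
  C 0 0 0 3 1 1 1 0 0 3 0 2 1 0 1 1,
  C 0 1 0 0 1 3 1 2 0 0 0 1 1 1 1 0,
  C 0 2 0 2 1 0 1 3 0 1 0 0 1 2 1 2,
  C 0 0 0 3 1 1 1 0 0 3 0 1 1 0 1 3,
  C 0 2 0 0 1 1 1 1 0 0 0 2 1 2 1 0,
  C 0 1 0 1 1 0 1 2 0 2 0 0 1 3 1 1,
  C 0 0 0 3 1 1 1 0 0 2 0 1 1 0 1 3,
  C 0 1 0 0 1 2 1 1 0 0 0 2 1 1 1 0,
  C 0 3 0 1 1 0 1 2 0 1 0 0 1 3 1 1],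
  [C 0 0 0 3 1 2 1 0 0 1 0 1 1 0 1 3,
  C 0 2 0 0 1 1 1 1 0 0 0 2 1 2 1 0,
  C 0 3 0 1 1 0 1 2 0 2 0 0 1 3 1 1,
  C 0 0 0 3 1 1 1 0 0 3 0 2 1 0 1 1,
  C 0 1 0 0 1 2 1 2 0 0 0 1 1 1 1 0,
  C 0 2 0 2 1 0 1 3 0 1 0 0 1 3 1 1,
  C 0 0 0 2 1 1 1 0 0 3 0 1 1 0 1 2,
  C 0 1 0 0 1 2 1 1 0 0 0 3 1 1 1 0,
  C 0 2 0 1 1 0 1 3 0 1 0 0 1 3 1 2,
  C 0 0 0 1 1 1 1 0 0 3 0 2 1 0 1 3,
  C 0 2 0 0 1 1 1 1 0 0 0 2 1 2 1 0,
  C 0 1 0 1 1 0 1 2 0 2 0 0 1 3 1 1,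
  C 0 0 0 3 1 1 1 0 0 2 0 1 1 0 1 4,
  C 0 1 0 0 1 2 1 1 0 0 0 2 1 1 1 0,
  C 0 3 0 1 1 0 1 2 0 1 0 0 1 3 1 1,
  C 0 0 0 3 1 2 1 0 0 1 0 1 1 0 1 3,
  C 0 2 0 0 1 1 1 1 0 0 0 4 1 2 1 0,
  C 0 3 0 1 1 0 1 2 0 2 0 0 1 3 1 1,
  C 0 0 0 2 1 1 1 0 0 2 0 1 1 0 1 3,
  C 0 1 0 0 1 2 1 1 0 0 0 3 1 1 1 0,
  C 0 3 0 1 1 0 1 2 0 1 0 0 1 3 1 1,
  C 0 0 0 2 1 2 1 0 0 1 0 1 1 0 1 3,
  C 0 2 0 0 1 1 1 1 0 0 0 3 1 2 1 0,
  C 0 3 0 1 1 0 1 2 0 2 0 0 1 3 1 1,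
  C 0 0 0 4 1 1 1 0 0 2 0 1 1 0 1 3,
  C 0 1 0 0 1 2 1 1 0 0 0 2 1 1 1 0,
  C 0 3 0 1 1 0 1 2 0 1 0 0 1 3 1 1,
  C 0 0 0 3 1 1 1 0 0 2 0 1 1 0 1 4,
  C 0 1 0 0 1 2 1 1 0 0 0 4 1 1 1 0,
  C 0 3 0 1 1 0 1 3 0 1 0 0 1 3 1 1,
  C 0 0 0 2 1 1 1 0 0 2 0 1 1 0 1 2,
  C 0 1 0 0 1 2 1 1 0 0 0 3 1 1 1 0],
  [C 0 3 0 1 1 0 1 4 0 1 0 0 1 3 1 1,
  C 0 0 0 4 1 1 1 0 0 2 0 1 1 0 1 3,
  C 0 1 0 0 1 2 1 1 0 0 0 2 1 3 1 0,
  C 0 1 0 1 1 0 1 2 0 2 0 0 1 1 1 1,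
  C 0 0 0 3 1 2 1 0 0 1 0 2 1 0 1 1,
  C 0 2 0 0 1 3 1 2 0 0 0 1 1 1 1 0,
  C 0 2 0 2 1 0 1 3 0 1 0 0 1 2 1 1,
  C 0 0 0 2 1 1 1 0 0 3 0 1 1 0 1 2,
  C 0 1 0 0 1 3 1 1 0 0 0 3 1 1 1 0,
  C 0 2 0 1 1 0 1 3 0 1 0 0 1 2 1 2,
  C 0 0 0 1 1 1 1 0 0 3 0 2 1 0 1 1,
  C 0 1 0 0 1 3 1 2 0 0 0 3 1 1 1 0,
  C 0 2 0 2 1 0 1 3 0 1 0 0 1 2 1 1,
  C 0 0 0 3 1 3 1 0 0 1 0 1 1 0 1 2,
  C 0 2 0 0 1 1 1 1 0 0 0 2 1 2 1 0,
  C 0 1 0 3 1 0 1 1 0 2 0 0 1 3 1 2,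
  C 0 0 0 1 1 1 1 0 0 2 0 2 1 0 1 1,
  C 0 1 0 0 1 2 1 2 0 0 0 3 1 1 1 0,
  C 0 3 0 1 1 0 1 2 0 1 0 0 1 3 1 1,
  C 0 0 0 2 1 1 1 0 0 2 0 3 1 0 1 1,
  C 0 1 0 0 1 2 1 3 0 0 0 1 1 1 1 0,
  C 0 3 0 2 1 0 1 1 0 2 0 0 1 1 1 2,
  C 0 0 0 1 1 2 1 0 0 1 0 2 1 0 1 3,
  C 0 2 0 0 1 3 1 1 0 0 0 2 1 1 1 0,
  C 0 2 0 1 1 0 1 2 0 1 0 0 1 2 1 1,
  C 0 0 0 3 1 1 1 0 0 3 0 1 1 0 1 3,
  C 0 1 0 0 1 3 1 1 0 0 0 2 1 2 1 0,
  C 0 1 0 1 1 0 1 2 0 2 0 0 1 1 1 1,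
  C 0 0 0 3 1 2 1 0 0 3 0 1 1 0 1 3,
  C 0 2 0 0 1 3 1 1 0 0 0 2 1 1 1 0,
  C 0 2 0 3 1 0 1 1 0 1 0 0 1 2 1 2,
  C 0 0 0 1 1 1 1 0 0 3 0 2 1 0 1 1],
  [C 0 2 0 0 1 1 1 2 0 0 0 3 1 2 1 0,
  C 0 1 0 1 1 0 1 2 0 2 0 0 1 3 1 1,
  C 0 0 0 2 1 1 1 0 0 3 0 1 1 0 1 3,
  C 0 1 0 0 1 2 1 1 0 0 0 3 1 1 1 0,
  C 0 2 0 1 1 0 1 2 0 1 0 0 1 3 1 1,
  C 0 0 0 2 1 2 1 0 0 1 0 1 1 0 1 3,
  C 0 2 0 0 1 1 1 1 0 0 0 3 1 2 1 0,
  C 0 3 0 1 1 0 1 2 0 1 0 0 1 2 1 1,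
  C 0 0 0 2 1 1 1 0 0 2 0 1 1 0 1 3,
  C 0 1 0 0 1 3 1 1 0 0 0 3 1 1 1 0,
  C 0 3 0 1 1 0 1 2 0 2 0 0 1 1 1 1,
  C 0 0 0 2 1 2 1 0 0 1 0 1 1 0 1 3,
  C 0 2 0 0 1 3 1 1 0 0 0 3 1 2 1 0,
  C 0 3 0 1 1 0 1 2 0 1 0 0 1 3 1 3,
  C 0 0 0 1 1 1 1 0 0 2 0 2 1 0 1 1,
  C 0 1 0 0 1 2 1 2 0 0 0 1 1 3 1 0,
  C 0 1 0 2 1 0 1 3 0 2 0 0 1 1 1 1,
  C 0 0 0 2 1 2 1 0 0 1 0 1 1 0 1 2,
  C 0 2 0 0 1 3 1 1 0 0 0 3 1 1 1 0,
  C 0 2 0 1 1 0 1 3 0 1 0 0 1 2 1 1,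
  C 0 0 0 2 1 1 1 0 0 3 0 1 1 0 1 2,
  C 0 1 0 0 1 3 1 1 0 0 0 3 1 2 1 0,
  C 0 1 0 1 1 0 1 3 0 2 0 0 1 1 1 1,
  C 0 0 0 2 1 2 1 0 0 3 0 1 1 0 1 2,
  C 0 2 0 0 1 3 1 1 0 0 0 3 1 1 1 0,
  C 0 3 0 2 1 0 1 1 0 1 0 0 1 2 1 2,
  C 0 0 0 1 1 1 1 0 0 2 0 2 1 0 1 3,
  C 0 1 0 0 1 3 1 1 0 0 0 2 1 1 1 0,
  C 0 3 0 1 1 0 1 2 0 1 0 0 1 2 1 1,
  C 0 0 0 3 1 1 1 0 0 2 0 1 1 0 1 3,
  C 0 1 0 0 1 3 1 2 0 0 0 1 1 1 1 0,
  C 0 3 0 2 1 0 1 1 0 1 0 0 1 2 1 2],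
  [C 0 0 0 3 1 1 1 0 0 2 0 2 1 0 1 3,
  C 0 1 0 0 1 3 1 1 0 0 0 3 1 2 1 0,
  C 0 1 0 1 1 0 1 2 0 2 0 0 1 1 1 1,
  C 0 0 0 2 1 2 1 0 0 3 0 1 1 0 1 3,
  C 0 1 0 0 1 2 1 1 0 0 0 3 1 1 1 0,
  C 0 2 0 1 1 0 1 2 0 1 0 0 1 3 1 1,
  C 0 0 0 2 1 1 1 0 0 3 0 1 1 0 1 3,
  C 0 2 0 0 1 1 1 1 0 0 0 3 1 2 1 0,
  C 0 1 0 1 1 0 1 2 0 2 0 0 1 3 1 1,
  C 0 0 0 2 1 2 1 0 0 3 0 1 1 0 1 3,
  C 0 1 0 0 1 3 1 2 0 0 0 1 1 1 1 0,
  C 0 2 0 2 1 0 1 1 0 1 0 0 1 2 1 2,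
  C 0 0 0 3 1 1 1 0 0 3 0 1 1 0 1 2,
  C 0 1 0 0 1 3 1 1 0 0 0 2 1 1 1 0,
  C 0 2 0 1 1 0 1 3 0 1 0 0 1 2 1 1,
  C 0 0 0 3 1 1 1 0 0 3 0 2 1 0 1 1,
  C 0 1 0 0 1 3 1 2 0 0 0 1 1 1 1 0,
  C 0 2 0 2 1 0 1 3 0 1 0 0 1 2 1 2,
  C 0 0 0 3 1 1 1 0 0 3 0 1 1 0 1 3,
  C 0 2 0 0 1 1 1 1 0 0 0 2 1 2 1 0,
  C 0 1 0 1 1 0 1 2 0 2 0 0 1 3 1 1,
  C 0 0 0 3 1 1 1 0 0 2 0 1 1 0 1 3,
  C 0 1 0 0 1 2 1 1 0 0 0 2 1 1 1 0,
  C 0 3 0 1 1 0 1 2 0 1 0 0 1 3 1 1,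
  C 0 0 0 3 1 2 1 0 0 1 0 1 1 0 1 3,
  C 0 2 0 0 1 1 1 1 0 0 0 2 1 2 1 0,
  C 0 3 0 1 1 0 1 2 0 2 0 0 1 3 1 1,
  C 0 0 0 3 1 4 1 0 0 1 0 1 1 0 1 3,
  C 0 3 0 0 1 1 1 1 0 0 0 2 1 3 1 0,
  C 0 1 0 3 1 0 1 1 0 2 0 0 1 1 1 2,
  C 0 0 0 1 1 2 1 0 0 1 0 2 1 0 1 1,
  C 0 3 0 0 1 1 1 3 0 0 0 1 1 3 1 0],
  [C 0 1 0 3 1 0 1 2 0 2 0 0 1 1 1 1,
  C 0 0 0 2 1 2 1 0 0 1 0 1 1 0 1 2,
  C 0 3 0 0 1 1 1 3 0 0 0 2 1 3 1 0,
  C 0 1 0 3 1 0 1 1 0 2 0 0 1 1 1 4,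
  C 0 0 0 1 1 2 1 0 0 1 0 2 1 0 1 1,
  C 0 3 0 0 1 1 1 2 0 0 0 1 1 3 1 0,
  C 0 1 0 3 1 0 1 2 0 2 0 0 1 1 1 3,
  C 0 0 0 1 1 2 1 0 0 1 0 4 1 0 1 1,
  C 0 2 0 0 1 3 1 2 0 0 0 1 1 1 1 0,
  C 0 2 0 2 1 0 1 1 0 1 0 0 1 2 1 2,
  C 0 0 0 3 1 1 1 0 0 3 0 1 1 0 1 2,
  C 0 1 0 0 1 3 1 3 0 0 0 1 1 1 1 0,
  C 0 2 0 3 1 0 1 1 0 1 0 0 1 2 1 3,
  C 0 0 0 2 1 1 1 0 0 3 0 1 1 0 1 3,
  C 0 1 0 0 1 3 1 1 0 0 0 2 1 2 1 0,
  C 0 1 0 1 1 0 1 2 0 2 0 0 1 1 1 1,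
  C 0 0 0 3 1 2 1 0 0 3 0 1 1 0 1 3,
  C 0 2 0 0 1 3 1 1 0 0 0 2 1 1 1 0,
  C 0 2 0 1 1 0 1 2 0 1 0 0 1 2 1 1,
  C 0 0 0 3 1 1 1 0 0 3 0 1 1 0 1 3,
  C 0 1 0 0 1 3 1 1 0 0 0 4 1 1 1 0,
  C 0 2 0 1 1 0 1 4 0 1 0 0 1 2 1 1,
  C 0 0 0 2 1 1 1 0 0 3 0 1 1 0 1 2,
  C 0 1 0 0 1 3 1 1 0 0 0 3 1 1 1 0,
  C 0 2 0 1 1 0 1 3 0 1 0 0 1 2 1 1,
  C 0 0 0 4 1 1 1 0 0 3 0 1 1 0 1 4,
  C 0 1 0 0 1 3 1 1 0 0 0 2 1 1 1 0,
  C 0 2 0 1 1 0 1 2 0 1 0 0 1 2 1 1,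
  C 0 0 0 3 1 3 1 0 0 1 0 1 1 0 1 3,
  C 0 2 0 0 1 1 1 1 0 0 0 2 1 2 1 0,
  C 0 1 0 3 1 0 1 1 0 2 0 0 1 3 1 2,
  C 0 0 0 1 1 1 1 0 0 2 0 2 1 0 1 1],
  [C 0 1 0 0 1 2 1 2 0 0 0 3 1 1 1 0,
  C 0 3 0 1 1 0 1 2 0 1 0 0 1 3 1 1,
  C 0 0 0 2 1 1 1 0 0 2 0 1 1 0 1 3,
  C 0 1 0 0 1 2 1 1 0 0 0 3 1 1 1 0,
  C 0 3 0 2 1 0 1 1 0 1 0 0 1 3 1 2,
  C 0 0 0 1 1 1 1 0 0 2 0 2 1 0 1 3,
  C 0 1 0 0 1 2 1 2 0 0 0 3 1 1 1 0,
  C 0 3 0 1 1 0 1 3 0 2 0 0 1 1 1 1,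
  C 0 0 0 2 1 2 1 0 0 1 0 1 1 0 1 2,
  C 0 2 0 0 1 3 1 1 0 0 0 3 1 1 1 0,
  C 0 2 0 1 1 0 1 3 0 1 0 0 1 2 1 1,
  C 0 0 0 2 1 1 1 0 0 3 0 3 1 0 1 1,
  C 0 1 0 0 1 3 1 2 0 0 0 1 1 1 1 0,
  C 0 2 0 2 1 0 1 1 0 3 0 0 1 1 1 2,
  C 0 0 0 3 1 2 1 0 0 1 0 1 1 0 1 2,
  C 0 2 0 0 1 1 1 1 0 0 0 2 1 2 1 0,
  C 0 3 0 1 1 0 1 3 0 1 0 0 1 2 1 1,
  C 0 0 0 3 1 1 1 0 0 2 0 1 1 0 1 2,
  C 0 1 0 0 1 3 1 1 0 0 0 2 1 1 1 0,
  C 0 3 0 1 1 0 1 3 0 2 0 0 1 1 1 1,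
  C 0 0 0 3 1 2 1 0 0 1 0 1 1 0 1 2,
  C 0 2 0 0 1 3 1 1 0 0 0 2 1 2 1 0,
  C 0 3 0 1 1 0 1 3 0 1 0 0 1 3 1 2,
  C 0 0 0 1 1 1 1 0 0 2 0 2 1 0 1 1,
  C 0 1 0 0 1 2 1 2 0 0 0 3 1 1 1 0,
  C 0 3 0 1 1 0 1 2 0 1 0 0 1 3 1 1,
  C 0 0 0 2 1 1 1 0 0 2 0 1 1 0 1 3,
  C 0 1 0 0 1 2 1 1 0 0 0 3 1 1 1 0,
  C 0 3 0 2 1 0 1 1 0 2 0 0 1 1 1 2,
  C 0 0 0 1 1 2 1 0 0 1 0 2 1 0 1 3,
  C 0 2 0 0 1 3 1 1 0 0 0 2 1 1 1 0,
  C 0 2 0 3 1 0 1 1 0 1 0 0 1 2 1 2],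
  [C 0 0 0 1 1 1 1 0 0 3 0 2 1 0 1 1,
  C 0 2 0 0 1 3 1 2 0 0 0 3 1 1 1 0,
  C 0 2 0 1 1 0 1 2 0 1 0 0 1 2 1 1,
  C 0 0 0 2 1 1 1 0 0 3 0 1 1 0 1 3,
  C 0 1 0 0 1 3 1 1 0 0 0 3 1 1 1 0,
  C 0 2 0 2 1 0 1 1 0 1 0 0 1 2 1 2,
  C 0 0 0 1 1 1 1 0 0 3 0 3 1 0 1 1,
  C 0 2 0 0 1 1 1 2 0 0 0 3 1 2 1 0,
  C 0 1 0 1 1 0 1 2 0 2 0 0 1 3 1 1,
  C 0 0 0 2 1 1 1 0 0 2 0 1 1 0 1 3,
  C 0 1 0 0 1 2 1 1 0 0 0 3 1 1 1 0,
  C 0 3 0 1 1 0 1 2 0 1 0 0 1 3 1 1,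
  C 0 0 0 2 1 2 1 0 0 1 0 1 1 0 1 3,
  C 0 2 0 0 1 1 1 1 0 0 0 3 1 2 1 0,
  C 0 3 0 1 1 0 1 2 0 2 0 0 1 3 1 1,
  C 0 0 0 2 1 1 1 0 0 3 0 3 1 0 1 1,
  C 0 1 0 0 1 2 1 2 0 0 0 1 1 1 1 0,
  C 0 2 0 2 1 0 1 1 0 3 0 0 1 1 1 2,
  C 0 0 0 3 1 2 1 0 0 1 0 1 1 0 1 2,
  C 0 2 0 0 1 1 1 1 0 0 0 2 1 2 1 0,
  C 0 3 0 1 1 0 1 3 0 1 0 0 1 2 1 1,
  C 0 0 0 3 1 1 1 0 0 2 0 1 1 0 1 2,
  C 0 1 0 0 1 3 1 1 0 0 0 2 1 1 1 0,
  C 0 3 0 1 1 0 1 3 0 2 0 0 1 1 1 1,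
  C 0 0 0 3 1 2 1 0 0 1 0 1 1 0 1 2,
  C 0 2 0 0 1 4 1 1 0 0 0 2 1 1 1 0,
  C 0 2 0 1 1 0 1 3 0 1 0 0 1 2 1 1,
  C 0 0 0 3 1 1 1 0 0 3 0 1 1 0 1 2,
  C 0 1 0 0 1 3 1 1 0 0 0 2 1 1 1 0,
  C 0 4 0 1 1 0 1 3 0 1 0 0 1 4 1 1,
  C 0 0 0 3 1 1 1 0 0 2 0 1 1 0 1 2,
  C 0 1 0 0 1 2 1 1 0 0 0 2 1 1 1 0],
  [C 0 3 0 1 1 0 1 3 0 1 0 0 1 3 1 1,
  C 0 0 0 3 1 1 1 0 0 4 0 1 1 0 1 2,
  C 0 1 0 0 1 4 1 1 0 0 0 2 1 1 1 0,
  C 0 2 0 1 1 0 1 3 0 1 0 0 1 2 1 1,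
  C 0 0 0 3 1 3 1 0 0 1 0 1 1 0 1 2,
  C 0 2 0 0 1 1 1 1 0 0 0 2 1 2 1 0,
  C 0 1 0 3 1 0 1 1 0 2 0 0 1 3 1 2,
  C 0 0 0 1 1 1 1 0 0 2 0 2 1 0 1 1,
  C 0 1 0 0 1 2 1 2 0 0 0 3 1 1 1 0,
  C 0 3 0 1 1 0 1 2 0 1 0 0 1 3 1 1,
  C 0 0 0 2 1 1 1 0 0 2 0 1 1 0 1 3,
  C 0 1 0 0 1 2 1 1 0 0 0 4 1 1 1 0,
  C 0 3 0 1 1 0 1 4 0 1 0 0 1 3 1 1,
  C 0 0 0 3 1 1 1 0 0 2 0 1 1 0 1 2,
  C 0 1 0 0 1 2 1 1 0 0 0 2 1 1 1 0,
  C 0 3 0 1 1 0 1 3 0 1 0 0 1 3 1 1,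
  C 0 0 0 4 1 1 1 0 0 2 0 1 1 0 1 4,
  C 0 1 0 0 1 2 1 1 0 0 0 3 1 1 1 0,
  C 0 3 0 1 1 0 1 2 0 1 0 0 1 3 1 1,
  C 0 0 0 2 1 1 1 0 0 2 0 3 1 0 1 1,
  C 0 1 0 0 1 2 1 2 0 0 0 1 1 1 1 0,
  C 0 3 0 2 1 0 1 1 0 2 0 0 1 1 1 2,
  C 0 0 0 3 1 2 1 0 0 1 0 1 1 0 1 2,
  C 0 2 0 0 1 3 1 1 0 0 0 2 1 1 1 0,
  C 0 2 0 1 1 0 1 3 0 1 0 0 1 2 1 1,
  C 0 0 0 3 1 1 1 0 0 3 0 1 1 0 1 2,
  C 0 1 0 0 1 4 1 1 0 0 0 2 1 1 1 0,
  C 0 4 0 1 1 0 1 3 0 1 0 0 1 3 1 1,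
  C 0 0 0 3 1 1 1 0 0 2 0 1 1 0 1 2,
  C 0 1 0 0 1 2 1 1 0 0 0 2 1 1 1 0,
  C 0 3 0 1 1 0 1 3 0 1 0 0 1 4 1 1,
  C 0 0 0 3 1 1 1 0 0 4 0 1 1 0 1 2],
  [C 0 1 0 0 1 3 1 1 0 0 0 2 1 1 1 0,
  C 0 2 0 1 1 0 1 3 0 1 0 0 1 2 1 1,
  C 0 0 0 3 1 3 1 0 0 1 0 1 1 0 1 2,
  C 0 2 0 0 1 1 1 1 0 0 0 2 1 2 1 0,
  C 0 1 0 3 1 0 1 1 0 2 0 0 1 3 1 2,
  C 0 0 0 1 1 1 1 0 0 2 0 2 1 0 1 1,
  C 0 1 0 0 1 2 1 2 0 0 0 3 1 1 1 0,
  C 0 3 0 1 1 0 1 2 0 1 0 0 1 4 1 1,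
  C 0 0 0 2 1 1 1 0 0 2 0 1 1 0 1 3,
  C 0 1 0 0 1 2 1 1 0 0 0 4 1 1 1 0,
  C 0 3 0 1 1 0 1 4 0 1 0 0 1 3 1 1,
  C 0 0 0 2 1 1 1 0 0 4 0 1 1 0 1 2,
  C 0 1 0 0 1 2 1 1 0 0 0 3 1 1 1 0,
  C 0 2 0 1 1 0 1 3 0 1 0 0 1 3 1 1,
  C 0 0 0 4 1 1 1 0 0 3 0 1 1 0 1 2,
  C 0 1 0 0 1 4 1 1 0 0 0 2 1 1 1 0,
  C 0 4 0 1 1 0 1 3 0 1 0 0 1 2 1 1,
  C 0 0 0 3 1 1 1 0 0 3 0 1 1 0 1 4,
  C 0 1 0 0 1 3 1 1 0 0 0 2 1 1 1 0,
  C 0 2 0 1 1 0 1 2 0 1 0 0 1 2 1 1,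
  C 0 0 0 4 1 1 1 0 0 3 0 1 1 0 1 3,
  C 0 1 0 0 1 3 1 1 0 0 0 3 1 1 1 0,
  C 0 2 0 1 1 0 1 4 0 1 0 0 1 2 1 1,
  C 0 0 0 2 1 1 1 0 0 3 0 1 1 0 1 2,
  C 0 1 0 0 1 3 1 1 0 0 0 4 1 1 1 0,
  C 0 2 0 1 1 0 1 3 0 1 0 0 1 2 1 1,
  C 0 0 0 3 1 1 1 0 0 3 0 1 1 0 1 4,
  C 0 1 0 0 1 4 1 1 0 0 0 2 1 1 1 0,
  C 0 2 0 1 1 0 1 2 0 1 0 0 1 2 1 1,
  C 0 0 0 4 1 1 1 0 0 4 0 1 1 0 1 3,
  C 0 1 0 0 1 3 1 1 0 0 0 2 1 1 1 0,
  C 0 3 0 1 1 0 1 2 0 1 0 0 1 4 1 1],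
  [C 0 0 0 3 1 1 1 0 0 2 0 1 1 0 1 3,
  C 0 1 0 0 1 2 1 1 0 0 0 2 1 1 1 0,
  C 0 4 0 1 1 0 1 2 0 1 0 0 1 3 1 1,
  C 0 0 0 3 1 1 1 0 0 3 0 1 1 0 1 3,
  C 0 1 0 0 1 4 1 1 0 0 0 2 1 1 1 0,
  C 0 2 0 1 1 0 1 2 0 1 0 0 1 2 1 1,
  C 0 0 0 3 1 1 1 0 0 4 0 1 1 0 1 3,
  C 0 1 0 0 1 3 1 1 0 0 0 2 1 1 1 0,
  C 0 3 0 1 1 0 1 4 0 1 0 0 1 2 1 1,
  C 0 0 0 4 1 1 1 0 0 2 0 1 1 0 1 2,
  C 0 1 0 0 1 3 1 1 0 0 0 3 1 1 1 0,
  C 0 3 0 1 1 0 1 5 0 1 0 0 1 2 1 1,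
  C 0 0 0 2 1 1 1 0 0 2 0 1 1 0 1 3,
  C 0 1 0 0 1 3 1 1 0 0 0 4 1 1 1 0,
  C 0 3 0 1 1 0 1 2 0 1 0 0 1 2 1 1,
  C 0 0 0 3 1 1 1 0 0 2 0 1 1 0 1 4,
  C 0 1 0 0 1 3 1 1 0 0 0 2 1 1 1 0,
  C 0 3 0 1 1 0 1 3 0 1 0 0 1 2 1 1,
  C 0 0 0 4 1 1 1 0 0 2 0 1 1 0 1 2,
  C 0 1 0 0 1 3 1 1 0 0 0 5 1 1 1 0,
  C 0 3 0 1 1 0 1 4 0 1 0 0 1 2 1 1,
  C 0 0 0 2 1 1 1 0 0 2 0 1 1 0 1 3,
  C 0 1 0 0 1 3 1 1 0 0 0 3 1 1 1 0,
  C 0 3 0 1 1 0 1 2 0 1 0 0 1 2 1 1,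
  C 0 0 0 4 1 1 1 0 0 2 0 1 1 0 1 4,
  C 0 1 0 0 1 3 1 1 0 0 0 2 1 1 1 0,
  C 0 3 0 1 1 0 1 5 0 1 0 0 1 2 1 1,
  C 0 0 0 3 1 1 1 0 0 2 0 1 1 0 1 2,
  C 0 1 0 0 1 3 1 1 0 0 0 4 1 1 1 0,
  C 0 3 0 1 1 0 1 3 0 1 0 0 1 2 1 1,
  C 0 0 0 2 1 1 1 0 0 2 0 1 1 0 1 4,
  C 0 1 0 0 1 3 1 1 0 0 0 3 1 1 1 0],
  [C 0 3 0 1 1 0 1 2 0 1 0 0 1 2 1 1,
  C 0 0 0 5 1 1 1 0 0 2 0 1 1 0 1 3,
  C 0 1 0 0 1 3 1 1 0 0 0 2 1 1 1 0,
  C 0 3 0 1 1 0 1 4 0 1 0 0 1 2 1 1,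
  C 0 0 0 3 1 1 1 0 0 2 0 1 1 0 1 2,
  C 0 1 0 0 1 3 1 1 0 0 0 5 1 1 1 0,
  C 0 3 0 1 1 0 1 3 0 1 0 0 1 2 1 1,
  C 0 0 0 2 1 1 1 0 0 2 0 1 1 0 1 5,
  C 0 1 0 0 1 3 1 1 0 0 0 3 1 1 1 0,
  C 0 3 0 1 1 0 1 2 0 1 0 0 1 2 1 1,
  C 0 0 0 4 1 1 1 0 0 2 0 1 1 0 1 3,
  C 0 1 0 0 1 3 1 1 0 0 0 2 1 1 1 0,
  C 0 3 0 1 1 0 1 5 0 1 0 0 1 2 1 1,
  C 0 0 0 3 1 1 1 0 0 2 0 1 1 0 1 2,
  C 0 1 0 0 1 3 1 1 0 0 0 4 1 1 1 0,
  C 0 3 0 1 1 0 1 4 0 1 0 0 1 2 1 1,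
  C 0 0 0 2 1 1 1 0 0 2 0 1 1 0 1 3,
  C 0 1 0 0 1 3 1 1 0 0 0 3 1 1 1 0,
  C 0 3 0 1 1 0 1 2 0 1 0 0 1 2 1 1,
  C 0 0 0 5 1 1 1 0 0 2 0 1 1 0 1 4,
  C 0 1 0 0 1 3 1 1 0 0 0 2 1 1 1 0,
  C 0 3 0 1 1 0 1 3 0 1 0 0 1 2 1 1,
  C 0 0 0 3 1 1 1 0 0 2 0 1 1 0 1 2,
  C 0 1 0 0 1 3 1 1 0 0 0 5 1 1 1 0,
  C 0 3 0 1 1 0 1 4 0 1 0 0 1 2 1 1,
  C 0 0 0 2 1 1 1 0 0 2 0 1 1 0 1 5,
  C 0 1 0 0 1 3 1 1 0 0 0 3 1 1 1 0,
  C 0 3 0 1 1 0 1 2 0 1 0 0 1 2 1 1,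
  C 0 0 0 4 1 1 1 0 0 2 0 1 1 0 1 4,
  C 0 1 0 0 1 3 1 1 0 0 0 2 1 1 1 0,
  C 0 3 0 1 1 0 1 5 0 1 0 0 1 2 1 1,
  C 0 0 0 3 1 1 1 0 0 2 0 1 1 0 1 2],
  [C 0 1 0 0 1 3 1 1 0 0 0 4 1 1 1 0,
  C 0 3 0 1 1 0 1 3 0 1 0 0 1 2 1 1,
  C 0 0 0 2 1 1 1 0 0 2 0 1 1 0 1 5,
  C 0 1 0 0 1 3 1 1 0 0 0 5 1 1 1 0,
  C 0 3 0 1 1 0 1 2 0 1 0 0 1 2 1 1,
  C 0 0 0 3 1 1 1 0 0 2 0 1 1 0 1 3,
  C 0 1 0 0 1 3 1 1 0 0 0 2 1 1 1 0,
  C 0 3 0 1 1 0 1 4 0 1 0 0 1 2 1 1,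
  C 0 0 0 4 1 1 1 0 0 2 0 1 1 0 1 2,
  C 0 1 0 0 1 3 1 1 0 0 0 3 1 1 1 0,
  C 0 3 0 1 1 0 1 3 0 1 0 0 1 2 1 1,
  C 0 0 0 2 1 1 1 0 0 2 0 1 1 0 1 4,
  C 0 1 0 0 1 3 1 1 0 0 0 4 1 1 1 0,
  C 0 3 0 1 1 0 1 2 0 1 0 0 1 2 1 1,
  C 0 0 0 3 1 1 1 0 0 2 0 1 1 0 1 5,
  C 0 1 0 0 1 3 1 1 0 0 0 2 1 1 1 0,
  C 0 3 0 1 1 0 1 3 0 1 0 0 1 2 1 1,
  C 0 0 0 4 0 0 0 0 0 0 0 0 0 0 0 0]]"

lemmas w_data_chunks =
  tab_chunk_at[OF w_data_def, unfolded num_of_nat_numeral_eq tab_concat tab.simps adv.simps inc.simps concat.simps(1) simp_thms]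

section \<open>Evaluation on the stored letters\<close>

lemmas w_calc = calc w_data_chunks

lemmas sigma_calc = calc sigma_data_chunks

text \<open>The three ranges end at 1690, the largest k with 4k < 6764: these are the lengths for
  which the second x can begin in the prefix.\<close>

lemma w_start0: "all_from (start w_data 8468) 1 10"
  by (simp only: w_calc cong: if_weak_cong)

lemma w_start1: "all_from (start w_data 8468) 11 190"
  by (simp only: w_calc cong: if_weak_cong)

lemma w_start2: "all_from (start w_data 8468) 201 1490"
  by (simp only: w_calc cong: if_weak_cong)

text \<open>Here the ranges end at 5056, the largest k with 4k < 20226. They grow geometrically,
  since the number of windows to be scanned falls roughly like 1 / h.\<close>

lemma sigma_start0: "all_from (start sigma_data 25290) 1 2"
  by (simp only: sigma_calc cong: if_weak_cong)

lemma sigma_start1: "all_from (start sigma_data 25290) 3 4"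
  by (simp only: sigma_calc cong: if_weak_cong)

lemma sigma_start2: "all_from (start sigma_data 25290) 7 10"
  by (simp only: sigma_calc cong: if_weak_cong)

lemma sigma_start3: "all_from (start sigma_data 25290) 17 27"
  by (simp only: sigma_calc cong: if_weak_cong)

lemma sigma_start4: "all_from (start sigma_data 25290) 44 73"
  by (simp only: sigma_calc cong: if_weak_cong)

lemma sigma_start5: "all_from (start sigma_data 25290) 117 196"
  by (simp only: sigma_calc cong: if_weak_cong)

lemma sigma_start6: "all_from (start sigma_data 25290) 313 527"
  by (simp only: sigma_calc cong: if_weak_cong)

lemma sigma_start7: "all_from (start sigma_data 25290) 840 1416"
  by (simp only: sigma_calc cong: if_weak_cong)

lemma sigma_start8: "all_from (start sigma_data 25290) 2256 2801"
  by (simp only: sigma_calc cong: if_weak_cong)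

text \<open>Lengths \<open>|x|\<close> of powers \<open>xyx\<close> that suffice to exclude all smaller letters, the frequently
  used ones first.\<close>

definition w_periods :: "num list" where
  "w_periods = map num_of_nat [1, 2, 6, 12, 24, 18, 36, 30, 138, 120, 366, 100, 244, 60, 246, 952, 210, 96, 144]"

definition sigma_periods :: "num list" where
  "sigma_periods = map num_of_nat [1, 2, 6, 12, 24, 18, 36, 30, 66, 138, 114, 120, 5, 366, 42, 3, 342, 294, 84, 1020, 336, 156, 360, 186, 180, 222, 408, 132, 288, 300, 282, 276, 420, 150, 144, 450]"

text \<open>The range reaches 48 letters beyond the prefix, because lifting from \<sigma> starts
  only with its entry 8.\<close>

lemma w_low: "all_from (low w_data w_periods 0) 4096 6812"
  by (simp only: w_calc w_periods_def list.map cong: if_weak_cong)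

text \<open>The start is entry 8, at address 4104: the beginning of \<sigma> is not minimal. For
  instance entry 0 is 3, and no power fits into one letter to exclude 2.\<close>

lemma sigma_low: "all_from (low sigma_data sigma_periods 2) 4104 20218"
  by (simp only: sigma_calc sigma_periods_def list.map cong: if_weak_cong)

text \<open>The entry 2 of \<open>w_pattern\<close> and the entry 4 of \<open>sigma_pattern\<close> stand for all letters not below it.\<close>

definition w_pattern :: "nat list" where
  "w_pattern = [1, 1, 1, 0, 0, 2, 0, 1, 1, 0, 1, 2, 0, 1, 0, 0, 1, 2, 1, 1, 0, 0, 0, 2]"

definition sigma_pattern :: "nat list" where
  "sigma_pattern = [2, 3, 2, 2, 3, 4, 3, 3, 2, 2, 2, 4, 3, 3, 3, 2, 2, 4, 2, 3, 3, 2, 3, 4]"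

text \<open>Block \<open>x \<ge> 1\<close> of 24 letters of the periodic part begins at letter \<open>N + 24 * (x - 1)\<close>, whose
  address is \<open>24 * x + c\<close> for \<open>c = N + 4072\<close>; the four letters of \<open>sigma_data\<close> that it contains begin
  at address \<open>4 * x + 4092\<close>.\<close>

definition block :: "chunk list \<Rightarrow> nat list \<Rightarrow> nat \<Rightarrow> nat \<Rightarrow> num \<Rightarrow> bool" where
  "block A P c d x \<longleftrightarrow> seq A (num.Bit0 (num.Bit0 (num.Bit0 (num.Bit0 x + x))) + num_of_nat c)
     (concat (map (\<lambda>t. [P ! (6 * t), P ! (6 * t + 1), P ! (6 * t + 2), P ! (6 * t + 3), P ! (6 * t + 4),
        letter_at sigma_data (num.Bit0 (num.Bit0 x) + num_of_nat (4092 + t)) + d]) [0, 1, 2, 3]))"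

lemma w_block: "all_from (block w_data w_pattern 10836 0) 1 71"
proof -
  \<comment> \<open>The pattern is looked up once for all blocks, so that the evaluation meets
    literal pattern letters.\<close>
  have block: "block w_data w_pattern 10836 0 x \<longleftrightarrow>
    seq w_data (num.Bit0 (num.Bit0 (num.Bit0 (num.Bit0 x + x))) + num_of_nat 10836)
      [1,1,1,0,0,letter_at sigma_data (num.Bit0 (num.Bit0 x) + num_of_nat 4092),0,1,1,0,1,letter_at sigma_data (num.Bit0 (num.Bit0 x) + num_of_nat 4093),0,1,0,0,1,letter_at sigma_data (num.Bit0 (num.Bit0 x) + num_of_nat 4094),1,1,0,0,0,letter_at sigma_data (num.Bit0 (num.Bit0 x) + num_of_nat 4095)]" for x
    by (simp add: block_def w_pattern_def)
  show ?thesis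
    by (simp only: calc w_data_chunks sigma_data_chunks block cong: if_weak_cong)
qed

lemma sigma_block: "all_from (block sigma_data sigma_pattern 24298 2) 1 211"
proof -
  have block: "block sigma_data sigma_pattern 24298 2 x \<longleftrightarrow>
    seq sigma_data (num.Bit0 (num.Bit0 (num.Bit0 (num.Bit0 x + x))) + num_of_nat 24298)
      [2,3,2,2,3,letter_at sigma_data (num.Bit0 (num.Bit0 x) + num_of_nat 4092) + 2,3,3,2,2,2,letter_at sigma_data (num.Bit0 (num.Bit0 x) + num_of_nat 4093) + 2,3,3,3,2,2,letter_at sigma_data (num.Bit0 (num.Bit0 x) + num_of_nat 4094) + 2,2,3,3,2,3,letter_at sigma_data (num.Bit0 (num.Bit0 x) + num_of_nat 4095) + 2]" for x
    by (simp add: block_def sigma_pattern_def)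
  show ?thesis
    by (simp only: calc sigma_data_chunks block cong: if_weak_cong)
qed

definition ge_2 :: "num \<Rightarrow> bool" where
  "ge_2 a \<longleftrightarrow> 2 \<le> letter_at sigma_data a"

lemma sigma_data_ge2: "all_from ge_2 4096 20226"
  by (simp only: calc sigma_data_chunks ge_2_def order_refl cong: if_weak_cong)

definition mult_4_ne_4 :: "num \<Rightarrow> bool" where
  "mult_4_ne_4 x \<longleftrightarrow> letter_at sigma_data (num.Bit0 (num.Bit0 x) + num_of_nat 4098) \<noteq> 4"

text \<open>Address 4x + 4098 is entry 2 + 4x; the last x, 5055, gives 20222, the last such entry of
  the prefix.\<close>

lemma sigma_data_ne4: "all_from mult_4_ne_4 21 5035"
  by (simp only: calc sigma_data_chunks mult_4_ne_4_def cong: if_weak_cong)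

lemma sigma_data_2: "word sigma_data 2 = 4"
  by (simp only: word_def calc sigma_data_chunks cong: if_weak_cong)

text \<open>For each residue class modulo 6 of \<open>|x|\<close>, positions at which the prefix deviates from the
  periodic part; consecutive ones are so close that long \<open>x\<close> cannot avoid them.\<close>

lemma w_chains:
  "covers (deviates w_data w_pattern 6764 4 2 0) 6764 341 0
    [339, 679, 1019, 1359, 1699, 2037, 2367, 2707, 2937, 3267, 3601, 3937, 4275, 4611, 4881, 5211, 5511, 5845, 6033, 6279, 6513, 6781]"
  "covers (deviates w_data w_pattern 6764 4 2 1) 6764 341 0
    [340, 681, 1022, 1362, 1702, 2043, 2384, 2725, 3066, 3407, 3748, 4089, 4430, 4771, 5112, 5453, 5794, 6135, 6476, 6817]"
  "covers (deviates w_data w_pattern 6764 4 2 2) 6764 341 0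
    [339, 679, 1017, 1357, 1697, 2037, 2377, 2717, 3057, 3397, 3737, 4077, 4415, 4755, 5093, 5433, 5773, 6113, 6453, 6793]"
  "covers (deviates w_data w_pattern 6764 4 2 3) 6764 341 0
    [340, 680, 1021, 1362, 1703, 2044, 2384, 2725, 3066, 3406, 3746, 4087, 4428, 4768, 5108, 5449, 5790, 6130, 6471, 6812]"
  "covers (deviates w_data w_pattern 6764 4 2 4) 6764 341 0
    [333, 617, 951, 1115, 1445, 1785, 2125, 2465, 2803, 3143, 3483, 3823, 4163, 4503, 4843, 5183, 5523, 5863, 6203, 6543, 6883]"
  "covers (deviates w_data w_pattern 6764 4 2 5) 6764 341 0
    [340, 681, 1022, 1363, 1704, 2045, 2386, 2727, 3068, 3409, 3750, 4091, 4432, 4773, 5114, 5455, 5796, 6137, 6478, 6819]"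
  by (simp_all only: covers.simps deviates_def word_def calc w_data_chunks cong: if_weak_cong)
    (simp_all add: w_pattern_def)

lemma sigma_chains:
  "covers (deviates sigma_data sigma_pattern 20226 6 4 0) 20226 1013 0
    [1009, 2021, 3029, 4037, 5041, 6047, 7057, 8065, 9071, 10069, 11077, 12083, 13091, 14101, 15103, 16069, 17071, 18083, 19093, 19975, 20243]"
  "covers (deviates sigma_data sigma_pattern 20226 6 4 1) 20226 1013 0
    [1012, 2025, 3038, 4051, 5064, 6077, 7090, 8103, 9116, 10128, 11141, 12154, 13167, 14180, 15193, 16206, 17219, 18232, 19245, 20258]"
  "covers (deviates sigma_data sigma_pattern 20226 6 4 2) 20226 1013 0
    [1011, 2023, 3035, 4047, 5059, 6071, 7083, 8095, 9107, 10119, 11131, 12143, 13155, 14167, 15177, 16189, 17201, 18213, 19225, 20237]"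
  "covers (deviates sigma_data sigma_pattern 20226 6 4 3) 20226 1013 0
    [1012, 2024, 3037, 4050, 5062, 6074, 7087, 8100, 9112, 10124, 11136, 12149, 13162, 14174, 15187, 16200, 17212, 18224, 19236, 20248]"
  "covers (deviates sigma_data sigma_pattern 20226 6 4 4) 20226 1013 0
    [1011, 2023, 3035, 4047, 5059, 6071, 7083, 8093, 9105, 10117, 11129, 12141, 13153, 14165, 15177, 16189, 17201, 18213, 19225, 20237]"
  "covers (deviates sigma_data sigma_pattern 20226 6 4 5) 20226 1013 0
    [1012, 2025, 3038, 4051, 5064, 6077, 7090, 8103, 9116, 10129, 11142, 12154, 13167, 14180, 15193, 16206, 17218, 18231, 19244, 20257]"
  by (simp_all only: covers.simps deviates_def word_def calc sigma_data_chunks cong: if_weak_cong)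
    (simp_all add: sigma_pattern_def)

section \<open>The two words\<close>

lemma w_start:
  assumes "1 \<le> k" "k \<le> 1690" "i + 5 * k \<le> 8468"
  shows "conflict (word w_data) i k"
proof -
  consider "k < 1 + 10" | "11 \<le> k" "k < 11 + 190" | "201 \<le> k" "k < 201 + 1490"
    using assms(2) by linarith
  then show ?thesis
    unfolding conflict_def
    by cases (use assms in \<open>blast intro: start_sound[OF w_start0] start_sound[OF w_start1]
      start_sound[OF w_start2]\<close>)+
qed

lemma sigma_start:
  assumes "1 \<le> k" "k \<le> 5056" "i + 5 * k \<le> 25290"
  shows "conflict (word sigma_data) i k"
proof -
  consider "1 \<le> k" "k < 1 + 2" | "3 \<le> k" "k < 3 + 4" | "7 \<le> k" "k < 7 + 10" | "17 \<le> k" "k < 17 + 27" | "44 \<le> k" "k < 44 + 73" | "117 \<le> k" "k < 117 + 196" | "313 \<le> k" "k < 313 + 527" | "840 \<le> k" "k < 840 + 1416" | "2256 \<le> k" "k < 2256 + 2801"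
    using assms(1,2) by linarith
  then show ?thesis
    unfolding conflict_def
    by cases (use assms in \<open>blast intro: start_sound[OF sigma_start0] start_sound[OF sigma_start1] start_sound[OF sigma_start2] start_sound[OF sigma_start3] start_sound[OF sigma_start4] start_sound[OF sigma_start5] start_sound[OF sigma_start6] start_sound[OF sigma_start7] start_sound[OF sigma_start8]\<close>)+
qed

text \<open>Here \<open>sigma\<close> is the sequence of the numbers \<open>n + d\<^sub>j\<close> for the letters \<open>n\<^sub>j\<close> of
  \<open>\<^bold>s = \<^bold>z \<phi>(\<^bold>s)\<close>, and \<open>wext\<close> is the word \<open>\<^bold>p \<tau>(\<phi>(\<^bold>s))\<close>.\<close>

function sigma :: "nat \<Rightarrow> nat" where
  "sigma n = (if n < 20226 then word sigma_data n
     else if (n - 20226) mod 6 = 5 then sigma ((n - 20226) div 6) + 2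
     else sigma_pattern ! ((n - 20226) mod 24))"
  by auto
termination
  by (relation "measure id") (auto intro: le_less_trans[OF div_le_dividend])

declare sigma.simps [simp del]

definition wext :: "nat \<Rightarrow> nat" where
  "wext n = (if n < 6764 then word w_data n
     else if (n - 6764) mod 6 = 5 then sigma ((n - 6764) div 6)
     else w_pattern ! ((n - 6764) mod 24))"

lemma less_24E:
  assumes "(r::nat) < 24"
  shows "r \<in> {0,1,2,3,4,5,6,7,8,9,10,11,12,13,14,15,16,17,18,19,20,21,22,23}"
  using assms by (simp, presburger)

lemma mod_6_24: "(r::nat) mod 24 mod 6 = r mod 6"
  by (rule mod_mod_cancel) simp

lemma sigma_star: "sigma (20226 + 6 * i + 5) = sigma i + 2"
  by (subst sigma.simps) simp

lemma wext_star: "wext (6764 + 6 * i + 5) = sigma i"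
  by (simp add: wext_def)

lemma sigma_ge_2: "2 \<le> sigma n"
proof -
  have P: "2 \<le> sigma_pattern ! r" if "r < 24" for r
    using less_24E[OF that] by (auto simp: sigma_pattern_def)
  have "2 \<le> word sigma_data n" if "n < 20226"
    using all_fromD[OF sigma_data_ge2, of "n + 4096"] that by (simp add: word_def ge_2_def)
  then show ?thesis by (subst sigma.simps) (simp add: P)
qed

text \<open>The interleaved letters are at least 2 + 2 = 4 and all other letters of the tail are 2
  or 3, so the cap 4 hides the copied values and nothing else. The phase 6 is -20226 modulo
  24.\<close>

lemma sigma_cap:
  assumes "20226 \<le> n"
  shows "min (sigma n) 4 = sigma_pattern ! ((n + 6) mod 24)"
proof -
  define m where "m = n - 20226"
  have n: "n = 20226 + m" using assms by (simp add: m_def)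
  have "n + 6 = m + 24 * 843" by (simp add: n)
  then have r: "(n + 6) mod 24 = m mod 24" by (metis mod_mult_self2)
  have m: "m mod 24 mod 6 = m mod 6" by (rule mod_6_24)
  have "sigma_pattern ! (m mod 24) \<le> 4" "m mod 6 = 5 \<Longrightarrow> sigma_pattern ! (m mod 24) = 4"
    using less_24E[of "m mod 24"] m by (auto simp: sigma_pattern_def)
  then show ?thesis
    unfolding r using sigma_ge_2[of "m div 6"] by (subst sigma.simps) (simp add: n)
qed

text \<open>Here the interleaved letters are entries of \<sigma>, hence at least 2, and the others
  are 0 or 1. The phase 4 is -6764 modulo 24.\<close>

lemma wext_cap:
  assumes "6764 \<le> n"
  shows "min (wext n) 2 = w_pattern ! ((n + 4) mod 24)"
proof -
  define m where "m = n - 6764"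
  have n: "n = 6764 + m" using assms by (simp add: m_def)
  have "n + 4 = m + 24 * 282" by (simp add: n)
  then have r: "(n + 4) mod 24 = m mod 24" by (metis mod_mult_self2)
  have m: "m mod 24 mod 6 = m mod 6" by (rule mod_6_24)
  have "w_pattern ! (m mod 24) \<le> 2" "m mod 6 = 5 \<Longrightarrow> w_pattern ! (m mod 24) = 2"
    using less_24E[of "m mod 24"] m by (auto simp: w_pattern_def)
  then show ?thesis
    unfolding r using sigma_ge_2[of "m div 6"] by (simp add: n wext_def)
qed

section \<open>Agreement of the recursions with the stored letters\<close>

lemma blockD:
  assumes "block A P c d x" "r < 24" "0 < c"
  shows "letter_at A (num_of_nat (24 * nat_of_num x + c + r)) =
    (if r mod 6 = 5 then letter_at sigma_data (num_of_nat (4 * nat_of_num x + 4092 + r div 6)) + d else P ! r)"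
proof -
  define p where "p t = num.Bit0 (num.Bit0 x) + num_of_nat (4092 + t)" for t
  have p: "p t = num_of_nat (4 * nat_of_num x + 4092 + t)" for t
    unfolding p_def by (rule num_eq_iff[THEN iffD2])
      (simp add: nat_of_num_add num_of_nat_inverse del: num_of_nat.simps)
  let ?vs = "concat (map (\<lambda>t. [P ! (6 * t), P ! (6 * t + 1), P ! (6 * t + 2), P ! (6 * t + 3),
    P ! (6 * t + 4), letter_at sigma_data (p t) + d]) [0, 1, 2, 3])"
  have len: "length ?vs = 24" by simp
  have vs: "?vs ! r = (if r mod 6 = 5 then letter_at sigma_data (p (r div 6)) + d else P ! r)"
    using less_24E[OF assms(2)] by (auto, simp add: numeral_2_eq_2)
  have c: "num.Bit0 (num.Bit0 (num.Bit0 (num.Bit0 x + x))) + num_of_nat c =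
    num_of_nat (24 * nat_of_num x + c)"
    by (rule num_eq_iff[THEN iffD2])
      (use assms(3) nat_of_num_pos[of x] in \<open>simp add: nat_of_num_add num_of_nat_inverse del: num_of_nat.simps\<close>)
  have "seq A (num_of_nat (24 * nat_of_num x + c)) ?vs"
    using assms(1) unfolding block_def c p_def by simp
  from seq_sound[OF this, of r] show ?thesis
    unfolding len vs using assms(2,3) by (simp add: p)
qed

lemma block_word:
  assumes "all_from (block A P (N + 4072) d) 1 B" "m < 24 * B"
  shows "word A (N + m) = (if m mod 6 = 5 then word sigma_data (m div 6) + d else P ! (m mod 24))"
proof -
  define q r where "q = m div 24" and "r = m mod 24"
  have m: "m = 24 * q + r" "r < 24" by (simp_all add: q_def r_def)
  have x: "nat_of_num (num_of_nat (q + 1)) = q + 1" by (rule num_of_nat_inverse) simp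
  have "block A P (N + 4072) d (num_of_nat (q + 1))"
    using all_fromD[OF assms(1), of "q + 1"] assms(2) m by simp
  from blockD[OF this m(2)]
  have letter_at: "letter_at A (num_of_nat (24 * (q + 1) + (N + 4072) + r)) =
    (if r mod 6 = 5 then letter_at sigma_data (num_of_nat (4 * (q + 1) + 4092 + r div 6)) + d else P ! r)"
    unfolding x by simp
  have e: "24 * (q + 1) + (N + 4072) + r = N + m + 4096" "4 * (q + 1) + 4092 + r div 6 = m div 6 + 4096"
    "r mod 6 = m mod 6"
    using m by (simp_all add: r_def mod_6_24)
  show ?thesis
    using letter_at unfolding word_def e by (simp add: r_def)
qed

lemma sigma_eq_data:
  assumes "n < 25290"
  shows "sigma n = word sigma_data n"
proof (cases "n < 20226")
  case False
  define m where "m = n - 20226"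
  have n: "n = 20226 + m" "m < 24 * 211" using False assms by (simp_all add: m_def)
  \<comment> \<open>The stored part of the tail refers back to the prefix only, so the recursion is
    unfolded just once.\<close>
  have "m div 6 < 20226" using n(2) by simp
  then have "sigma (m div 6) = word sigma_data (m div 6)" by (subst sigma.simps) simp
  then show ?thesis
    using block_word[of sigma_data sigma_pattern 20226 2 211 m] sigma_block n by (subst sigma.simps) simp
qed (subst sigma.simps, simp)

lemma wext_eq_data:
  assumes "n < 8468"
  shows "wext n = word w_data n"
proof (cases "n < 6764")
  case False
  define m where "m = n - 6764"
  have n: "n = 6764 + m" "m < 24 * 71" using False assms by (simp_all add: m_def)
  have "sigma (m div 6) = word sigma_data (m div 6)" using n(2) by (intro sigma_eq_data) simp
  then show ?thesis
    using block_word[of w_data w_pattern 6764 0 71 m] w_block n by (simp add: wext_def)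
qed (simp add: wext_def)

text \<open>Excludes, inside the tail, all lengths |x| that are not divisible by 6; c stands for |x|
  mod 6.\<close>

lemma sigma_pat:
  assumes "1 \<le> c" "c < 6" "r < 24"
  shows "\<exists>a<c. sigma_pattern ! ((r + a) mod 24) \<noteq> sigma_pattern ! ((r + a + 4 * c) mod 24)"
proof -
  have "list_all (\<lambda>c. list_all (\<lambda>r. list_ex (\<lambda>a.
      sigma_pattern ! ((r + a) mod 24) \<noteq> sigma_pattern ! ((r + a + 4 * c) mod 24)) [0..<c]) [0..<24]) [1..<6]"
    by code_simp
  then show ?thesis using assms by (simp add: list_all_iff list_ex_iff) (metis atLeastLessThan_iff le0)
qed

lemma w_pat:
  assumes "1 \<le> c" "c < 6" "r < 24"
  shows "\<exists>a<c. w_pattern ! ((r + a) mod 24) \<noteq> w_pattern ! ((r + a + 4 * c) mod 24)"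
proof -
  have "list_all (\<lambda>c. list_all (\<lambda>r. list_ex (\<lambda>a.
      w_pattern ! ((r + a) mod 24) \<noteq> w_pattern ! ((r + a + 4 * c) mod 24)) [0..<c]) [0..<24]) [1..<6]"
    by code_simp
  then show ?thesis using assms by (simp add: list_all_iff list_ex_iff) (metis atLeastLessThan_iff le0)
qed

lemma sigma_chain:
  assumes "c < 6" "i < 20226"
  shows "\<exists>a. i \<le> a \<and> a < i + 1013 \<and>
    (c = 0 \<and> a = 20226 + 17 \<or> min (sigma a) 4 \<noteq> sigma_pattern ! ((a + 6 + 4 * c) mod 24))"
proof -
  have "c = 0 \<or> c = 1 \<or> c = 2 \<or> c = 3 \<or> c = 4 \<or> c = 5" using assms(1) by linarith
  then obtain as where "covers (deviates sigma_data sigma_pattern 20226 6 4 c) 20226 1013 0 as"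
    using sigma_chains by blast
  from covers_sound[OF this _ assms(2)] obtain a where
    a: "i \<le> a" "a < i + 1013" "deviates sigma_data sigma_pattern 20226 6 4 c a"
    by blast
  have "sigma a = word sigma_data a" using a(2) assms(2) by (intro sigma_eq_data) simp
  then show ?thesis using a unfolding deviates_def by metis
qed

lemma w_chain:
  assumes "c < 6" "i < 6764"
  shows "\<exists>a. i \<le> a \<and> a < i + 341 \<and>
    (c = 0 \<and> a = 6764 + 17 \<or> min (wext a) 2 \<noteq> w_pattern ! ((a + 4 + 4 * c) mod 24))"
proof -
  have "c = 0 \<or> c = 1 \<or> c = 2 \<or> c = 3 \<or> c = 4 \<or> c = 5" using assms(1) by linarith
  then obtain as where "covers (deviates w_data w_pattern 6764 4 2 c) 6764 341 0 as"
    using w_chains by blast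
  from covers_sound[OF this _ assms(2)] obtain a where
    a: "i \<le> a" "a < i + 341" "deviates w_data w_pattern 6764 4 2 c a"
    by blast
  have "wext a = word w_data a" using a(2) assms(2) by (intro wext_eq_data) simp
  then show ?thesis using a unfolding deviates_def by metis
qed

lemma sigma_2: "sigma 2 = 4"
  by (subst sigma.simps) (simp add: sigma_data_2)

text \<open>In the tail this is a matter of parity: 2 + 4j has even offset from 20226, whereas the
  interleaved places, the only ones with letters above 3, have odd offsets.\<close>

lemma sigma_ne_4:
  assumes "126 \<le> 6 * j"
  shows "sigma (2 + 4 * j) \<noteq> sigma 2"
proof (cases "2 + 4 * j < 20226")
  case True
  have x: "nat_of_num (num_of_nat j) = j" using assms by (intro num_of_nat_inverse) simp
  have p: "num.Bit0 (num.Bit0 (num_of_nat j)) + num_of_nat 4098 = num_of_nat (2 + 4 * j + 4096)"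
    by (rule num_eq_iff[THEN iffD2])
      (simp add: nat_of_num_add num_of_nat_inverse x del: num_of_nat.simps num_of_nat_numeral_eq)
  have "mult_4_ne_4 (num_of_nat j)" using all_fromD[OF sigma_data_ne4, of j] True assms by simp
  then have "word sigma_data (2 + 4 * j) \<noteq> 4" unfolding mult_4_ne_4_def word_def p .
  then show ?thesis using True by (subst sigma.simps) (simp add: sigma_2)
next
  case False
  define m where "m = 2 + 4 * j - 20226"
  have "even (m mod 24)" using False by (simp add: m_def dvd_mod_iff)
  then have "sigma_pattern ! (m mod 24) \<noteq> 4"
    using less_24E[of "m mod 24"] by (auto simp: sigma_pattern_def)
  moreover have "m mod 6 \<noteq> 5" using \<open>even (m mod 24)\<close> by (metis mod_6_24 dvd_mod_iff even_numeral odd_numeral)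
  ultimately show ?thesis
    using False by (subst sigma.simps) (simp add: sigma_2 m_def)
qed

section \<open>Absence of powers in both words\<close>

lemma conflict_cong:
  "(\<And>a. a < i + 5 * k \<Longrightarrow> f a = g a) \<Longrightarrow> conflict f i k \<longleftrightarrow> conflict g i k"
  unfolding conflict_def by (intro ex_cong conj_cong refl) auto

lemma sigma_conflict: "1 \<le> k \<Longrightarrow> conflict sigma i k"
proof (induction k arbitrary: i rule: less_induct)
  case (less k)
  show ?case
  proof (rule tail_conflict[where N = 20226 and K = 1013 and d = 2 and M = 4 and e = 6, OF sigma_star sigma_cap sigma_pat _ sigma_chain])
    \<comment> \<open>Both alternatives stay within the stored letters: i + 4k < 20226 gives k \<le>
      5056 and i + 5k \<le> 25281, and k < 1013 gives i + 5k \<le> 20225 + 5 * 1012 = 25285.\<close>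
    show "conflict sigma i k" if "i < 20226" "1 \<le> k" "i + 4 * k < 20226 \<or> k < 1013" for i k
      using that sigma_start[of k i] sigma_eq_data by (subst conflict_cong[of i k sigma "word sigma_data"]) auto
    show "sigma (2 + 4 * j) \<noteq> sigma 2" if "1013 \<le> 6 * j" for j
      using that by (intro sigma_ne_4) simp
    show "conflict sigma i j" if "k = 6 * j" "1 \<le> j" for i j
      using less.IH[of j i] that by simp
  qed (use less.prems in auto)
qed

lemma wext_conflict: "1 \<le> k \<Longrightarrow> conflict wext i k"
proof (rule tail_conflict[where N = 6764 and K = 341 and d = 0 and M = 2 and e = 4 and g = sigma, OF _ wext_cap w_pat _ w_chain])
  \<comment> \<open>Again within the stored letters: i + 4k < 6764 gives k \<le> 1690 and i + 5k
    \<le> 8453, and k < 341 gives i + 5k \<le> 6763 + 5 * 340 = 8463.\<close>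
  show "conflict wext i k" if "i < 6764" "1 \<le> k" "i + 4 * k < 6764 \<or> k < 341" for i k
    using that w_start[of k i] wext_eq_data by (subst conflict_cong[of i k wext "word w_data"]) auto
  show "sigma (2 + 4 * j) \<noteq> sigma 2" if "341 \<le> 6 * j" for j
    using that by (intro sigma_ne_4) simp
  show "wext (6764 + 6 * i + 5) = sigma i + 0" for i by (simp only: wext_star add_0_right)
qed (auto intro: sigma_conflict)

section \<open>Every smaller letter completes a power\<close>

lemma low_forbidden:
  assumes "low A ks b (num_of_nat (n + 4096))" "b \<le> v" "v < word A n"
    and "\<And>k. k \<in> set ks \<Longrightarrow> nat_of_num k \<le> 1365"
  shows "forbidden (word A) n v"
proof -
  have "covered A ks (num_of_nat (n + 4096)) v"
    using assms(1-3) by (auto simp: low_def list_all_iff word_def)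
  from covered_sound[OF this assms(4)] show ?thesis
    by (auto simp: forbidden_def)
qed

lemma nat_of_num_le:
  assumes "k \<in> set (map num_of_nat xs)" "list_all (\<lambda>x. x \<le> 1365) xs"
  shows "nat_of_num k \<le> 1365"
proof -
  obtain x where x: "k = num_of_nat x" "x \<le> 1365"
    using assms by (auto simp: list_all_iff)
  then show ?thesis
    by (cases "x = 0") (simp_all add: num_of_nat_inverse)
qed

lemma w_periods_le: "k \<in> set w_periods \<Longrightarrow> nat_of_num k \<le> 1365"
  unfolding w_periods_def by (erule nat_of_num_le) (simp only: list.pred_inject rel_simps simp_thms one_le_numeral)

lemma sigma_periods_le: "k \<in> set sigma_periods \<Longrightarrow> nat_of_num k \<le> 1365"
  unfolding sigma_periods_def by (erule nat_of_num_le) (simp only: list.pred_inject rel_simps simp_thms one_le_numeral)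

lemma forbidden_cong:
  assumes "\<And>m. m \<le> n \<Longrightarrow> f m = g m"
  shows "forbidden f n v = forbidden g n v"
  unfolding forbidden_def using assms by simp

lemma sigma_forbidden:
  assumes "8 \<le> n" "n < 20226" "2 \<le> v" "v < sigma n"
  shows "forbidden sigma n v"
proof -
  have "low sigma_data sigma_periods 2 (num_of_nat (n + 4096))"
    using all_fromD[OF sigma_low, of "n + 4096"] assms by simp
  then have "forbidden (word sigma_data) n v"
    using assms sigma_periods_le sigma_eq_data[of n] by (intro low_forbidden) simp_all
  then show ?thesis
    using forbidden_cong[of n sigma "word sigma_data"] sigma_eq_data assms by simp
qed

text \<open>The powers completed here have period 4 or 8.\<close>

lemma wext_forbidden_lt_2:
  assumes "6812 \<le> n" "v < 2" "v < wext n"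
  shows "forbidden wext n v"
proof -
  define r where "r = (n + 4) mod 24"
  have r: "r < 24" by (simp add: r_def)
  have cap: "min (wext (n - m)) 2 = w_pattern ! ((r + (24 - m)) mod 24)" if "m < 24" for m
  proof -
    have "n - m + 4 + 24 = n + 4 + (24 - m)" using assms(1) that by simp
    then have "(n - m + 4) mod 24 = (r + (24 - m)) mod 24"
      unfolding r_def by (metis mod_add_left_eq mod_add_self2)
    then show ?thesis using wext_cap[of "n - m"] assms(1) that by simp
  qed
  have eq: "wext (n - m) = c" if "min (wext (n - m)) 2 = c" "c < 2" for m c
    using that by (auto simp: min_def split: if_splits)
  have "w_pattern ! r = min (wext n) 2" using cap[of 0] r by simp
  then have v: "v < w_pattern ! r" using assms(2,3) by simp
  \<comment> \<open>All 24 phases: v stands 4 places back (|x| = 1), or 8 places back with equal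
    letters before both places (|x| = 2). A pattern entry below 2 is the true letter, so the
    repetition holds in the word and not only after capping.\<close>
  have dich: "w_pattern ! ((r + 20) mod 24) = v \<or>
      w_pattern ! ((r + 16) mod 24) = v \<and>
      w_pattern ! ((r + 23) mod 24) = w_pattern ! ((r + 15) mod 24) \<and> w_pattern ! ((r + 15) mod 24) < 2"
    using less_24E[OF r] v assms(2) by (auto simp: w_pattern_def less_2_cases_iff)
  then show ?thesis
  proof
    assume "w_pattern ! ((r + 20) mod 24) = v"
    then have "wext (n - 4) = v" using cap[of 4] assms(2) by (intro eq) simp_all
    then show ?thesis
      unfolding forbidden_def using assms(1) by (intro exI[of _ 1]) auto
  next
    assume *: "w_pattern ! ((r + 16) mod 24) = v \<and>
      w_pattern ! ((r + 23) mod 24) = w_pattern ! ((r + 15) mod 24) \<and> w_pattern ! ((r + 15) mod 24) < 2"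
    have "wext (n - 8) = v" using * cap[of 8] assms(2) by (intro eq) simp_all
    moreover have "wext (n - 1) = wext (n - 9)"
      using * cap[of 1] cap[of 9] eq[of 1] eq[of 9] by simp
    ultimately show ?thesis
      unfolding forbidden_def using assms(1)
      by (intro exI[of _ 2]) (auto simp: less_2_cases_iff numeral_2_eq_2 less_Suc_eq)
  qed
qed

text \<open>Up to 128120 = 6764 + 6 * 20226, the interleaved letters are the entries of \<sigma>
  with index below 20226, those for which \<open>sigma_low\<close> excludes smaller letters.\<close>

lemma wext_forbidden:
  assumes "n < 128120" "v < wext n"
  shows "forbidden wext n v"
proof (cases "n < 6812")
  case True
  have "low w_data w_periods 0 (num_of_nat (n + 4096))"
    using all_fromD[OF w_low, of "n + 4096"] True by simp
  then have "forbidden (word w_data) n v"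
    using assms True w_periods_le wext_eq_data[of n] by (intro low_forbidden[of w_data w_periods 0]) simp_all
  then show ?thesis
    using forbidden_cong[of n wext "word w_data"] wext_eq_data True by simp
next
  case n: False
  show ?thesis
  proof (cases "v < 2")
    case True
    then show ?thesis using wext_forbidden_lt_2 n assms(2) by simp
  next
    case False
    define m where "m = n - 6764"
    have m: "n = 6764 + m" "48 \<le> m" "m < 121356" using n assms(1) by (simp_all add: m_def)
    \<comment> \<open>All other letters of the tail are 0 or 1 and leave no room for a smaller v
      \<ge> 2.\<close>
    have "m mod 6 = 5"
    proof (rule ccontr)
      assume m5: "m mod 6 \<noteq> 5"
      then have "wext n = w_pattern ! (m mod 24)" by (simp add: wext_def m(1))
      moreover have "w_pattern ! (m mod 24) < 2"
        using less_24E[of "m mod 24"] m5 mod_6_24[of m] by (auto simp: w_pattern_def)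
      ultimately show False using assms(2) False by simp
    qed
    then obtain i where i: "m = 6 * i + 5" by (metis mult_div_mod_eq)
    then have n: "n = 6764 + 6 * i + 5" using m(1) by simp
    have "forbidden sigma i v"
      using i m(2,3) assms(2) False n wext_star[of i] by (intro sigma_forbidden) simp_all
    then obtain k where k: "1 \<le> k" "5 * k \<le> i + 1" "sigma (i - 4 * k) = v"
      "\<And>j. 1 \<le> j \<Longrightarrow> j < k \<Longrightarrow> sigma (i - j) = sigma (i - 4 * k - j)"
      by (auto simp: forbidden_def)
    have star: "wext (n - 6 * j) = sigma (i - j)" if "j \<le> i" for j
    proof -
      have "n - 6 * j = 6764 + 6 * (i - j) + 5" using that n by simp
      then show ?thesis by (simp only: wext_star)
    qed
    \<comment> \<open>The power in \<sigma> is stretched by 6. It still lies in the tail, as 30k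
      \<le> 6i + 6 = m + 1. Its interleaved letters repeat by the choice of k, the others because
      its period 24k is a multiple of 24.\<close>
    show ?thesis
      unfolding forbidden_def
    proof (intro exI[of _ "6 * k"] conjI allI impI)
      show "wext (n - 4 * (6 * k)) = v"
        using star[of "4 * k"] k(1-3) by simp
      fix j assume j: "1 \<le> j \<and> j < 6 * k"
      show "wext (n - j) = wext (n - 4 * (6 * k) - j)"
      proof (cases "j mod 6 = 0")
        case True
        then obtain l where l: "j = 6 * l" by auto
        have "wext (n - 6 * l) = wext (n - 6 * (4 * k + l))"
          using star[of l] star[of "4 * k + l"] k(4)[of l] k(1,2) j l by simp
        then show ?thesis by (simp add: l algebra_simps)
      next
        case False
        define x where "x = m - 24 * k - j"
        have x: "n - 4 * (6 * k) - j = 6764 + x" "n - j = 6764 + (x + 24 * k)" "x + 24 * k + j = m"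
          using n j k(2) m(1) i by (simp_all add: x_def)
        have "x mod 6 \<noteq> 5"
        proof
          assume "x mod 6 = 5"
          then obtain p where "x = 6 * p + 5" by (metis mult_div_mod_eq)
          then have "j = 6 * (i - 4 * k - p)" using x(3) i by simp
          then show False using False by simp
        qed
        moreover have "(x + 24 * k) mod 6 = x mod 6"
          using mod_mult_self2[of x 6 "4 * k"] by simp
        ultimately show ?thesis unfolding x(1,2) by (simp add: wext_def)
      qed
    qed (use k n in auto)
  qed
qed

lemma w54_eq_wext: "n < 128120 \<Longrightarrow> w54 !! n = wext n"
  using least_eq_prefix[OF is_lex_least_power_free_w54, of wext 128120 n] wext_conflict wext_forbidden by blast

section \<open>The morphism\<close>

text \<open>The number d_j: the last letter of \<open>phi_letter (n, j)\<close> has value n +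
  d_j.\<close>

definition shift :: "nat \<Rightarrow> int" where
  "shift j = [3, 2, 3, 2, 1, 2, 1, 2] ! j"

lemma length_phi_letter: "length (phi_letter x) = 6"
  by (cases x) simp

lemma phi_nth:
  "i < length u \<Longrightarrow> r < 6 \<Longrightarrow> phi u ! (6 * i + r) = phi_letter (u ! i) ! r"
proof (induction u arbitrary: i)
  case (Cons x u)
  then show ?case
    by (cases i) (simp_all add: phi_def nth_append length_phi_letter del: phi_letter.simps)
qed simp

lemma phi_inf_shift: "phi_inf s = phi_letter (shd s) @- phi_inf (stl s)"
  unfolding phi_inf_def using length_phi_letter[of "shd s"]
  by (subst flat_unfold) auto

lemma phi_inf_append: "phi_inf (u @- s) = phi u @- phi_inf s"
  by (induction u) (simp_all add: phi_def phi_inf_shift[of "_ ## _"] del: phi_letter.simps)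

lemma phi_inf_nth: "r < 6 \<Longrightarrow> phi_inf s !! (6 * i + r) = phi_letter (s !! i) ! r"
proof (induction i arbitrary: s)
  case 0
  then show ?case by (subst phi_inf_shift) (simp add: length_phi_letter del: phi_letter.simps)
next
  case (Suc i)
  have "phi_inf s !! (6 * Suc i + r) = phi_inf (stl s) !! (6 * i + r)"
    by (subst phi_inf_shift) (simp add: length_phi_letter shift_snth_ge del: phi_letter.simps)
  then show ?case using Suc by simp
qed

lemma length_phi: "length (phi u) = 6 * length u"
  by (induction u) (simp_all add: phi_def length_phi_letter del: phi_letter.simps)

lemma iterated_word_unfold: "u \<noteq> [] \<Longrightarrow> iterated_word u = u @- iterated_word (phi u)"
  unfolding iterated_word_def by (subst siterate.ctr) simp

text \<open>Together with \<open>iterated_word_unfold\<close> this is the equation s = z \<phi>(s).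
  Both sides begin with \<phi>(u); removing this nonempty block leaves the same claim for \<phi>(u)
  at a smaller position.\<close>

lemma iterated_word_phi:
  "u \<noteq> [] \<Longrightarrow> iterated_word (phi u) !! n = phi_inf (iterated_word u) !! n"
proof (induction n arbitrary: u rule: less_induct)
  case (less n)
  have ne: "phi u \<noteq> []" using less.prems length_phi[of u] by auto
  show ?case
  proof (cases "n < length (phi u)")
    case True
    then show ?thesis
      using less.prems ne
      by (subst iterated_word_unfold) (simp_all add: iterated_word_unfold[of u] phi_inf_append)
  next
    case False
    have "n - length (phi u) < n" using False ne by (cases "phi u") auto
    then show ?thesis
      using less.IH[of "n - length (phi u)" "phi u"] False less.prems ne
      by (simp add: iterated_word_unfold[of u] iterated_word_unfold[of "phi u"] phi_inf_append shift_snth_ge)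
  qed
qed

text \<open>If letter t of s is known to be \<open>sigma t\<close> decorated with its subscript,
  then so are the six letters of its image, at positions 20226 + 6t + r. For r = 5 the new subscript
  is odd, where \<open>shift\<close> is 2; this is the summand 2 in the recursion of
  \<open>sigma\<close>.\<close>

lemma letter_step:
  fixes s :: "letter stream"
  assumes "s !! t = (int (sigma t) - shift ((t + 2) mod 8), (t + 2) mod 8)" "r < 6"
  shows "phi_letter (s !! t) ! r =
      (int (sigma (20226 + (6 * t + r))) - shift ((20226 + (6 * t + r) + 2) mod 8), (20226 + (6 * t + r) + 2) mod 8)"
    and "tau (phi_letter (s !! t) ! r) = int (wext (6764 + (6 * t + r)))"
proof -
  \<comment> \<open>The residue b of t modulo 8 fixes the subscripts and, since 6 * 8 = 2 * 24, also
    the place in the pattern. This leaves 48 pairs of b and r.\<close>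
  define a b where "a = t div 8" and "b = t mod 8"
  have t: "t = 8 * a + b" "b < 8" by (simp_all add: a_def b_def)
  have b: "b \<in> {0,1,2,3,4,5,6,7}" and r: "r \<in> {0,1,2,3,4,5}"
    using t(2) assms(2) by (simp, presburger)+
  have "6 * t + r = 6 * b + r + 24 * (2 * a)" by (simp add: t(1))
  then have m24: "(6 * t + r) mod 24 = (6 * b + r) mod 24" by (metis mod_mult_self2)
  have "20226 + (6 * t + r) + 2 = 6 * b + r + 4 + 8 * (6 * a + 2528)" by (simp add: t(1))
  then have m8: "(20226 + (6 * t + r) + 2) mod 8 = (6 * b + r + 4) mod 8" by (metis mod_mult_self2)
  have "t + 2 = b + 2 + 8 * a" by (simp add: t(1))
  then have t8: "(t + 2) mod 8 = (b + 2) mod 8" by (metis mod_mult_self2)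
  have sigma: "sigma (20226 + (6 * t + r)) = (if r = 5 then sigma t + 2 else sigma_pattern ! ((6 * b + r) mod 24))"
    using assms(2) m24 by (subst sigma.simps) simp
  have wext: "wext (6764 + (6 * t + r)) = (if r = 5 then sigma t else w_pattern ! ((6 * b + r) mod 24))"
    using assms(2) m24 by (simp add: wext_def)
  show "phi_letter (s !! t) ! r =
      (int (sigma (20226 + (6 * t + r))) - shift ((20226 + (6 * t + r) + 2) mod 8), (20226 + (6 * t + r) + 2) mod 8)"
    unfolding assms(1) sigma m8 t8 using b r by (elim insertE emptyE) (simp_all add: shift_def sigma_pattern_def)
  show "tau (phi_letter (s !! t) ! r) = int (wext (6764 + (6 * t + r)))"
    unfolding assms(1) wext t8 using b r by (elim insertE emptyE) (simp_all add: shift_def w_pattern_def tau_def)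
qed

theorem theorem5p7:
  fixes z :: "letter list"
  assumes "set z \<subseteq> Sigma8"
    and "subscript_increasing z"
    and "length z = 20226"
    and "hd z = (0, 2)"
    and "map tau (phi z) = map int (stake (6 * 20226) (sdrop 6764 w54))"
  shows "five_fourths_power_free
           (map int (stake 6764 w54) @- smap tau (phi_inf (iterated_word z)))"
proof -
  have sub: "snd (z ! i) = (i + 2) mod 8" if "i < 20226" for i
    using that
  proof (induction i)
    case 0
    then show ?case using assms(3,4) by (cases z) auto
  next
    case (Suc i)
    then show ?case using assms(2,3) by (simp add: subscript_increasing_def mod_Suc_eq)
  qed
  \<comment> \<open>The last letter of block i of \<phi>(z) is letter 6764 + 6i + 5 of
    \<open>w54\<close>, hence equal to \<open>sigma i\<close>; subtracting d_j recovers n. So the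
    hypotheses determine z completely.\<close>
  have z: "z ! i = (int (sigma i) - shift ((i + 2) mod 8), (i + 2) mod 8)" if i: "i < 20226" for i
  proof -
    obtain m where m: "z ! i = (m, (i + 2) mod 8)" using sub[OF i] by (metis prod.collapse)
    have "tau (phi z ! (6 * i + 5)) = int (w54 !! (6764 + (6 * i + 5)))"
      using arg_cong[OF assms(5), of "\<lambda>u. u ! (6 * i + 5)"] i assms(3)
      by (simp add: length_phi sdrop_snth)
    also have "\<dots> = int (sigma i)"
      using w54_eq_wext[of "6764 + (6 * i + 5)"] wext_star[of i] i by (simp add: add.assoc)
    also have "phi z ! (6 * i + 5) = phi_letter (m, (i + 2) mod 8) ! 5"
      using phi_nth[of i z 5] i assms(3) m by (simp del: phi_letter.simps)
    also have "tau (phi_letter (m, j) ! 5) = m + shift j" if "j < 8" for j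
    proof -
      have "j \<in> {0,1,2,3,4,5,6,7}" using that by (simp, presburger)
      then show ?thesis by (auto simp: tau_def shift_def)
    qed
    then have "tau (phi_letter (m, (i + 2) mod 8) ! 5) = m + shift ((i + 2) mod 8)" by simp
    finally show ?thesis using m by simp
  qed
  let ?s = "iterated_word z"
  have ne: "z \<noteq> []" using assms(3) by auto
  \<comment> \<open>A letter beyond z belongs to \<phi>(s) and stems from the earlier letter t, so
    the closed form propagates by strong induction.\<close>
  have s: "?s !! i = (int (sigma i) - shift ((i + 2) mod 8), (i + 2) mod 8)" for i
  proof (induction i rule: less_induct)
    case (less i)
    show ?case
    proof (cases "i < 20226")
      case True
      then show ?thesis using z assms(3) ne by (simp add: iterated_word_unfold)
    next
      case False
      define t r where "t = (i - 20226) div 6" and "r = (i - 20226) mod 6"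
      have i: "i = 20226 + (6 * t + r)" "r < 6" "t < i" using False by (auto simp: t_def r_def)
      have "?s !! i = phi_inf ?s !! (6 * t + r)"
        using iterated_word_unfold[OF ne] iterated_word_phi[OF ne] i(1) assms(3)
        by (metis add_diff_cancel_left' le_add1 shift_snth_ge)
      then show ?thesis
        using letter_step(1)[OF less.IH[OF i(3)] i(2)] phi_inf_nth[OF i(2), of ?s t] i(1) by simp
    qed
  qed
  let ?f = "map int (stake 6764 w54) @- smap tau (phi_inf ?s)"
  \<comment> \<open>Below 6764 this is the identification of \<open>w54\<close>, beyond it the
    second part of \<open>letter_step\<close>.\<close>
  have f: "?f !! n = int (wext n)" for n
  proof (cases "n < 6764")
    case True
    then show ?thesis using w54_eq_wext by simp
  next
    case False
    define t r where "t = (n - 6764) div 6" and "r = (n - 6764) mod 6"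
    have n: "n = 6764 + (6 * t + r)" "r < 6" using False by (auto simp: t_def r_def)
    have "?f !! n = tau (phi_inf ?s !! (6 * t + r))"
      using n(1) by (simp add: shift_snth_ge)
    then show ?thesis
      using letter_step(2)[OF s n(2)] phi_inf_nth[OF n(2), of ?s t] n(1) by simp
  qed
  show ?thesis
    by (rule power_free_if_conflict) (use wext_conflict in \<open>auto simp: f conflict_def\<close>)
qed

end
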